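(* Let $p\in\mathbb{R}$ with $p>1$ and let $G$ be a finitely generated, infinite nilpotent group. Then $\overline{H^{(p)}_i(G)}=0$ and $\overline{H_{(p)}^i(G)}=0$ for all $i\in\mathbb{N}$.
   Context: $\mathbb{Z}[G]$ is the integral group ring and $\mathbb{Z}$ is the trivial $\mathbb{Z}[G]$-module. A group $G$ is of type $FP_n$ if there is an exact sequence $F_n\to\dots\to F_0\to\mathbb{Z}\to 0$ of $\mathbb{Z}[G]$-modules with $F_0,\dots,F_n$ projective and finitely generated; the groups in the claim are of type $FP_n$ for every $n$. For real $p\ge 1$, $l^p(G)$ is the Banach space of formal sums $f=\sum_{g\in G}f_g g$ with $f_g\in\mathbb{C}$, only countably many $f_g\ne 0$, and $\sum_{g}|f_g|^p=(|f|_p)^p<\infty$; it is a $\mathbb{Z}[G]$-module via translation by $G$. For a projective resolution $\cdots\to F_2\xrightarrow{\partial_2}F_1\xrightarrow{\partial_1}F_0\xrightarrow{\varepsilon}\mathbb{Z}\to 0$ over $\mathbb{Z}[G]$, consider the chain complex $F_i\otimes_{\mathbb{Z}[G]}l^p(G)$, $i\ge0$, with boundary maps $\partial_i\otimes 1$ (left modules being turned into right modules via $xg=g^{-1}x$ when forming tensor products), and the cochain complex $\operatorname{Hom}_{\mathbb{Z}[G]}(F_i,l^p(G))$, $i\ge 0$, with $\widetilde\partial_i(\varphi)=\varphi\circ\partial_i$ (maps with index $0$ are zero). The reduced $l^p$-homology and $l^p$-cohomology are $\overline{H^{(p)}_i(G)}=\ker(\partial_i\otimes1)/\overline{\operatorname{im}(\partial_{i+1}\otimes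 1)}$ and $\overline{H_{(p)}^i(G)}=\ker(\widetilde\partial_{i+1})/\overline{\operatorname{im}(\widetilde\partial_i)}$. For $G$ of type $FP_n$ the resolution is taken with $F_0,\dots,F_n$ finitely generated; then for $i\le n$ the spaces $F_i\otimes_{\mathbb{Z}[G]}l^p(G)$ and $\operatorname{Hom}_{\mathbb{Z}[G]}(F_i,l^p(G))$ carry natural Banach space topologies (both are $l^p(G)^{m_i}$ if $F_i$ is free of rank $m_i$), in which the closures are taken. *)

theory Defs
  imports "HOL-Analysis.Analysis" "HOL-Algebra.Algebra"
begin

section \<open>Finitely generated and nilpotent groups\<close>

definition finitely_generated_group :: "('g, 'x) monoid_scheme \<Rightarrow> bool" where
  "finitely_generated_group G \<longleftrightarrow>
     group G \<and> (\<exists>S. finite S \<and> S \<subseteq> carrier G \<and> generate G S = carrier G)"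

primrec lower_central_series :: "('g, 'x) monoid_scheme \<Rightarrow> nat \<Rightarrow> 'g set" where
  "lower_central_series G 0 = carrier G"
| "lower_central_series G (Suc n) =
     generate G (\<Union>x \<in> lower_central_series G n. \<Union>y \<in> carrier G.
       {x \<otimes>\<^bsub>G\<^esub> y \<otimes>\<^bsub>G\<^esub> inv\<^bsub>G\<^esub> x \<otimes>\<^bsub>G\<^esub> inv\<^bsub>G\<^esub> y})"

definition nilpotent_group :: "('g, 'x) monoid_scheme \<Rightarrow> bool" where
  "nilpotent_group G \<longleftrightarrow> group G \<and> (\<exists>n. lower_central_series G n = {\<one>\<^bsub>G\<^esub>})"


section \<open>Modules over a not necessarily commutative ring\<close>

text \<open>The library locale for modules requires a commutative ring; only its record type of
  modules is reused here. The ring multiplication fields of that record play no role.\<close>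

locale left_module = R?: ring R + M?: abelian_group M
  for R :: "('r, 'x) ring_scheme" (structure) and M :: "('r, 'm, 'y) module_scheme" (structure) +
  assumes smult_closed [simp, intro]:
      "\<lbrakk>a \<in> carrier R; x \<in> carrier M\<rbrakk> \<Longrightarrow> a \<odot>\<^bsub>M\<^esub> x \<in> carrier M"
    and smult_l_distr:
      "\<lbrakk>a \<in> carrier R; b \<in> carrier R; x \<in> carrier M\<rbrakk> \<Longrightarrow>
        (a \<oplus>\<^bsub>R\<^esub> b) \<odot>\<^bsub>M\<^esub> x = a \<odot>\<^bsub>M\<^esub> x \<oplus>\<^bsub>M\<^esub> b \<odot>\<^bsub>M\<^esub> x"
    and smult_r_distr:
      "\<lbrakk>a \<in> carrier R; x \<in> carrier M; y \<in> carrier M\<rbrakk> \<Longrightarrow>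
        a \<odot>\<^bsub>M\<^esub> (x \<oplus>\<^bsub>M\<^esub> y) = a \<odot>\<^bsub>M\<^esub> x \<oplus>\<^bsub>M\<^esub> a \<odot>\<^bsub>M\<^esub> y"
    and smult_assoc:
      "\<lbrakk>a \<in> carrier R; b \<in> carrier R; x \<in> carrier M\<rbrakk> \<Longrightarrow>
        (a \<otimes>\<^bsub>R\<^esub> b) \<odot>\<^bsub>M\<^esub> x = a \<odot>\<^bsub>M\<^esub> (b \<odot>\<^bsub>M\<^esub> x)"
    and smult_one [simp]: "x \<in> carrier M \<Longrightarrow> \<one>\<^bsub>R\<^esub> \<odot>\<^bsub>M\<^esub> x = x"

definition linear_map ::
  "('r, 'x) ring_scheme \<Rightarrow> ('r, 'm, 'y) module_scheme \<Rightarrow> ('r, 'n, 'z) module_scheme \<Rightarrow> ('m \<Rightarrow> 'n) \<Rightarrow> bool"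
where
  "linear_map R M N h \<longleftrightarrow>
     h \<in> carrier M \<rightarrow> carrier N \<and>
     (\<forall>x \<in> carrier M. \<forall>y \<in> carrier M. h (x \<oplus>\<^bsub>M\<^esub> y) = h x \<oplus>\<^bsub>N\<^esub> h y) \<and>
     (\<forall>a \<in> carrier R. \<forall>x \<in> carrier M. h (a \<odot>\<^bsub>M\<^esub> x) = a \<odot>\<^bsub>N\<^esub> h x)"

definition finitely_generated_module ::
  "('r, 'x) ring_scheme \<Rightarrow> ('r, 'm, 'y) module_scheme \<Rightarrow> bool" where
  "finitely_generated_module R M \<longleftrightarrow>
     (\<exists>S. finite S \<and> S \<subseteq> carrier M \<and>
        (\<forall>x \<in> carrier M. \<exists>a \<in> S \<rightarrow> carrier R. x = (\<Oplus>\<^bsub>M\<^esub>s\<in>S. a s \<odot>\<^bsub>M\<^esub> s)))"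

definition free_module :: "('r, 'x) ring_scheme \<Rightarrow> 'b set \<Rightarrow> ('r, 'b \<Rightarrow> 'r) module" where
  "free_module R B =
     \<lparr>carrier = {f. (\<forall>b \<in> B. f b \<in> carrier R) \<and> (\<forall>b. b \<notin> B \<longrightarrow> f b = \<zero>\<^bsub>R\<^esub>) \<and>
                   finite {b. f b \<noteq> \<zero>\<^bsub>R\<^esub>}},
      monoid.mult = undefined, one = undefined,
      ring.zero = (\<lambda>b. \<zero>\<^bsub>R\<^esub>), ring.add = (\<lambda>f f' b. f b \<oplus>\<^bsub>R\<^esub> f' b),
      module.smult = (\<lambda>r f b. r \<otimes>\<^bsub>R\<^esub> f b)\<rparr>"

text \<open>Projective means: direct summand of a free module, that is, a retract of one via linear maps
  \<open>s\<close> and \<open>r\<close>. It is no restriction that the basis \<open>B\<close> is taken in the type of elements of \<open>P\<close>,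
  because a projective module is a retract of the free module on its underlying set.\<close>

definition projective_module ::
  "('r, 'x) ring_scheme \<Rightarrow> ('r, 'm, 'y) module_scheme \<Rightarrow> bool" where
  "projective_module R P \<longleftrightarrow>
     left_module R P \<and>
     (\<exists>(B :: 'm set) s r.
        linear_map R P (free_module R B) s \<and> linear_map R (free_module R B) P r \<and>
        (\<forall>x \<in> carrier P. r (s x) = x))"

definition Hom_group ::
  "('r, 'x) ring_scheme \<Rightarrow> ('r, 'm, 'y) module_scheme \<Rightarrow> ('r, 'n, 'z) module_scheme \<Rightarrow> ('m \<Rightarrow> 'n) monoid"
where
  "Hom_group R M N =
     \<lparr>carrier = {\<phi> \<in> extensional (carrier M). linear_map R M N \<phi>},
      monoid.mult = (\<lambda>\<phi> \<psi>. \<lambda>x\<in>carrier M. \<phi> x \<oplus>\<^bsub>N\<^esub> \<psi> x),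
      one = (\<lambda>x\<in>carrier M. \<zero>\<^bsub>N\<^esub>)\<rparr>"


section \<open>Tensor products over a noncommutative ring\<close>

text \<open>Here \<open>M\<close> is a right \<open>R\<close>-module and \<open>N\<close> a left \<open>R\<close>-module. The
  right multiplication of \<open>x \<in> M\<close> by \<open>a \<in> R\<close> is stored in the scalar multiplication field of \<open>M\<close>,
  so that \<open>a \<odot>\<^bsub>M\<^esub> x\<close> stands for the element usually written \<open>xa\<close>. The tensor product is a
  quotient of the free abelian group on pairs and is written as a multiplicative group.\<close>

definition tensor_relations ::
  "('r, 'x) ring_scheme \<Rightarrow> ('r, 'm, 'y) module_scheme \<Rightarrow> ('r, 'n, 'z) module_scheme \<Rightarrow> ('m \<times> 'n \<Rightarrow>\<^sub>0 int) set"
where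
  "tensor_relations R M N =
     {frag_of (x \<oplus>\<^bsub>M\<^esub> x', y) - frag_of (x, y) - frag_of (x', y) | x x' y.
        x \<in> carrier M \<and> x' \<in> carrier M \<and> y \<in> carrier N} \<union>
     {frag_of (x, y \<oplus>\<^bsub>N\<^esub> y') - frag_of (x, y) - frag_of (x, y') | x y y'.
        x \<in> carrier M \<and> y \<in> carrier N \<and> y' \<in> carrier N} \<union>
     {frag_of (a \<odot>\<^bsub>M\<^esub> x, y) - frag_of (x, a \<odot>\<^bsub>N\<^esub> y) | a x y.
        a \<in> carrier R \<and> x \<in> carrier M \<and> y \<in> carrier N}"

definition tensor_kernel ::
  "('r, 'x) ring_scheme \<Rightarrow> ('r, 'm, 'y) module_scheme \<Rightarrow> ('r, 'n, 'z) module_scheme \<Rightarrow> ('m \<times> 'n \<Rightarrow>\<^sub>0 int) set"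
where
  "tensor_kernel R M N =
     generate (free_Abelian_group (carrier M \<times> carrier N)) (tensor_relations R M N)"

definition tensor_class ::
  "('r, 'x) ring_scheme \<Rightarrow> ('r, 'm, 'y) module_scheme \<Rightarrow> ('r, 'n, 'z) module_scheme \<Rightarrow>
    ('m \<times> 'n \<Rightarrow>\<^sub>0 int) \<Rightarrow> ('m \<times> 'n \<Rightarrow>\<^sub>0 int) set"
where
  "tensor_class R M N u =
     tensor_kernel R M N #>\<^bsub>free_Abelian_group (carrier M \<times> carrier N)\<^esub> u"

definition tensor_product ::
  "('r, 'x) ring_scheme \<Rightarrow> ('r, 'm, 'y) module_scheme \<Rightarrow> ('r, 'n, 'z) module_scheme \<Rightarrow>
    ('m \<times> 'n \<Rightarrow>\<^sub>0 int) set monoid"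
where
  "tensor_product R M N =
     free_Abelian_group (carrier M \<times> carrier N) Mod tensor_kernel R M N"

text \<open>The map \<open>h \<otimes> 1\<close> induced by a linear map \<open>h\<close> from \<open>M\<close> to \<open>M'\<close>. All representatives of a
  coset \<open>c\<close> have the same image, so \<open>the_elem\<close> is applied to a singleton.\<close>

definition tensor_map ::
  "('r, 'x) ring_scheme \<Rightarrow> ('r, 'm, 'y) module_scheme \<Rightarrow> ('r, 'n, 'z) module_scheme \<Rightarrow>
    ('m \<Rightarrow> 'm) \<Rightarrow> ('m \<times> 'n \<Rightarrow>\<^sub>0 int) set \<Rightarrow> ('m \<times> 'n \<Rightarrow>\<^sub>0 int) set"
where
  "tensor_map R M' N h c =
     the_elem ((\<lambda>u. tensor_class R M' N (frag_extend (\<lambda>(x, y). frag_of (h x, y)) u)) ` c)"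


section \<open>The integral group ring and its modules\<close>

text \<open>\<open>group_convolution G a f\<close> is the sum of the translates \<open>a\<^sub>x (x f)\<close> over \<open>x \<in> G\<close>, where
  \<open>(x f)\<^sub>g = f\<^bsub>x\<^sup>-\<^sup>1g\<^esub>\<close>. It serves both as the product of the group ring and as the action of the
  group ring on functions.\<close>

definition group_convolution ::
  "('g, 'x) monoid_scheme \<Rightarrow> ('g \<Rightarrow> int) \<Rightarrow> ('g \<Rightarrow> 'k::ring_1) \<Rightarrow> 'g \<Rightarrow> 'k" where
  "group_convolution G a f =
     (\<lambda>g. if g \<in> carrier G
          then \<Sum>x | x \<in> carrier G \<and> a x \<noteq> 0. of_int (a x) * f (inv\<^bsub>G\<^esub> x \<otimes>\<^bsub>G\<^esub> g) else 0)"

definition int_group_ring :: "('g, 'x) monoid_scheme \<Rightarrow> ('g \<Rightarrow> int) ring" where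
  "int_group_ring G =
     \<lparr>carrier = {a. (\<forall>g. g \<notin> carrier G \<longrightarrow> a g = 0) \<and> finite {g. a g \<noteq> 0}},
      monoid.mult = group_convolution G, one = (\<lambda>g. if g = \<one>\<^bsub>G\<^esub> then 1 else 0),
      ring.zero = (\<lambda>g. 0), ring.add = (\<lambda>a b g. a g + b g)\<rparr>"

definition trivial_int_module :: "('g, 'x) monoid_scheme \<Rightarrow> ('g \<Rightarrow> int, int) module" where
  "trivial_int_module G =
     \<lparr>carrier = UNIV, monoid.mult = undefined, one = undefined, ring.zero = 0, ring.add = (+),
      module.smult = (\<lambda>a k. (\<Sum>g | g \<in> carrier G \<and> a g \<noteq> 0. a g) * k)\<rparr>"

text \<open>A left module is turned into a right module by \<open>xg = g\<^sup>-\<^sup>1x\<close> for \<open>g \<in> G\<close>; a general element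
  of the group ring acts through the anti-involution determined by \<open>g \<mapsto> g\<^sup>-\<^sup>1\<close>.\<close>

definition group_ring_involution :: "('g, 'x) monoid_scheme \<Rightarrow> ('g \<Rightarrow> int) \<Rightarrow> 'g \<Rightarrow> int" where
  "group_ring_involution G a = (\<lambda>g. if g \<in> carrier G then a (inv\<^bsub>G\<^esub> g) else 0)"

definition to_right_module ::
  "('g, 'x) monoid_scheme \<Rightarrow> ('g \<Rightarrow> int, 'm) module \<Rightarrow> ('g \<Rightarrow> int, 'm) module" where
  "to_right_module G M =
     M\<lparr>module.smult := \<lambda>a x. group_ring_involution G a \<odot>\<^bsub>M\<^esub> x\<rparr>"

definition projective_resolution ::
  "('g, 'x) monoid_scheme \<Rightarrow> (nat \<Rightarrow> ('g \<Rightarrow> int, 'm) module) \<Rightarrow> (nat \<Rightarrow> 'm \<Rightarrow> 'm) \<Rightarrow> ('m \<Rightarrow> int) \<Rightarrow> bool"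
where
  "projective_resolution G F d \<epsilon> \<longleftrightarrow>
     (\<forall>i. projective_module (int_group_ring G) (F i)) \<and>
     (\<forall>i. linear_map (int_group_ring G) (F (Suc i)) (F i) (d (Suc i))) \<and>
     linear_map (int_group_ring G) (F 0) (trivial_int_module G) \<epsilon> \<and>
     \<epsilon> ` carrier (F 0) = carrier (trivial_int_module G) \<and>
     d 1 ` carrier (F 1) = {x \<in> carrier (F 0). \<epsilon> x = 0} \<and>
     (\<forall>i. d (Suc (Suc i)) ` carrier (F (Suc (Suc i))) =
          {x \<in> carrier (F (Suc i)). d (Suc i) x = \<zero>\<^bsub>F i\<^esub>})"


section \<open>The Banach space \<open>l\<^sup>p(G)\<close>\<close>

text \<open>Summability of the real family already forces the support to be countable.\<close>

definition lp_space :: "('g, 'x) monoid_scheme \<Rightarrow> real \<Rightarrow> ('g \<Rightarrow> complex) set" where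
  "lp_space G p =
     {f. (\<forall>g. g \<notin> carrier G \<longrightarrow> f g = 0) \<and> (\<lambda>g. norm (f g) powr p) summable_on carrier G}"

definition lp_norm :: "('g, 'x) monoid_scheme \<Rightarrow> real \<Rightarrow> ('g \<Rightarrow> complex) \<Rightarrow> real" where
  "lp_norm G p f = (\<Sum>\<^sub>\<infinity>g\<in>carrier G. norm (f g) powr p) powr (1 / p)"

definition lp_topology :: "('g, 'x) monoid_scheme \<Rightarrow> real \<Rightarrow> ('g \<Rightarrow> complex) topology" where
  "lp_topology G p =
     Metric_space.mtopology (lp_space G p) (\<lambda>f f'. lp_norm G p (\<lambda>g. f g - f' g))"

definition lp_module :: "('g, 'x) monoid_scheme \<Rightarrow> real \<Rightarrow> ('g \<Rightarrow> int, 'g \<Rightarrow> complex) module" where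
  "lp_module G p =
     \<lparr>carrier = lp_space G p, monoid.mult = undefined, one = undefined,
      ring.zero = (\<lambda>g. 0), ring.add = (\<lambda>f f' g. f g + f' g), module.smult = group_convolution G\<rparr>"


section \<open>Chains and reduced homology with coefficients in \<open>l\<^sup>p(G)\<close>\<close>

type_synonym ('g, 'm) lp_chain = "('m \<times> ('g \<Rightarrow> complex) \<Rightarrow>\<^sub>0 int) set"

definition lp_chains ::
  "('g, 'x) monoid_scheme \<Rightarrow> real \<Rightarrow> ('g \<Rightarrow> int, 'm) module \<Rightarrow> ('g, 'm) lp_chain monoid" where
  "lp_chains G p M = tensor_product (int_group_ring G) (to_right_module G M) (lp_module G p)"

definition lp_boundary ::
  "('g, 'x) monoid_scheme \<Rightarrow> real \<Rightarrow> (nat \<Rightarrow> ('g \<Rightarrow> int, 'm) module) \<Rightarrow> (nat \<Rightarrow> 'm \<Rightarrow> 'm) \<Rightarrow> nat \<Rightarrow>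
    ('g, 'm) lp_chain \<Rightarrow> ('g, 'm) lp_chain"
where
  "lp_boundary G p F d i =
     tensor_map (int_group_ring G) (to_right_module G (F (i - 1))) (lp_module G p) (d i)"

text \<open>For a tuple \<open>x\<^sub>1, \<dots>, x\<^sub>m\<close> of elements of \<open>M\<close> this is the map from \<open>l\<^sup>p(G)\<^sup>m\<close> to the chains
  sending \<open>(f\<^sub>1, \<dots>, f\<^sub>m)\<close> to the sum of the \<open>x\<^sub>j \<otimes> f\<^sub>j\<close>.\<close>

definition lp_chain_sum ::
  "('g, 'x) monoid_scheme \<Rightarrow> real \<Rightarrow> ('g \<Rightarrow> int, 'm) module \<Rightarrow> 'm list \<Rightarrow>
    (nat \<Rightarrow> 'g \<Rightarrow> complex) \<Rightarrow> ('g, 'm) lp_chain"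
where
  "lp_chain_sum G p M xs f =
     (\<Otimes>\<^bsub>lp_chains G p M\<^esub>j\<in>{..<length xs}.
        tensor_class (int_group_ring G) (to_right_module G M) (lp_module G p) (frag_of (xs ! j, f j)))"

text \<open>The natural topology on the chains: the finest one for which \<open>lp_chain_sum\<close> is continuous
  on \<open>l\<^sup>p(G)\<^sup>m\<close> for every finite tuple. If \<open>xs\<close> generates \<open>M\<close>, then every element of another
  tuple is a combination of \<open>xs\<close> over the group ring, so the map for that tuple factors
  continuously through the map for \<open>xs\<close>. Hence the topology is the quotient topology from
  \<open>l\<^sup>p(G)\<^sup>m\<close> along any generating tuple, and if \<open>xs\<close> is a basis, \<open>lp_chain_sum\<close> is a
  homeomorphism from \<open>l\<^sup>p(G)\<^sup>m\<close>.\<close>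

definition lp_chain_open ::
  "('g, 'x) monoid_scheme \<Rightarrow> real \<Rightarrow> ('g \<Rightarrow> int, 'm) module \<Rightarrow> ('g, 'm) lp_chain set \<Rightarrow> bool" where
  "lp_chain_open G p M U \<longleftrightarrow>
     U \<subseteq> carrier (lp_chains G p M) \<and>
     (\<forall>xs. set xs \<subseteq> carrier M \<longrightarrow>
        openin (product_topology (\<lambda>j. lp_topology G p) {..<length xs})
          {f \<in> {..<length xs} \<rightarrow>\<^sub>E lp_space G p. lp_chain_sum G p M xs f \<in> U})"

definition lp_chain_topology ::
  "('g, 'x) monoid_scheme \<Rightarrow> real \<Rightarrow> ('g \<Rightarrow> int, 'm) module \<Rightarrow> ('g, 'm) lp_chain topology" where
  "lp_chain_topology G p M = topology (lp_chain_open G p M)"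

definition lp_cycles ::
  "('g, 'x) monoid_scheme \<Rightarrow> real \<Rightarrow> (nat \<Rightarrow> ('g \<Rightarrow> int, 'm) module) \<Rightarrow> (nat \<Rightarrow> 'm \<Rightarrow> 'm) \<Rightarrow> nat \<Rightarrow>
    ('g, 'm) lp_chain set"
where
  "lp_cycles G p F d i =
     (if i = 0 then carrier (lp_chains G p (F 0))
      else kernel (lp_chains G p (F i)) (lp_chains G p (F (i - 1))) (lp_boundary G p F d i))"

definition reduced_lp_homology ::
  "('g, 'x) monoid_scheme \<Rightarrow> real \<Rightarrow> (nat \<Rightarrow> ('g \<Rightarrow> int, 'm) module) \<Rightarrow> (nat \<Rightarrow> 'm \<Rightarrow> 'm) \<Rightarrow> nat \<Rightarrow>
    ('g, 'm) lp_chain set monoid"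
where
  "reduced_lp_homology G p F d i =
     (lp_chains G p (F i))\<lparr>carrier := lp_cycles G p F d i\<rparr> Mod
       (lp_chain_topology G p (F i) closure_of
          (lp_boundary G p F d (i + 1) ` carrier (lp_chains G p (F (i + 1)))))"


section \<open>Cochains and reduced cohomology with coefficients in \<open>l\<^sup>p(G)\<close>\<close>

type_synonym ('g, 'm) lp_cochain = "'m \<Rightarrow> 'g \<Rightarrow> complex"

definition lp_cochains ::
  "('g, 'x) monoid_scheme \<Rightarrow> real \<Rightarrow> ('g \<Rightarrow> int, 'm) module \<Rightarrow> ('g, 'm) lp_cochain monoid" where
  "lp_cochains G p M = Hom_group (int_group_ring G) M (lp_module G p)"

definition lp_coboundary ::
  "(nat \<Rightarrow> ('g \<Rightarrow> int, 'm) module) \<Rightarrow> (nat \<Rightarrow> 'm \<Rightarrow> 'm) \<Rightarrow> nat \<Rightarrow>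
    ('g, 'm) lp_cochain \<Rightarrow> ('g, 'm) lp_cochain"
where
  "lp_coboundary F d i \<phi> = compose (carrier (F i)) \<phi> (d i)"

text \<open>The natural topology on the cochains: the coarsest one for which evaluation at every
  element of \<open>M\<close> is continuous into \<open>l\<^sup>p(G)\<close>. If \<open>x\<^sub>1, \<dots>, x\<^sub>m\<close> generate \<open>M\<close>, evaluation at these
  elements already embeds the cochains topologically into \<open>l\<^sup>p(G)\<^sup>m\<close>, and for a basis this is a
  homeomorphism onto \<open>l\<^sup>p(G)\<^sup>m\<close>.\<close>

definition lp_cochain_topology ::
  "('g, 'x) monoid_scheme \<Rightarrow> real \<Rightarrow> ('g \<Rightarrow> int, 'm) module \<Rightarrow> ('g, 'm) lp_cochain topology" where
  "lp_cochain_topology G p M =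
     subtopology (product_topology (\<lambda>x. lp_topology G p) (carrier M)) (carrier (lp_cochains G p M))"

definition lp_cocycles ::
  "('g, 'x) monoid_scheme \<Rightarrow> real \<Rightarrow> (nat \<Rightarrow> ('g \<Rightarrow> int, 'm) module) \<Rightarrow> (nat \<Rightarrow> 'm \<Rightarrow> 'm) \<Rightarrow> nat \<Rightarrow>
    ('g, 'm) lp_cochain set"
where
  "lp_cocycles G p F d i =
     kernel (lp_cochains G p (F i)) (lp_cochains G p (F (i + 1))) (lp_coboundary F d (i + 1))"

definition lp_coboundaries ::
  "('g, 'x) monoid_scheme \<Rightarrow> real \<Rightarrow> (nat \<Rightarrow> ('g \<Rightarrow> int, 'm) module) \<Rightarrow> (nat \<Rightarrow> 'm \<Rightarrow> 'm) \<Rightarrow> nat \<Rightarrow>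
    ('g, 'm) lp_cochain set"
where
  "lp_coboundaries G p F d i =
     (if i = 0 then {\<one>\<^bsub>lp_cochains G p (F 0)\<^esub>}
      else lp_coboundary F d i ` carrier (lp_cochains G p (F (i - 1))))"

definition reduced_lp_cohomology ::
  "('g, 'x) monoid_scheme \<Rightarrow> real \<Rightarrow> (nat \<Rightarrow> ('g \<Rightarrow> int, 'm) module) \<Rightarrow> (nat \<Rightarrow> 'm \<Rightarrow> 'm) \<Rightarrow> nat \<Rightarrow>
    ('g, 'm) lp_cochain set monoid"
where
  "reduced_lp_cohomology G p F d i =
     (lp_cochains G p (F i))\<lparr>carrier := lp_cocycles G p F d i\<rparr> Mod
       (lp_cochain_topology G p (F i) closure_of lp_coboundaries G p F d i)"


section \<open>The group ring is a ring, the integers are a module, the open sets form a topology\<close>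

lemma (in group) group_convolution_superset:
  assumes "finite S" "S \<subseteq> carrier G" "\<And>x. x \<in> carrier G \<Longrightarrow> x \<notin> S \<Longrightarrow> a x = 0" "g \<in> carrier G"
  shows "group_convolution G a f g = (\<Sum>x\<in>S. of_int (a x) * f (inv x \<otimes> g))"
proof -
  have "(\<Sum>x | x \<in> carrier G \<and> a x \<noteq> 0. of_int (a x) * f (inv x \<otimes> g))
      = (\<Sum>x\<in>S. of_int (a x) * f (inv x \<otimes> g))"
  proof (rule sum.mono_neutral_left)
    show "{x \<in> carrier G. a x \<noteq> 0} \<subseteq> S" using assms(3) by blast
    show "\<forall>x\<in>S - {x \<in> carrier G. a x \<noteq> 0}. of_int (a x) * f (inv x \<otimes> g) = 0"
      using assms(2) by auto
  qed (fact assms(1))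
  then show ?thesis using assms(4) by (simp add: group_convolution_def)
qed

lemma (in group) group_convolution_closed:
  assumes a: "a \<in> carrier (int_group_ring G)" and b: "b \<in> carrier (int_group_ring G)"
  shows "group_convolution G a b \<in> carrier (int_group_ring G)"
    and "\<And>g. group_convolution G a b g \<noteq> 0 \<Longrightarrow>
           g \<in> (\<lambda>(x, y). x \<otimes> y) ` ({x. a x \<noteq> 0} \<times> {y. b y \<noteq> 0})"
proof -
  have *: "g \<in> (\<lambda>(x, y). x \<otimes> y) ` ({x. a x \<noteq> 0} \<times> {y. b y \<noteq> 0})"
    if "group_convolution G a b g \<noteq> 0" for g
  proof -
    have g: "g \<in> carrier G" using that by (auto simp: group_convolution_def split: if_splits)
    then have "(\<Sum>x | x \<in> carrier G \<and> a x \<noteq> 0. of_int (a x) * b (inv x \<otimes> g)) \<noteq> 0"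
      using that by (simp add: group_convolution_def)
    then obtain x where "x \<in> {x. x \<in> carrier G \<and> a x \<noteq> 0}" "of_int (a x) * b (inv x \<otimes> g) \<noteq> 0"
      by (rule sum.not_neutral_contains_not_neutral)
    then have x: "x \<in> carrier G" "a x \<noteq> 0" "b (inv x \<otimes> g) \<noteq> 0" by auto
    have "g = x \<otimes> (inv x \<otimes> g)" using x g by (simp add: inv_solve_left m_assoc[symmetric])
    with x show ?thesis by (intro image_eqI[of _ _ "(x, inv x \<otimes> g)"]) simp_all
  qed
  have "finite ((\<lambda>(x, y). x \<otimes> y) ` ({x. a x \<noteq> 0} \<times> {y. b y \<noteq> 0}))"
    using a b by (auto simp: int_group_ring_def)
  then have "finite {g. group_convolution G a b g \<noteq> 0}"
    by (rule finite_subset[rotated]) (use * in blast)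
  then show "group_convolution G a b \<in> carrier (int_group_ring G)"
    by (auto simp: int_group_ring_def group_convolution_def)
  show "\<And>g. group_convolution G a b g \<noteq> 0 \<Longrightarrow>
           g \<in> (\<lambda>(x, y). x \<otimes> y) ` ({x. a x \<noteq> 0} \<times> {y. b y \<noteq> 0})" by (fact *)
qed

lemma (in group) group_convolution_assoc:
  fixes f :: "'a \<Rightarrow> 'k::ring_1"
  assumes a: "a \<in> carrier (int_group_ring G)" and b: "b \<in> carrier (int_group_ring G)"
  shows "group_convolution G (group_convolution G a b) f = group_convolution G a (group_convolution G b f)"
proof
  fix g
  let ?A = "{x. a x \<noteq> 0}" and ?B = "{x. b x \<noteq> 0}"
  let ?P = "(\<lambda>(x, y). x \<otimes> y) ` (?A \<times> ?B)"
  have A: "finite ?A" "?A \<subseteq> carrier G" and B: "finite ?B" "?B \<subseteq> carrier G"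
    using a b by (auto simp: int_group_ring_def)
  have P: "finite ?P" "?P \<subseteq> carrier G" using A B by auto
  show "group_convolution G (group_convolution G a b) f g = group_convolution G a (group_convolution G b f) g"
  proof (cases "g \<in> carrier G")
    case g: True
    have "group_convolution G (group_convolution G a b) f g
        = (\<Sum>z\<in>?P. of_int (group_convolution G a b z) * f (inv z \<otimes> g))"
      using group_convolution_closed(2)[OF a b] P g by (intro group_convolution_superset) blast+
    also have "\<dots> = (\<Sum>z\<in>?P. \<Sum>x\<in>?A. of_int (a x) * (of_int (b (inv x \<otimes> z)) * f (inv z \<otimes> g)))"
    proof (rule sum.cong[OF refl])
      fix z assume "z \<in> ?P"
      then have "z \<in> carrier G" using P by blast
      then have "group_convolution G a b z = (\<Sum>x\<in>?A. a x * b (inv x \<otimes> z))"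
        using group_convolution_superset[OF A, of a z b] by simp
      then show "of_int (group_convolution G a b z) * f (inv z \<otimes> g) =
          (\<Sum>x\<in>?A. of_int (a x) * (of_int (b (inv x \<otimes> z)) * f (inv z \<otimes> g)))"
        by (simp add: sum_distrib_right mult.assoc)
    qed
    also have "\<dots> = (\<Sum>x\<in>?A. of_int (a x) * (\<Sum>z\<in>?P. of_int (b (inv x \<otimes> z)) * f (inv z \<otimes> g)))"
      by (subst sum.swap) (simp add: sum_distrib_left)
    also have "\<dots> = (\<Sum>x\<in>?A. of_int (a x) * group_convolution G b f (inv x \<otimes> g))"
    proof (rule sum.cong[OF refl])
      fix x assume x: "x \<in> ?A"
      then have xc: "x \<in> carrier G" using A by blast
      have inj: "inj_on ((\<otimes>) x) ?B" 
      proof (rule inj_onI)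
        fix y z assume "y \<in> ?B" "z \<in> ?B" "x \<otimes> y = x \<otimes> z"
        then show "y = z" using xc B by (metis l_cancel subsetD)
      qed
      have "(\<Sum>z\<in>?P. of_int (b (inv x \<otimes> z)) * f (inv z \<otimes> g))
          = (\<Sum>z\<in>(\<otimes>) x ` ?B. of_int (b (inv x \<otimes> z)) * f (inv z \<otimes> g))"
      proof (rule sum.mono_neutral_right)
        show "\<forall>z\<in>?P - (\<otimes>) x ` ?B. of_int (b (inv x \<otimes> z)) * f (inv z \<otimes> g) = 0"
        proof
          fix z assume z: "z \<in> ?P - (\<otimes>) x ` ?B"
          then have "z \<in> carrier G" using P by blast
          then have "z = x \<otimes> (inv x \<otimes> z)" using xc by (simp add: m_assoc[symmetric])
          then have "b (inv x \<otimes> z) = 0" using z by blast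
          then show "of_int (b (inv x \<otimes> z)) * f (inv z \<otimes> g) = 0" by simp
        qed
      qed (use x P in auto)
      also have "\<dots> = (\<Sum>y\<in>?B. of_int (b (inv x \<otimes> (x \<otimes> y))) * f (inv (x \<otimes> y) \<otimes> g))"
        by (subst sum.reindex[OF inj]) simp
      also have "\<dots> = (\<Sum>y\<in>?B. of_int (b y) * f (inv y \<otimes> (inv x \<otimes> g)))"
      proof (rule sum.cong[OF refl])
        fix y assume "y \<in> ?B"
        then have "y \<in> carrier G" using B by blast
        then show "of_int (b (inv x \<otimes> (x \<otimes> y))) * f (inv (x \<otimes> y) \<otimes> g) = of_int (b y) * f (inv y \<otimes> (inv x \<otimes> g))"
          using xc g by (simp add: m_assoc[symmetric] inv_mult_group)
      qed
      also have "\<dots> = group_convolution G b f (inv x \<otimes> g)"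
        using group_convolution_superset[OF B, of b "inv x \<otimes> g" f] xc g by simp
      finally show "of_int (a x) * (\<Sum>z\<in>?P. of_int (b (inv x \<otimes> z)) * f (inv z \<otimes> g)) =
          of_int (a x) * group_convolution G b f (inv x \<otimes> g)" by simp
    qed
    also have "\<dots> = group_convolution G a (group_convolution G b f) g"
      using group_convolution_superset[OF A, of a g "group_convolution G b f"] g by simp
    finally show ?thesis .
  qed (simp add: group_convolution_def)
qed

lemma (in group) group_convolution_add_left:
  assumes a: "a \<in> carrier (int_group_ring G)" and b: "b \<in> carrier (int_group_ring G)"
  shows "group_convolution G (\<lambda>g. a g + b g) f = (\<lambda>g. group_convolution G a f g + group_convolution G b f g)"
proof
  fix g
  let ?S = "{x. a x \<noteq> 0} \<union> {x. b x \<noteq> 0}"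
  have S: "finite ?S" "?S \<subseteq> carrier G" using a b by (auto simp: int_group_ring_def)
  show "group_convolution G (\<lambda>g. a g + b g) f g = group_convolution G a f g + group_convolution G b f g"
  proof (cases "g \<in> carrier G")
    case True
    then show ?thesis
      using group_convolution_superset[OF S, of a g f] group_convolution_superset[OF S, of b g f]
        group_convolution_superset[OF S, of "\<lambda>g. a g + b g" g f]
      by (simp add: distrib_right sum.distrib)
  qed (simp add: group_convolution_def)
qed

lemma group_convolution_add_right:
  "group_convolution G a (\<lambda>g. f g + f' g) = (\<lambda>g. group_convolution G a f g + group_convolution G a f' g)"
  by (auto simp: group_convolution_def fun_eq_iff distrib_left sum.distrib)

lemma (in group) group_convolution_one:
  assumes "\<And>g. g \<notin> carrier G \<Longrightarrow> f g = 0"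
  shows "group_convolution G (\<lambda>g. if g = \<one> then 1 else 0) f = f"
proof
  fix g
  show "group_convolution G (\<lambda>g. if g = \<one> then 1 else 0) f g = f g"
    using group_convolution_superset[of "{\<one>}" "\<lambda>g. if g = \<one> then 1 else 0" g f] assms
    by (cases "g \<in> carrier G") (auto simp: group_convolution_def)
qed

lemma (in group) group_convolution_one_right:
  assumes a: "a \<in> carrier (int_group_ring G)"
  shows "group_convolution G a (\<lambda>g. if g = \<one> then 1 else 0) = a"
proof
  fix g
  let ?A = "insert g {x. a x \<noteq> 0}"
  show "group_convolution G a (\<lambda>g. if g = \<one> then 1 else 0) g = a g"
  proof (cases "g \<in> carrier G")
    case g: True
    have A: "finite ?A" "?A \<subseteq> carrier G" using a g by (auto simp: int_group_ring_def)
    have "x \<in> ?A \<Longrightarrow> inv x \<otimes> g = \<one> \<longleftrightarrow> x = g" for x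
      using A g by (metis inv_closed inv_equality inv_inv l_inv subsetD)
    then have "(\<Sum>x\<in>?A. a x * (if inv x \<otimes> g = \<one> then 1 else 0)) = (\<Sum>x\<in>?A. if x = g then a x else 0)"
      by (intro sum.cong) auto
    also have "\<dots> = a g" using A by (simp add: sum.delta')
    finally have "(\<Sum>x\<in>?A. of_int (a x) * (if inv x \<otimes> g = \<one> then 1 else 0)) = a g" by simp
    moreover have "group_convolution G a (\<lambda>g. if g = \<one> then 1 else 0) g =
        (\<Sum>x\<in>?A. of_int (a x) * (if inv x \<otimes> g = \<one> then 1 else 0))"
      by (rule group_convolution_superset[OF A _ g]) auto
    ultimately show ?thesis by (rule trans[rotated])
  qed (use a in \<open>auto simp: group_convolution_def int_group_ring_def\<close>)
qed

lemma (in group) ring_int_group_ring: "ring (int_group_ring G)"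
proof (rule ringI)
  show "abelian_group (int_group_ring G)"
  proof (rule abelian_groupI)
    fix x assume x: "x \<in> carrier (int_group_ring G)"
    show "\<exists>y\<in>carrier (int_group_ring G). y \<oplus>\<^bsub>int_group_ring G\<^esub> x = \<zero>\<^bsub>int_group_ring G\<^esub>"
      by (rule bexI[of _ "\<lambda>g. - x g"]) (use x in \<open>auto simp: int_group_ring_def\<close>)
  next
    fix x y assume "x \<in> carrier (int_group_ring G)" "y \<in> carrier (int_group_ring G)"
    moreover have "{g. x g + y g \<noteq> 0} \<subseteq> {g. x g \<noteq> 0} \<union> {g. y g \<noteq> 0}" by auto
    ultimately show "x \<oplus>\<^bsub>int_group_ring G\<^esub> y \<in> carrier (int_group_ring G)"
      by (auto simp: int_group_ring_def intro: finite_subset)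
  qed (auto simp: int_group_ring_def)
  show "monoid (int_group_ring G)"
  proof (rule monoidI)
    show "\<one>\<^bsub>int_group_ring G\<^esub> \<in> carrier (int_group_ring G)" by (auto simp: int_group_ring_def)
    fix x y z assume x: "x \<in> carrier (int_group_ring G)" and y: "y \<in> carrier (int_group_ring G)"
    show "x \<otimes>\<^bsub>int_group_ring G\<^esub> y \<in> carrier (int_group_ring G)"
      using group_convolution_closed(1)[OF x y] by (simp add: int_group_ring_def)
    show "x \<otimes>\<^bsub>int_group_ring G\<^esub> y \<otimes>\<^bsub>int_group_ring G\<^esub> z = x \<otimes>\<^bsub>int_group_ring G\<^esub> (y \<otimes>\<^bsub>int_group_ring G\<^esub> z)"
      using group_convolution_assoc[OF x y, of z] by (simp add: int_group_ring_def)
    show "\<one>\<^bsub>int_group_ring G\<^esub> \<otimes>\<^bsub>int_group_ring G\<^esub> x = x"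
      using group_convolution_one[of x] x by (simp add: int_group_ring_def)
    show "x \<otimes>\<^bsub>int_group_ring G\<^esub> \<one>\<^bsub>int_group_ring G\<^esub> = x"
      using group_convolution_one_right[OF x] by (simp add: int_group_ring_def)
  qed
  fix x y z assume x: "x \<in> carrier (int_group_ring G)" and y: "y \<in> carrier (int_group_ring G)"
  show "(x \<oplus>\<^bsub>int_group_ring G\<^esub> y) \<otimes>\<^bsub>int_group_ring G\<^esub> z =
      x \<otimes>\<^bsub>int_group_ring G\<^esub> z \<oplus>\<^bsub>int_group_ring G\<^esub> y \<otimes>\<^bsub>int_group_ring G\<^esub> z"
    using group_convolution_add_left[OF x y, of z] by (simp add: int_group_ring_def)
  show "z \<otimes>\<^bsub>int_group_ring G\<^esub> (x \<oplus>\<^bsub>int_group_ring G\<^esub> y) =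
      z \<otimes>\<^bsub>int_group_ring G\<^esub> x \<oplus>\<^bsub>int_group_ring G\<^esub> z \<otimes>\<^bsub>int_group_ring G\<^esub> y"
    using group_convolution_add_right[of G z x y] by (simp add: int_group_ring_def)
qed

lemma istopology_lp_chain_open: "istopology (lp_chain_open G p M)"
proof -
  let ?C = "carrier (lp_chains G p M)"
  let ?X = "\<lambda>xs. product_topology (\<lambda>j. lp_topology G p) {..<length xs}"
  define V where "V xs U = {f \<in> {..<length xs} \<rightarrow>\<^sub>E lp_space G p. lp_chain_sum G p M xs f \<in> U}" for xs U
  have open_iff: "lp_chain_open G p M U \<longleftrightarrow>
      U \<subseteq> ?C \<and> (\<forall>xs. set xs \<subseteq> carrier M \<longrightarrow> openin (?X xs) (V xs U))" for U
    by (simp only: lp_chain_open_def V_def)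
  have Collect_Int: "{f \<in> A. h f \<in> S \<inter> T} = {f \<in> A. h f \<in> S} \<inter> {f \<in> A. h f \<in> T}"
    and Collect_Union: "{f \<in> A. h f \<in> \<Union>K} = (\<Union>U\<in>K. {f \<in> A. h f \<in> U})"
    for A :: "'u set" and h :: "'u \<Rightarrow> 'v" and S T K by blast+
  have V_Int: "V xs (S \<inter> T) = V xs S \<inter> V xs T" for xs S T
    unfolding V_def by (rule Collect_Int)
  have V_Union: "V xs (\<Union>K) = \<Union>(V xs ` K)" for xs K
    unfolding V_def by (rule Collect_Union)
  have inter: "lp_chain_open G p M (S \<inter> T)" if S: "lp_chain_open G p M S" and T: "lp_chain_open G p M T" for S T
  proof -
    have "S \<inter> T \<subseteq> ?C" using S unfolding open_iff by (simp add: le_infI1)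
    moreover have "openin (?X xs) (V xs (S \<inter> T))" if "set xs \<subseteq> carrier M" for xs
      unfolding V_Int using S T that unfolding open_iff by (simp add: openin_Int)
    ultimately show ?thesis unfolding open_iff by simp
  qed
  have union: "lp_chain_open G p M (\<Union>K)" if K: "\<forall>U\<in>K. lp_chain_open G p M U" for K
  proof -
    have "\<Union>K \<subseteq> ?C" using K unfolding open_iff by (simp add: Union_least)
    moreover have "openin (?X xs) (V xs (\<Union>K))" if "set xs \<subseteq> carrier M" for xs
    proof -
      have "openin (?X xs) W" if "W \<in> V xs ` K" for W
        using K \<open>set xs \<subseteq> carrier M\<close> that unfolding open_iff by auto
      then show ?thesis unfolding V_Union by (intro openin_Union) simp
    qed
    ultimately show ?thesis unfolding open_iff by simp
  qed
  show ?thesis unfolding istopology_def using inter union by simp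
qed

lemma openin_lp_chain_topology: "openin (lp_chain_topology G p M) U \<longleftrightarrow> lp_chain_open G p M U"
  by (simp add: lp_chain_topology_def istopology_lp_chain_open topology_inverse')

lemma (in group) left_module_trivial: "left_module (int_group_ring G) (trivial_int_module G)"
proof -
  have ab: "abelian_group (trivial_int_module G)"
    by (rule abelian_groupI) (auto simp: trivial_int_module_def intro: exI[of _ "- x" for x])
  let ?e = "\<lambda>a::'a \<Rightarrow> int. \<Sum>g | g \<in> carrier G \<and> a g \<noteq> 0. a g"
  have e: "?e a = sum a S" if "finite S" "S \<subseteq> carrier G" "{x. a x \<noteq> 0} \<subseteq> S" for a S
    by (rule sum.mono_neutral_left) (use that in auto)
  have add: "?e (\<lambda>g. a g + b g) = ?e a + ?e b"
    if "a \<in> carrier (int_group_ring G)" "b \<in> carrier (int_group_ring G)" for a b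
  proof -
    let ?S = "{x. a x \<noteq> 0} \<union> {x. b x \<noteq> 0}"
    have "finite ?S" "?S \<subseteq> carrier G" using that by (auto simp: int_group_ring_def)
    moreover have "{x. a x + b x \<noteq> 0} \<subseteq> ?S" by auto
    ultimately have "?e a = sum a ?S" "?e b = sum b ?S" "?e (\<lambda>g. a g + b g) = (\<Sum>g\<in>?S. a g + b g)"
      by (intro e; auto)+
    then show ?thesis by (simp only: sum.distrib)
  qed
  have conv: "?e (group_convolution G a b) = ?e a * ?e b"
    if a: "a \<in> carrier (int_group_ring G)" and b: "b \<in> carrier (int_group_ring G)" for a b
  proof -
    let ?u = "\<lambda>g. if g \<in> carrier G then 1 else 0 :: int"
    have *: "group_convolution G b ?u g = (if g \<in> carrier G then ?e b else 0)" for b g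
    proof (cases "g \<in> carrier G")
      case True
      then have "(\<Sum>x | x \<in> carrier G \<and> b x \<noteq> 0. of_int (b x) * ?u (inv x \<otimes> g)) = ?e b"
        by (intro sum.cong) simp_all
      then show ?thesis using True by (simp only: group_convolution_def if_True)
    qed (simp add: group_convolution_def)
    have "group_convolution G a (group_convolution G b ?u) \<one> =
        (\<Sum>x | x \<in> carrier G \<and> a x \<noteq> 0. of_int (a x) * group_convolution G b ?u (inv x \<otimes> \<one>))"
      using one_closed unfolding group_convolution_def[of G a] by (simp only: if_True)
    also have "\<dots> = (\<Sum>x | x \<in> carrier G \<and> a x \<noteq> 0. a x * ?e b)"
      by (intro sum.cong refl) (simp add: *)
    also have "\<dots> = ?e a * ?e b" by (simp only: sum_distrib_right)
    finally show ?thesis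
      using *[of "group_convolution G a b" \<one>] group_convolution_assoc[OF a b, of ?u]
      by (simp only: one_closed if_True)
  qed
  show ?thesis
    apply (intro left_module.intro ring_int_group_ring ab left_module_axioms.intro)
    subgoal by (simp add: trivial_int_module_def)
    subgoal for a b x using add[of a b] by (simp add: trivial_int_module_def int_group_ring_def distrib_right)
    subgoal by (simp add: trivial_int_module_def distrib_left)
    subgoal for a b x using conv[of a b] by (simp add: trivial_int_module_def int_group_ring_def)
    subgoal for x using e[of "{\<one>}" "\<lambda>g. if g = \<one> then 1 else 0"] by (simp add: trivial_int_module_def int_group_ring_def)
    done
qed

end

theory Submission
  imports Defs
begin

text \<open>An infinite finitely generated nilpotent group has a central element \<open>z\<close> of infinite order:
  let \<open>k\<close> be maximal with \<open>\<gamma>\<^sub>k\<close> infinite. Since \<open>\<gamma>\<^sub>k\<close> is finitely generated modulo the finite group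
  \<open>\<gamma>\<^sub>k\<^sub>+\<^sub>1\<close> and abelian modulo it, \<open>\<gamma>\<^sub>k\<close> contains some \<open>u\<close> of infinite order; the commutators of the powers
  of \<open>u\<close> with the generators lie in a finite set, so by the pigeonhole principle some power of \<open>u\<close> is
  central.

  On a projective resolution the action of \<open>z\<close> is chain homotopic to the identity. Hence, if \<open>T\<close> is the
  translation by \<open>z\<close> on \<open>l\<^sup>p(G)\<close>, the operator \<open>1 - T\<close> maps cycles to boundaries and cocycles to
  coboundaries, and so does \<open>1 - A\<^sub>N = (1 - T) Q\<^sub>N\<close>, where \<open>A\<^sub>N\<close> is the ergodic average
  \<open>(T + \<dots> + T\<^sup>N) / N\<close>. For \<open>p > 1\<close> the mean ergodic theorem gives \<open>A\<^sub>N f \<rightarrow> 0\<close>, because \<open>z\<close> has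
  infinite order, so every cycle is a limit of boundaries and every cocycle a limit of coboundaries.
  Cycles are closed because a dual basis of a projective module provides continuous coordinates
  that separate its chains.\<close>

section \<open>Central elements of infinite order in nilpotent groups\<close>

text \<open>\<open>Q_N\<close> may be applied before the homotopy because \<open>z\<close> is
  central: translation by \<open>z\<close> commutes with the whole group ring, so \<open>Q_N\<close>
  acts on the coefficients alone and preserves cycles and cocycles. Its weights come from averaging
  \<open>1 - T^k = (1 - T)(1 + ... + T^(k-1))\<close> over \<open>k = 1, ..., N\<close>, which gives
  \<open>T^j\<close> the coefficient \<open>1 - j/N\<close>. The ergodic theorem is elementary here:
  averaging does not increase the norm, so point masses suffice, and the average of a point mass has
  the value \<open>1/N\<close> at \<open>N\<close> distinct points, hence norm
  \<open>N^((1-p)/p)\<close>, which tends to zero because \<open>p > 1\<close>. A chain is a coset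
  of formal sums and has no canonical coordinates. It is therefore written once as a sum of
  \<open>x_j \<otimes> f_j\<close> with fixed \<open>x_j\<close>, and only the \<open>f_j\<close>
  are averaged; convergence of the new chains is then built into the topology, which is final for
  all such tuples. In homology the right action turns \<open>z\<close> into its inverse, so the
  homotopy there is the one for \<open>inv z\<close>.\<close>

declare lower_central_series.simps(2) [simp del]

context group begin

section \<open>Commutators and the lower central series\<close>

lemma commutator_mult_right:
  assumes "x \<in> carrier G" "y \<in> carrier G" "y' \<in> carrier G"
  shows "x \<otimes> (y \<otimes> y') \<otimes> inv x \<otimes> inv (y \<otimes> y') =
    (x \<otimes> y \<otimes> inv x \<otimes> inv y) \<otimes> (y \<otimes> (x \<otimes> y' \<otimes> inv x \<otimes> inv y') \<otimes> inv y)"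
  using assms by (simp add: inv_mult_group m_assoc inv_solve_left')
    (simp flip: m_assoc)

lemma inv_commutator:
  assumes "x \<in> carrier G" "y \<in> carrier G"
  shows "inv (x \<otimes> y \<otimes> inv x \<otimes> inv y) = y \<otimes> x \<otimes> inv y \<otimes> inv x"
  using assms by (simp add: inv_mult_group m_assoc)

text \<open>This is the preimage of the centralizer of the coset of \<open>x\<close> in
  \<open>G\<close> modulo \<open>K\<close>. Being a subgroup, it contains everything as soon as it
  contains a generating set, and that is how commutators are controlled below.\<close>

lemma subgroup_commutator_right:
  assumes K: "K \<lhd> G" and x: "x \<in> carrier G"
  shows "subgroup {y \<in> carrier G. x \<otimes> y \<otimes> inv x \<otimes> inv y \<in> K} G"
proof (rule subgroupI)
  interpret K: normal K G by fact
  have K1: "\<one> \<in> K" by (rule K.one_closed)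
  have "\<one> \<in> {y \<in> carrier G. x \<otimes> y \<otimes> inv x \<otimes> inv y \<in> K}"
    using x K1 by simp
  then show "{y \<in> carrier G. x \<otimes> y \<otimes> inv x \<otimes> inv y \<in> K} \<noteq> {}" by blast
  fix y assume y: "y \<in> {y \<in> carrier G. x \<otimes> y \<otimes> inv x \<otimes> inv y \<in> K}"
  then have yc: "y \<in> carrier G" and yK: "x \<otimes> y \<otimes> inv x \<otimes> inv y \<in> K" by auto
  \<comment> \<open>The commutator of \<open>x\<close> with \<open>inv y\<close> is the inverse of
    the commutator with \<open>y\<close>, conjugated by \<open>inv y\<close>; normality of
    \<open>K\<close> absorbs the conjugation.\<close>
  have "inv y \<otimes> inv (x \<otimes> y \<otimes> inv x \<otimes> inv y) \<otimes> y \<in> K"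
    using K.inv_op_closed1[OF yc K.m_inv_closed[OF yK]] .
  moreover have "inv y \<otimes> inv (x \<otimes> y \<otimes> inv x \<otimes> inv y) \<otimes> y = x \<otimes> inv y \<otimes> inv x \<otimes> inv (inv y)"
    unfolding inv_commutator[OF x yc] using x yc by (simp flip: m_assoc)
  ultimately show "inv y \<in> {y \<in> carrier G. x \<otimes> y \<otimes> inv x \<otimes> inv y \<in> K}"
    using yc by simp
  fix y' assume y': "y' \<in> {y \<in> carrier G. x \<otimes> y \<otimes> inv x \<otimes> inv y \<in> K}"
  then have "y \<otimes> (x \<otimes> y' \<otimes> inv x \<otimes> inv y') \<otimes> inv y \<in> K"
    using K.inv_op_closed2[OF yc] by blast
  then show "y \<otimes> y' \<in> {y \<in> carrier G. x \<otimes> y \<otimes> inv x \<otimes> inv y \<in> K}"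
    using commutator_mult_right[OF x yc, of y'] yK yc y' by (simp add: K.m_closed)
qed auto

text \<open>Exchanging the two entries inverts a commutator, which reduces this to the version in
  the second entry.\<close>

lemma subgroup_commutator_left:
  assumes K: "K \<lhd> G" and y: "y \<in> carrier G"
  shows "subgroup {x \<in> carrier G. x \<otimes> y \<otimes> inv x \<otimes> inv y \<in> K} G"
proof -
  interpret K: normal K G by fact
  have "x \<otimes> y \<otimes> inv x \<otimes> inv y \<in> K \<longleftrightarrow> y \<otimes> x \<otimes> inv y \<otimes> inv x \<in> K" if "x \<in> carrier G" for x
    using inv_commutator[OF that y] inv_commutator[OF y that] K.m_inv_closed by metis
  then have "{x \<in> carrier G. x \<otimes> y \<otimes> inv x \<otimes> inv y \<in> K} = {x \<in> carrier G. y \<otimes> x \<otimes> inv y \<otimes> inv x \<in> K}"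
    by blast
  then show ?thesis using subgroup_commutator_right[OF K y] by simp
qed

lemma lower_central_series_subset: "lower_central_series G n \<subseteq> carrier G"
proof (induction n)
  case (Suc n)
  show ?case unfolding lower_central_series.simps by (rule generate_incl) (use Suc in auto)
qed simp

lemma subgroup_lower_central_series: "subgroup (lower_central_series G n) G"
proof (cases n)
  case (Suc k)
  show ?thesis unfolding Suc lower_central_series.simps(2) using lower_central_series_subset[of k]
    by (auto intro!: generate_is_subgroup)
qed (simp add: subgroup_self)

lemma commutator_in_lower_central_series:
  assumes "x \<in> lower_central_series G n" "y \<in> carrier G"
  shows "x \<otimes> y \<otimes> inv x \<otimes> inv y \<in> lower_central_series G (Suc n)"
  using assms by (auto simp: lower_central_series.simps(2) intro!: generate.incl)

lemma conj_eq_commutator_mult: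
  assumes "x \<in> carrier G" "y \<in> carrier G"
  shows "y \<otimes> x \<otimes> inv y = inv (x \<otimes> y \<otimes> inv x \<otimes> inv y) \<otimes> x"
  using assms by (simp add: inv_mult_group m_assoc)

text \<open>A conjugate of \<open>x\<close> differs from \<open>x\<close> by a commutator, which
  lies in the next term of the series and hence in \<open>K\<close>. This supplies the normality of
  the subgroups that are generated below by finitely many elements together with a term of the
  series.\<close>

lemma normal_between_lower_central_series:
  assumes K: "subgroup K G" and "lower_central_series G (Suc n) \<subseteq> K" "K \<subseteq> lower_central_series G n"
  shows "K \<lhd> G"
  unfolding normal_inv_iff
proof (intro conjI ballI K)
  fix y x assume y: "y \<in> carrier G" and x: "x \<in> K"
  then have xc: "x \<in> carrier G" using K by (auto dest: subgroup.subset)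
  have c: "x \<otimes> y \<otimes> inv x \<otimes> inv y \<in> K"
    using commutator_in_lower_central_series[of x n y] x y assms by blast
  show "y \<otimes> x \<otimes> inv y \<in> K"
    unfolding conj_eq_commutator_mult[OF xc y] by (rule subgroup.m_closed[OF K subgroup.m_inv_closed[OF K c] x])
qed

lemma lower_central_series_antimono: "lower_central_series G (Suc n) \<subseteq> lower_central_series G n"
proof (induction n)
  case 0
  then show ?case using lower_central_series_subset[of "Suc 0"] by simp
next
  case (Suc n)
  have "lower_central_series G (Suc (Suc n)) = generate G (\<Union>x\<in>lower_central_series G (Suc n). \<Union>y\<in>carrier G.
       {x \<otimes> y \<otimes> inv x \<otimes> inv y})" by (simp add: lower_central_series.simps(2))
  also have "\<dots> \<subseteq> lower_central_series G (Suc n)"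
    using Suc commutator_in_lower_central_series[of _ n]
    by (intro generate_subgroup_incl subgroup_lower_central_series) blast
  finally show ?case .
qed

lemma normal_lower_central_series: "lower_central_series G n \<lhd> G"
proof (cases n)
  case 0
  then show ?thesis by (simp add: normal_inv_iff subgroup_self)
next
  case (Suc k)
  then show ?thesis
    using normal_between_lower_central_series[OF subgroup_lower_central_series, of k n] lower_central_series_antimono[of k] by blast
qed

text \<open>On a term of the series, commutators with elements of \<open>G\<close> are
  multiplicative in each entry modulo the next term but one. So the commutators of generators of
  that term modulo the next with generators of \<open>G\<close> generate the next term modulo its
  successor.\<close>

lemma lower_central_series_generated_mod_next:
  assumes S: "finite S" "S \<subseteq> carrier G" "generate G S = carrier G"
  shows "\<exists>T. finite T \<and> T \<subseteq> lower_central_series G n \<and>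
    generate G (T \<union> lower_central_series G (Suc n)) = lower_central_series G n"
proof (induction n)
  case 0
  have "generate G S \<subseteq> generate G (S \<union> lower_central_series G (Suc 0))" by (rule mono_generate) auto
  moreover have "generate G (S \<union> lower_central_series G (Suc 0)) \<subseteq> carrier G"
    using S(2) lower_central_series_subset[of "Suc 0"] by (intro generate_incl) simp
  ultimately show ?case using S by (intro exI[of _ S]) simp
next
  case (Suc n)
  then obtain T where T: "finite T" "T \<subseteq> lower_central_series G n"
    "generate G (T \<union> lower_central_series G (Suc n)) = lower_central_series G n" by blast
  define T' where "T' = (\<lambda>(t, s). t \<otimes> s \<otimes> inv t \<otimes> inv s) ` (T \<times> S)"
  define K where "K = generate G (T' \<union> lower_central_series G (Suc (Suc n)))"
  have T': "finite T'" "T' \<subseteq> lower_central_series G (Suc n)"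
    using T S by (auto simp: T'_def intro!: commutator_in_lower_central_series)
  have sub: "T' \<union> lower_central_series G (Suc (Suc n)) \<subseteq> lower_central_series G (Suc n)"
    using T' lower_central_series_antimono[of "Suc n"] by blast
  then have KG: "K \<subseteq> lower_central_series G (Suc n)"
    unfolding K_def by (intro generate_subgroup_incl subgroup_lower_central_series)
  have K: "subgroup K G"
    unfolding K_def using sub lower_central_series_subset[of "Suc n"] by (intro generate_is_subgroup) blast
  have GK: "lower_central_series G (Suc (Suc n)) \<subseteq> K"
    unfolding K_def by (meson generate.incl subsetI UnI2)
  have KN: "K \<lhd> G" by (rule normal_between_lower_central_series[OF K GK KG])
  have 1: "t \<otimes> y \<otimes> inv t \<otimes> inv y \<in> K" if t: "t \<in> T" and y: "y \<in> carrier G" for t y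
  proof -
    have tc: "t \<in> carrier G" using t T lower_central_series_subset by blast
    have "S \<subseteq> {y \<in> carrier G. t \<otimes> y \<otimes> inv t \<otimes> inv y \<in> K}"
      using t S by (auto simp: K_def T'_def intro!: generate.incl)
    then have "generate G S \<subseteq> {y \<in> carrier G. t \<otimes> y \<otimes> inv t \<otimes> inv y \<in> K}"
      by (rule generate_subgroup_incl[OF _ subgroup_commutator_right[OF KN tc]])
    then show ?thesis using y S by blast
  qed
  \<comment> \<open>The second entry has been extended from \<open>S\<close> to all of
    \<open>G\<close>; now the first is extended from \<open>T\<close>. The elements of
    \<open>lower_central_series G (Suc n)\<close> cause no trouble because their commutators lie one
    term further down, hence in \<open>K\<close>.\<close>
  have 2: "x \<otimes> y \<otimes> inv x \<otimes> inv y \<in> K" if x: "x \<in> lower_central_series G n" and y: "y \<in> carrier G" for x y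
  proof -
    have "T \<union> lower_central_series G (Suc n) \<subseteq> {x \<in> carrier G. x \<otimes> y \<otimes> inv x \<otimes> inv y \<in> K}"
      using 1[OF _ y] T lower_central_series_subset[of n] lower_central_series_subset[of "Suc n"]
        commutator_in_lower_central_series[OF _ y, of _ "Suc n"] GK by blast
    then have "generate G (T \<union> lower_central_series G (Suc n)) \<subseteq> {x \<in> carrier G. x \<otimes> y \<otimes> inv x \<otimes> inv y \<in> K}"
      by (rule generate_subgroup_incl[OF _ subgroup_commutator_left[OF KN y]])
    then show ?thesis using x T by blast
  qed
  have "lower_central_series G (Suc n) \<subseteq> K"
    unfolding lower_central_series.simps by (intro generate_subgroup_incl K) (use 2 in blast)
  then show ?case using T' KG by (intro exI[of _ T']) (auto simp: K_def)
qed

text \<open>One generator is added at a time: the subgroup reached so far is finite and, by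
  \<open>nor\<close>, normal, so its product with the finite cyclic group of \<open>t\<close> is a
  finite subgroup containing both. In the application \<open>K\<close> and \<open>H\<close> are
  consecutive terms of the lower central series.\<close>

lemma finite_generate_of_torsion:
  assumes K: "K \<lhd> G" "finite K" and T: "finite T" "T \<subseteq> H" and H: "H \<subseteq> carrier G"
    and tors: "\<And>t. t \<in> H \<Longrightarrow> finite (generate G {t})"
    and nor: "\<And>A. subgroup A G \<Longrightarrow> K \<subseteq> A \<Longrightarrow> A \<subseteq> H \<Longrightarrow> A \<lhd> G"
    and KH: "K \<subseteq> H" and HG: "subgroup H G"
  shows "finite (generate G (T \<union> K))"
  using T
proof (induction T rule: finite_induct)
  case empty
  have "generate G K \<subseteq> K" using K by (intro generate_subgroup_incl) (auto simp: normal_inv_iff)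
  then show ?case using K(2) finite_subset by auto
next
  case (insert t T)
  let ?A = "generate G (T \<union> K)"
  have tH: "t \<in> H" and tc: "t \<in> carrier G" and T: "T \<union> K \<subseteq> H" "T \<union> K \<subseteq> carrier G"
    using insert H KH by auto
  have A: "?A \<lhd> G"
    using T by (intro nor generate_is_subgroup generate_subgroup_incl HG) (auto intro: generate.incl)
  have t: "subgroup (generate G {t}) G" using tc by (intro generate_is_subgroup) auto
  have P: "subgroup (?A <#> generate G {t}) G"
    by (rule mult_norm_subgroup[OF A t])
  have fin: "finite (?A <#> generate G {t})"
    unfolding set_mult_def using insert tors[OF tH] by auto
  have one: "\<one> \<in> ?A" "\<one> \<in> generate G {t}" by (auto intro: generate.one)
  have "insert t T \<union> K \<subseteq> ?A <#> generate G {t}"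
  proof
    fix x assume x: "x \<in> insert t T \<union> K"
    then consider "x = t" | "x \<in> T \<union> K" by blast
    then show "x \<in> ?A <#> generate G {t}"
    proof cases
      case 1
      then show ?thesis unfolding set_mult_def
        using one(1) tc generate.incl[of t "{t}" G] l_one[OF tc] by force
    next
      case 2
      then have "x = x \<otimes> \<one>" using T(2) by (metis r_one subsetD)
      then show ?thesis unfolding set_mult_def using one(2) generate.incl[OF 2, of G] by blast
    qed
  qed
  then have "generate G (insert t T \<union> K) \<subseteq> ?A <#> generate G {t}"
    by (rule generate_subgroup_incl[OF _ P])
  then show ?case using fin finite_subset by blast
qed

theorem infinite_order_central_element:
  assumes fg: "finitely_generated_group G" and nil: "nilpotent_group G" and inf: "infinite (carrier G)"
  shows "\<exists>z\<in>carrier G. (\<forall>y\<in>carrier G. z \<otimes> y = y \<otimes> z) \<and> inj (\<lambda>k::nat. z [^] k)"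
proof -
  obtain S where S: "finite S" "S \<subseteq> carrier G" "generate G S = carrier G"
    using fg by (auto simp: finitely_generated_group_def)
  obtain c where c: "lower_central_series G c = {\<one>}" using nil by (auto simp: nilpotent_group_def)
  have "\<exists>k. infinite (lower_central_series G k) \<and> finite (lower_central_series G (Suc k))"
  proof (rule ccontr)
    assume *: "\<nexists>k. infinite (lower_central_series G k) \<and> finite (lower_central_series G (Suc k))"
    have "infinite (lower_central_series G k)" for k
    proof (induction k)
      case (Suc k)
      then show ?case using * by blast
    qed (use inf in simp)
    from this[of c] show False using c by simp
  qed
  then obtain k where k: "infinite (lower_central_series G k)" "finite (lower_central_series G (Suc k))" by blast
  obtain T where T: "finite T" "T \<subseteq> lower_central_series G k"
    "generate G (T \<union> lower_central_series G (Suc k)) = lower_central_series G k"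
    using lower_central_series_generated_mod_next[OF S] by blast
  \<comment> \<open>If all cyclic subgroups were finite, \<open>finite_generate_of_torsion\<close>
    would make the whole term finite.\<close>
  have "\<exists>z\<in>lower_central_series G k. infinite (generate G {z})"
  proof (rule ccontr)
    assume *: "\<not> ?thesis"
    have "finite (generate G (T \<union> lower_central_series G (Suc k)))"
      by (rule finite_generate_of_torsion[OF normal_lower_central_series k(2) T(1,2) lower_central_series_subset _ _
          lower_central_series_antimono subgroup_lower_central_series])
        (use * normal_between_lower_central_series in blast)+
    then show False using T k by simp
  qed
  then obtain u where u: "u \<in> lower_central_series G k" "infinite (generate G {u})" by blast
  have uc: "u \<in> carrier G" using u lower_central_series_subset by blast
  have injint: "inj (\<lambda>m::nat. u [^] m)"
    using infinite_cyclic_subgroup[OF uc] u uc by (simp add: carrier_subgroup_generated inj_def)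
  have um: "u [^] m \<in> lower_central_series G k" for m :: nat
  proof (induction m)
    case 0
    then show ?case using subgroup.one_closed[OF subgroup_lower_central_series] by simp
  next
    case (Suc m)
    then show ?case using subgroup.m_closed[OF subgroup_lower_central_series Suc u(1)] by simp
  qed
  define c where "c m = (\<lambda>s\<in>S. u [^] m \<otimes> s \<otimes> inv (u [^] m) \<otimes> inv s)" for m :: nat
  have "range c \<subseteq> S \<rightarrow>\<^sub>E lower_central_series G (Suc k)"
    using commutator_in_lower_central_series[OF um] S by (auto simp: c_def)
  moreover have "finite (S \<rightarrow>\<^sub>E lower_central_series G (Suc k))" using S k by (intro finite_PiE) auto
  ultimately have "\<not> inj c" using finite_subset range_inj_infinite by blast
  then obtain a b where ab: "c a = c b" "a < b"
    unfolding inj_def by (metis linorder_neqE_nat)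
  \<comment> \<open>Equal commutators of \<open>s\<close> with \<open>u^a\<close> and with
    \<open>u^b = u^a z\<close> leave, after cancelling \<open>u^a\<close>, the equation
    \<open>s = z s z^-1\<close>. The positive exponent \<open>b - a\<close> also keeps the powers of
    \<open>z\<close> distinct.\<close>
  define z where "z = u [^] (b - a)"
  have zc: "z \<in> carrier G" using uc by (simp add: z_def)
  have zs: "s \<in> {y \<in> carrier G. z \<otimes> y \<otimes> inv z \<otimes> inv y \<in> {\<one>}}" if s: "s \<in> S" for s
  proof -
    have sc: "s \<in> carrier G" using s S by blast
    have e: "u [^] b = u [^] a \<otimes> z" using uc ab by (simp add: z_def nat_pow_mult)
    let ?v = "u [^] a"
    have v: "?v \<in> carrier G" using uc by simp
    have "c a s = c b s" using ab by simp
    then have "?v \<otimes> s \<otimes> inv ?v \<otimes> inv s = ?v \<otimes> z \<otimes> s \<otimes> inv (?v \<otimes> z) \<otimes> inv s"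
      using s by (simp add: c_def e)
    then have "s \<otimes> (inv ?v \<otimes> inv s) = z \<otimes> s \<otimes> inv z \<otimes> (inv ?v \<otimes> inv s)"
      using sc v zc by (simp add: inv_mult_group m_assoc)
    then have "s = z \<otimes> s \<otimes> inv z"
      using sc v zc by (subst (asm) right_cancel) auto
    then have "z \<otimes> s \<otimes> inv z \<otimes> inv s = \<one>"
      using sc by (metis r_inv)
    then show ?thesis using sc zc by simp
  qed
  have triv: "{\<one>} \<lhd> G" by (simp add: one_is_normal)
  have "generate G S \<subseteq> {y \<in> carrier G. z \<otimes> y \<otimes> inv z \<otimes> inv y \<in> {\<one>}}"
    by (rule generate_subgroup_incl[OF _ subgroup_commutator_right[OF triv zc]]) (use zs in blast)
  then have c: "z \<otimes> y \<otimes> inv z \<otimes> inv y = \<one>" if "y \<in> carrier G" for y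
    using that S by blast
  have "z \<otimes> y = y \<otimes> z" if y: "y \<in> carrier G" for y
    using c[OF y] y zc by (metis inv_closed inv_equality inv_inv inv_solve_right m_closed)
  moreover have "inj (\<lambda>k::nat. z [^] k)"
  proof (rule injI)
    fix m n :: nat assume "z [^] m = z [^] n"
    then have "(b - a) * m = (b - a) * n" using injint uc by (simp add: z_def nat_pow_pow inj_eq)
    then show "m = n" using ab by simp
  qed
  ultimately show ?thesis using zc by blast
qed

end

section \<open>The mean ergodic theorem on \<open>l\<^sup>p(G)\<close>\<close>

lemma powr_convex_nonneg:
  fixes p :: real
  assumes p: "p \<ge> 1" and t: "0 \<le> t" "t \<le> 1" and a: "0 \<le> a" and b: "0 \<le> b"
  shows "(t * a + (1 - t) * b) powr p \<le> t * a powr p + (1 - t) * b powr p"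
proof -
  \<comment> \<open>The boundary cases \<open>a = 0\<close> and \<open>b = 0\<close> of convexity
    come down to \<open>s powr p \<le> s\<close> on the unit interval.\<close>
  have scale: "(s * c) powr p \<le> s * c powr p" if "0 \<le> s" "s \<le> 1" "0 \<le> c" for s c :: real
  proof (cases "s = 0")
    case False
    have "s powr p \<le> s powr 1" using that p False by (intro powr_mono') auto
    then show ?thesis using that by (auto simp: powr_mult intro: mult_right_mono)
  qed (use p in simp)
  consider "a = 0" | "b = 0" | "a > 0" "b > 0" using a b by linarith
  then show ?thesis
  proof cases
    case 3
    then show ?thesis
      using convex_onD[OF powr_convex[OF p], of t b a] t by (simp add: algebra_simps)
  qed (use scale[of "1 - t" b] scale[of t a] t a b p in auto)
qed

lemma lp_space_summable: "f \<in> lp_space G p \<Longrightarrow> (\<lambda>g. norm (f g) powr p) summable_on carrier G"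
  by (simp add: lp_space_def)

lemma lp_space_outside: "f \<in> lp_space G p \<Longrightarrow> g \<notin> carrier G \<Longrightarrow> f g = 0"
  by (simp add: lp_space_def)

lemma lp_norm_nonneg [simp]: "lp_norm G p f \<ge> 0"
  by (simp add: lp_norm_def)

lemma lp_norm_powr:
  assumes "p > 0"
  shows "lp_norm G p f powr p = (\<Sum>\<^sub>\<infinity>g\<in>carrier G. norm (f g) powr p)"
  using assms by (simp add: lp_norm_def powr_powr infsum_nonneg)

lemma lp_norm_le_iff:
  assumes "p > 0" "c \<ge> 0"
  shows "lp_norm G p f \<le> c \<longleftrightarrow> (\<Sum>\<^sub>\<infinity>g\<in>carrier G. norm (f g) powr p) \<le> c powr p"
  unfolding lp_norm_powr[OF assms(1), symmetric]
  using powr_mono2[of p "lp_norm G p f" c] powr_less_mono2[of p c "lp_norm G p f"] assms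
  by (cases "lp_norm G p f \<le> c") auto

lemma zero_in_lp_space [simp]: "p > 0 \<Longrightarrow> (\<lambda>g. 0) \<in> lp_space G p"
  by (simp add: lp_space_def)

lemma lp_norm_zero [simp]: "lp_norm G p (\<lambda>g. 0) = 0"
  by (simp add: lp_norm_def)

lemma lp_space_cmult:
  assumes "f \<in> lp_space G p"
  shows "(\<lambda>g. c * f g) \<in> lp_space G p"
  using assms by (auto simp: lp_space_def norm_mult powr_mult intro: summable_on_cmult_right)

lemma lp_norm_cmult:
  assumes "p > 0"
  shows "lp_norm G p (\<lambda>g. c * f g) = norm c * lp_norm G p f"
  using assms by (simp add: lp_norm_def norm_mult powr_mult infsum_cmult_right' powr_powr infsum_nonneg)

lemma lp_space_uminus: "f \<in> lp_space G p \<Longrightarrow> (\<lambda>g. - f g) \<in> lp_space G p"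
  using lp_space_cmult[of f G p "-1"] by simp

lemma norm_le_lp_norm:
  assumes f: "f \<in> lp_space G p" and p: "p > 0"
  shows "norm (f g) \<le> lp_norm G p f"
proof (cases "g \<in> carrier G")
  case True
  have "norm (f g) powr p \<le> (\<Sum>\<^sub>\<infinity>g\<in>carrier G. norm (f g) powr p)"
    using finite_sum_le_infsum[OF lp_space_summable[OF f], of "{g}"] True by simp
  also have "\<dots> = lp_norm G p f powr p" using p by (simp add: lp_norm_powr)
  finally show ?thesis using p powr_less_mono2[of p "lp_norm G p f" "norm (f g)"] by fastforce
qed (use f in \<open>simp add: lp_space_outside\<close>)

text \<open>After division by \<open>a\<close> and \<open>b\<close>, the modulus of the sum is at
  most \<open>a + b\<close> times a convex combination of two functions in the unit ball, with
  weight \<open>a / (a + b)\<close>, and \<open>powr p\<close> is convex. Strictly positive bounds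
  in place of the norms themselves keep these divisions meaningful when a norm vanishes.\<close>

lemma Minkowski_aux:
  assumes f: "f \<in> lp_space G p" and h: "h \<in> lp_space G p" and p: "p \<ge> 1"
    and a: "lp_norm G p f \<le> a" "a > 0" and b: "lp_norm G p h \<le> b" "b > 0"
  shows "(\<lambda>g. f g + h g) \<in> lp_space G p" "lp_norm G p (\<lambda>g. f g + h g) \<le> a + b"
proof -
  let ?t = "a / (a + b)"
  \<comment> \<open>The pointwise majorant of \<open>norm (f g + h g) powr p\<close>; its sum yields
    both summability and the norm bound.\<close>
  define B where "B g = (a + b) powr p * (?t * (norm (f g) powr p / a powr p) + (1 - ?t) * (norm (h g) powr p / b powr p))" for g
  have t1: "1 - ?t = b / (a + b)" using a b by (simp add: field_simps)
  have le: "norm (f g + h g) powr p \<le> B g" for g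
  proof -
    have "norm (f g + h g) powr p \<le> (norm (f g) + norm (h g)) powr p"
      using p by (intro powr_mono2 norm_triangle_ineq) auto
    also have "norm (f g) + norm (h g) = (a + b) * (?t * (norm (f g) / a) + (1 - ?t) * (norm (h g) / b))"
      unfolding t1 using a b by (simp add: distrib_left)
    also have "\<dots> powr p = (a + b) powr p * (?t * (norm (f g) / a) + (1 - ?t) * (norm (h g) / b)) powr p"
      by (rule powr_mult)
    also have "\<dots> \<le> (a + b) powr p * (?t * (norm (f g) / a) powr p + (1 - ?t) * (norm (h g) / b) powr p)"
      using a b p by (intro mult_left_mono powr_convex_nonneg) auto
    also have "\<dots> = B g" using a b by (simp add: B_def powr_divide)
    finally show ?thesis .
  qed
  have sf: "(\<lambda>g. norm (f g) powr p / a powr p) summable_on carrier G"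
    and sh: "(\<lambda>g. norm (h g) powr p / b powr p) summable_on carrier G"
    using summable_on_cmult_left[OF lp_space_summable[OF f], of "1 / a powr p"]
      summable_on_cmult_left[OF lp_space_summable[OF h], of "1 / b powr p"] by simp_all
  have sB: "B summable_on carrier G"
    unfolding B_def by (intro summable_on_cmult_right summable_on_add sf sh)
  have s: "(\<lambda>g. norm (f g + h g) powr p) summable_on carrier G"
    by (rule summable_on_comparison_test[OF sB]) (use le in auto)
  then show "(\<lambda>g. f g + h g) \<in> lp_space G p"
    using f h by (simp add: lp_space_def)
  have f1: "infsum (\<lambda>g. norm (f g) powr p / a powr p) (carrier G) \<le> 1"
    using a p lp_norm_le_iff[of p a G f] infsum_cmult_left'[of "\<lambda>g. norm (f g) powr p" "1 / a powr p" "carrier G"]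
    by simp
  have h1: "infsum (\<lambda>g. norm (h g) powr p / b powr p) (carrier G) \<le> 1"
    using b p lp_norm_le_iff[of p b G h] infsum_cmult_left'[of "\<lambda>g. norm (h g) powr p" "1 / b powr p" "carrier G"]
    by simp
  have "infsum B (carrier G) = (a + b) powr p * (?t * infsum (\<lambda>g. norm (f g) powr p / a powr p) (carrier G)
      + (1 - ?t) * infsum (\<lambda>g. norm (h g) powr p / b powr p) (carrier G))"
    unfolding B_def infsum_cmult_right'
      infsum_add[OF summable_on_cmult_right[OF sf] summable_on_cmult_right[OF sh]] ..
  also have "\<dots> \<le> (a + b) powr p * (?t * 1 + (1 - ?t) * 1)"
    using a b f1 h1 by (intro mult_left_mono add_mono) auto
  finally have "infsum B (carrier G) \<le> (a + b) powr p" by simp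
  moreover have "(\<Sum>\<^sub>\<infinity>g\<in>carrier G. norm (f g + h g) powr p) \<le> infsum B (carrier G)"
    by (rule infsum_mono[OF s sB le])
  ultimately show "lp_norm G p (\<lambda>g. f g + h g) \<le> a + b"
    using lp_norm_le_iff[of p "a + b" G] a b p by simp
qed

lemma lp_space_add:
  assumes "f \<in> lp_space G p" "h \<in> lp_space G p" "p \<ge> 1"
  shows "(\<lambda>g. f g + h g) \<in> lp_space G p"
  by (rule Minkowski_aux(1)[OF assms, of "lp_norm G p f + 1" "lp_norm G p h + 1"]) (simp_all add: add_nonneg_pos)

lemma lp_norm_triangle:
  assumes "f \<in> lp_space G p" "h \<in> lp_space G p" "p \<ge> 1"
  shows "lp_norm G p (\<lambda>g. f g + h g) \<le> lp_norm G p f + lp_norm G p h"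
proof (rule field_le_epsilon)
  fix e :: real assume "e > 0"
  \<comment> \<open>Adding \<open>e / 2\<close> makes each bound positive, as
    \<open>Minkowski_aux\<close> requires.\<close>
  then have "lp_norm G p (\<lambda>g. f g + h g) \<le> (lp_norm G p f + e / 2) + (lp_norm G p h + e / 2)"
    by (intro Minkowski_aux(2)[OF assms]) (simp_all add: add_nonneg_pos)
  then show "lp_norm G p (\<lambda>g. f g + h g) \<le> lp_norm G p f + lp_norm G p h + e" by simp
qed

lemma lp_space_diff:
  assumes "f \<in> lp_space G p" "h \<in> lp_space G p" "p \<ge> 1"
  shows "(\<lambda>g. f g - h g) \<in> lp_space G p"
  using lp_space_add[OF assms(1) lp_space_uminus[OF assms(2)] assms(3)] by simp

lemma lp_space_sum:
  assumes "finite I" "\<And>i. i \<in> I \<Longrightarrow> f i \<in> lp_space G p" "p \<ge> 1"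
  shows "(\<lambda>g. \<Sum>i\<in>I. f i g) \<in> lp_space G p"
  using assms by (induction I rule: finite_induct) (auto intro: lp_space_add)

lemma lp_norm_sum_le:
  assumes "finite I" "\<And>i. i \<in> I \<Longrightarrow> f i \<in> lp_space G p" "p \<ge> 1"
  shows "lp_norm G p (\<lambda>g. \<Sum>i\<in>I. f i g) \<le> (\<Sum>i\<in>I. lp_norm G p (f i))"
  using assms
proof (induction I rule: finite_induct)
  case (insert i I)
  have "lp_norm G p (\<lambda>g. f i g + (\<Sum>i\<in>I. f i g)) \<le> lp_norm G p (f i) + lp_norm G p (\<lambda>g. \<Sum>i\<in>I. f i g)"
    using insert by (intro lp_norm_triangle lp_space_sum) auto
  then show ?case using insert by (simp add: insert_iff)
qed auto

lemma lp_norm_minus_commute: "lp_norm G p (\<lambda>g. f g - h g) = lp_norm G p (\<lambda>g. h g - f g)"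
  by (simp add: lp_norm_def norm_minus_commute)

lemma Metric_space_lp:
  assumes p: "p \<ge> 1"
  shows "Metric_space (lp_space G p) (\<lambda>f f'. lp_norm G p (\<lambda>g. f g - f' g))"
proof
  fix f h k assume f: "f \<in> lp_space G p" and h: "h \<in> lp_space G p"
  show "lp_norm G p (\<lambda>g. f g - h g) = 0 \<longleftrightarrow> f = h"
  proof
    assume 0: "lp_norm G p (\<lambda>g. f g - h g) = 0"
    have "norm (f g - h g) \<le> 0" for g
      using norm_le_lp_norm[OF lp_space_diff[OF f h p], of g] p 0 by simp
    then show "f = h" by (auto simp: fun_eq_iff)
  qed auto
  assume k: "k \<in> lp_space G p"
  show "lp_norm G p (\<lambda>g. f g - k g) \<le> lp_norm G p (\<lambda>g. f g - h g) + lp_norm G p (\<lambda>g. h g - k g)"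
    using lp_norm_triangle[OF lp_space_diff[OF f h p] lp_space_diff[OF h k p] p] by simp
qed (simp, rule lp_norm_minus_commute)

lemma topspace_lp_topology [simp]: "p \<ge> 1 \<Longrightarrow> topspace (lp_topology G p) = lp_space G p"
  by (simp add: lp_topology_def Metric_space.topspace_mtopology[OF Metric_space_lp])

text \<open>Coordinates are 1-Lipschitz. Closedness of cycles and of cocycles is later reduced to
  the vanishing of such coordinates.\<close>

lemma continuous_map_lp_eval:
  assumes p: "p \<ge> 1"
  shows "continuous_map (lp_topology G p) euclidean (\<lambda>f. f g)"
proof -
  have "dist (f g) (h g) \<le> lp_norm G p (\<lambda>g. f g - h g)" if "f \<in> lp_space G p" "h \<in> lp_space G p" for f h
    using norm_le_lp_norm[OF lp_space_diff[OF that p], of g] p by (simp add: dist_norm)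
  then show ?thesis
    unfolding lp_topology_def mtopology_is_euclidean[symmetric]
      Metric_space.metric_continuous_map[OF Metric_space_lp[OF p] Met_TC.Metric_space_axioms]
    by (auto intro: le_less_trans)
qed

lemma limitin_lp_topology:
  assumes p: "p \<ge> 1"
  shows "limitin (lp_topology G p) f l F \<longleftrightarrow> l \<in> lp_space G p \<and> (\<forall>\<^sub>F n in F. f n \<in> lp_space G p) \<and>
    ((\<lambda>n. lp_norm G p (\<lambda>g. f n g - l g)) \<longlongrightarrow> 0) F"
  unfolding lp_topology_def by (rule Metric_space.limitin_metric_dist_null[OF Metric_space_lp[OF p]])

section \<open>Translations and ergodic averages\<close>

definition translate :: "('g, 'x) monoid_scheme \<Rightarrow> 'g \<Rightarrow> ('g \<Rightarrow> complex) \<Rightarrow> 'g \<Rightarrow> complex" where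
  "translate G w f = (\<lambda>g. if g \<in> carrier G then f (inv\<^bsub>G\<^esub> w \<otimes>\<^bsub>G\<^esub> g) else 0)"

context group begin

lemma bij_betw_left_translation:
  assumes "w \<in> carrier G"
  shows "bij_betw ((\<otimes>) w) (carrier G) (carrier G)"
  using assms by (intro bij_betwI[of _ _ _ "(\<otimes>) (inv w)"]) (auto simp flip: m_assoc)

lemma translate_lp_space:
  assumes "w \<in> carrier G" "f \<in> lp_space G p"
  shows "translate G w f \<in> lp_space G p"
proof -
  have "(\<lambda>g. norm (f (inv w \<otimes> g)) powr p) summable_on carrier G"
    using assms summable_on_reindex_bij_betw[OF bij_betw_left_translation[of "inv w"], of "\<lambda>g. norm (f g) powr p"]
    by (simp add: lp_space_def)
  then have "(\<lambda>g. norm (translate G w f g) powr p) summable_on carrier G"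
    by (rule summable_on_cong[THEN iffD1, rotated]) (simp add: translate_def)
  then show ?thesis by (simp add: lp_space_def translate_def)
qed

lemma lp_norm_translate:
  assumes "w \<in> carrier G"
  shows "lp_norm G p (translate G w f) = lp_norm G p f"
proof -
  have "(\<Sum>\<^sub>\<infinity>g\<in>carrier G. norm (translate G w f g) powr p) = (\<Sum>\<^sub>\<infinity>g\<in>carrier G. norm (f (inv w \<otimes> g)) powr p)"
    by (rule infsum_cong) (simp add: translate_def)
  also have "\<dots> = (\<Sum>\<^sub>\<infinity>g\<in>carrier G. norm (f g) powr p)"
    using assms infsum_reindex_bij_betw[OF bij_betw_left_translation[of "inv w"], of "\<lambda>g. norm (f g) powr p"] by simp
  finally show ?thesis by (simp add: lp_norm_def)
qed

lemma translate_translate: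
  assumes "v \<in> carrier G" "w \<in> carrier G"
  shows "translate G v (translate G w f) = translate G (v \<otimes> w) f"
  using assms by (auto simp: translate_def fun_eq_iff inv_mult_group m_assoc)

lemma translate_one:
  assumes "f \<in> lp_space G p"
  shows "translate G \<one> f = f"
  using assms by (auto simp: translate_def fun_eq_iff lp_space_outside)

text \<open>The powers run from 1 to \<open>N\<close>, which matches weights that drop from 1 at
  \<open>j = 0\<close> to 0 at \<open>j = N\<close>. For \<open>N = 0\<close> the value is
  0.\<close>

definition ergodic_average :: "'a \<Rightarrow> nat \<Rightarrow> ('a \<Rightarrow> complex) \<Rightarrow> 'a \<Rightarrow> complex" where
  "ergodic_average w N f = (\<lambda>g. 1 / of_nat N * (\<Sum>j<N. translate G (w [^] Suc j) f g))"

text \<open>The coefficients solve \<open>(1 - T) Q\<^sub>N = 1 - A\<^sub>N\<close>, where \<open>T\<close> is the translation by \<open>w\<close>.\<close>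

definition ergodic_potential :: "'a \<Rightarrow> nat \<Rightarrow> ('a \<Rightarrow> complex) \<Rightarrow> 'a \<Rightarrow> complex" where
  "ergodic_potential w N f = (\<lambda>g. \<Sum>j<N. (1 - of_nat j / of_nat N) * translate G (w [^] j) f g)"

lemma ergodic_average_lp_space:
  assumes "w \<in> carrier G" "f \<in> lp_space G p" "p \<ge> 1"
  shows "ergodic_average w N f \<in> lp_space G p"
  unfolding ergodic_average_def
  by (intro lp_space_cmult lp_space_sum translate_lp_space nat_pow_closed assms) simp

lemma ergodic_potential_lp_space:
  assumes "w \<in> carrier G" "f \<in> lp_space G p" "p \<ge> 1"
  shows "ergodic_potential w N f \<in> lp_space G p"
  unfolding ergodic_potential_def
  by (intro lp_space_cmult lp_space_sum translate_lp_space nat_pow_closed assms) simp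

lemma lp_norm_ergodic_average_le:
  assumes "w \<in> carrier G" "f \<in> lp_space G p" "p \<ge> 1"
  shows "lp_norm G p (ergodic_average w N f) \<le> lp_norm G p f"
proof -
  have "lp_norm G p (ergodic_average w N f) =
      1 / real N * lp_norm G p (\<lambda>g. \<Sum>j<N. translate G (w [^] Suc j) f g)"
    unfolding ergodic_average_def using assms by (subst lp_norm_cmult) (auto simp: norm_divide)
  also have "\<dots> \<le> 1 / real N * (\<Sum>j<N. lp_norm G p (translate G (w [^] Suc j) f))"
    by (intro mult_left_mono lp_norm_sum_le translate_lp_space nat_pow_closed assms) auto
  also have "\<dots> = 1 / real N * (real N * lp_norm G p f)"
    using assms by (simp add: lp_norm_translate del: nat_pow_Suc)
  \<comment> \<open>Equality holds for positive \<open>N\<close>; for \<open>N = 0\<close> the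
    factor \<open>1 / 0\<close> is 0.\<close>
  also have "\<dots> \<le> lp_norm G p f" by simp
  finally show ?thesis .
qed

text \<open>Summation by parts. Passing from \<open>j\<close> to \<open>j + 1\<close> lowers the
  weight by \<open>1 / N\<close>: these differences add up to the average, and the rest
  telescopes.\<close>

lemma ergodic_potential_minus_translate:
  assumes w: "w \<in> carrier G" and f: "f \<in> lp_space G p" and N: "N > 0"
  shows "ergodic_potential w N f g - translate G w (ergodic_potential w N f) g = f g - ergodic_average w N f g"
proof (cases "g \<in> carrier G")
  case g: True
  define u where "u j = translate G (w [^] j) f g" for j :: nat
  define c :: "nat \<Rightarrow> complex" where "c j = 1 - of_nat j / of_nat N" for j
  have u0: "u 0 = f g" by (simp add: u_def translate_one[OF f])
  have step: "translate G w (translate G (w [^] j) f) g = u (Suc j)" for j :: nat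
    unfolding u_def nat_pow_Suc2[OF w] by (simp add: translate_translate w)
  have cs: "c j = c (Suc j) + 1 / of_nat N" for j by (simp add: c_def add_divide_distrib)
  have "translate G w (ergodic_potential w N f) g = (\<Sum>j<N. c j * translate G w (translate G (w [^] j) f) g)"
    using g by (simp add: translate_def ergodic_potential_def c_def)
  then have "ergodic_potential w N f g - translate G w (ergodic_potential w N f) g
      = (\<Sum>j<N. c j * u j - c j * u (Suc j))"
    by (simp add: step ergodic_potential_def sum_subtractf) (simp add: u_def c_def)
  also have "\<dots> = (\<Sum>j<N. (c j * u j - c (Suc j) * u (Suc j)) - 1 / of_nat N * u (Suc j))"
  proof (rule sum.cong[OF refl])
    fix j
    show "c j * u j - c j * u (Suc j) = (c j * u j - c (Suc j) * u (Suc j)) - 1 / of_nat N * u (Suc j)"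
      by (subst (2) cs) (simp only: distrib_right diff_diff_eq)
  qed
  also have "\<dots> = (\<Sum>j<N. c j * u j - c (Suc j) * u (Suc j)) - 1 / of_nat N * (\<Sum>j<N. u (Suc j))"
    unfolding sum_subtractf[of "\<lambda>j. c j * u j - c (Suc j) * u (Suc j)"] sum_distrib_left ..
  also have "(\<Sum>j<N. c j * u j - c (Suc j) * u (Suc j)) = c 0 * u 0 - c N * u N"
    by (rule sum_lessThan_telescope')
  \<comment> \<open>The weight is 1 at 0, and it vanishes at \<open>N\<close>, which is where
    \<open>N > 0\<close> enters.\<close>
  also have "\<dots> = f g" using N by (simp add: u0 c_def)
  finally show ?thesis by (simp add: ergodic_average_def u_def)
qed (use f in \<open>simp add: ergodic_potential_def ergodic_average_def translate_def lp_space_outside\<close>)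

text \<open>Infinite order of \<open>w\<close> makes the translates of \<open>s\<close> distinct, so
  the average equals \<open>1 / N\<close> on a set of \<open>N\<close> points: its norm is
  \<open>N powr (1 / p) / N\<close>.\<close>

lemma lp_norm_ergodic_average_point_mass:
  assumes w: "w \<in> carrier G" "inj (\<lambda>k::nat. w [^] k)" and s: "s \<in> carrier G" and p: "p > 0" and N: "N > 0"
  shows "lp_norm G p (ergodic_average w N (\<lambda>g. if g = s then 1 else 0)) \<le> real N powr ((1 - p) / p)"
proof -
  let ?P = "(\<lambda>j. w [^] Suc j \<otimes> s) ` {..<N}"
  have P: "?P \<subseteq> carrier G" using w s by auto
  have eq: "inv (w [^] Suc j) \<otimes> g = s \<longleftrightarrow> g = w [^] Suc j \<otimes> s" if "g \<in> carrier G" for g j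
    using w s that by (metis inv_solve_left nat_pow_closed)
  have inj: "inj_on (\<lambda>j. w [^] Suc j \<otimes> s) {..<N}"
  proof (rule inj_onI)
    fix i j assume "w [^] Suc i \<otimes> s = w [^] Suc j \<otimes> s"
    then have "w [^] Suc i = w [^] Suc j" using w s by (subst (asm) right_cancel) auto
    then show "i = j" using injD[OF w(2), of "Suc i" "Suc j"] by simp
  qed
  have val: "ergodic_average w N (\<lambda>g. if g = s then 1 else 0) g = (if g \<in> ?P then 1 / of_nat N else 0)"
    if g: "g \<in> carrier G" for g
  proof -
    have "(\<Sum>j<N. translate G (w [^] Suc j) (\<lambda>g. if g = s then 1 else 0 :: complex) g) =
        (\<Sum>j<N. if g = w [^] Suc j \<otimes> s then 1 else 0)"
      using g eq[OF g] by (simp add: translate_def)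
    also have "\<dots> = (if g \<in> ?P then 1 else 0)"
    proof (cases "g \<in> ?P")
      case True
      then obtain i where i: "i < N" "g = w [^] Suc i \<otimes> s" by blast
      then have "(\<Sum>j<N. if g = w [^] Suc j \<otimes> s then 1 else 0 :: complex) = (\<Sum>j<N. if j = i then 1 else 0)"
        using inj by (intro sum.cong refl) (auto dest!: inj_onD simp del: nat_pow_Suc)
      then show ?thesis using True i by simp
    next
      case False
      then have "\<And>j. j < N \<Longrightarrow> g \<noteq> w [^] Suc j \<otimes> s" by blast
      then show ?thesis using False by simp
    qed
    finally show ?thesis by (simp add: ergodic_average_def)
  qed
  have "(\<Sum>\<^sub>\<infinity>g\<in>carrier G. norm (ergodic_average w N (\<lambda>g. if g = s then 1 else 0) g) powr p)
      = (\<Sum>\<^sub>\<infinity>g\<in>?P. (1 / real N) powr p)"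
    by (rule infsum_cong_neutral) (use P val p in \<open>auto simp: norm_divide simp del: nat_pow_Suc\<close>)
  also have "\<dots> = real N * (1 / real N) powr p"
    using card_image[OF inj] by simp
  also have "\<dots> = (real N powr ((1 - p) / p)) powr p"
    using N p by (simp add: powr_powr powr_diff powr_divide)
  finally show ?thesis using p by (simp add: lp_norm_le_iff)
qed

text \<open>Contractivity reduces the claim to a dense class: up to an error of norm
  \<open>e / 2\<close> the function is a finite combination of point masses, and for those the
  explicit decay is available.\<close>

theorem ergodic_average_tendsto_zero:
  assumes w: "w \<in> carrier G" "inj (\<lambda>k::nat. w [^] k)" and f: "f \<in> lp_space G p" and p: "p > 1"
  shows "(\<lambda>N. lp_norm G p (ergodic_average w N f)) \<longlonglongrightarrow> 0"
proof (rule order_tendstoI)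
  fix e :: real assume "e > 0"
  \<comment> \<open>The tolerance for the sum of p-th powers that makes the norm of the tail
    \<open>f2\<close> at most \<open>e / 2\<close>.\<close>
  define \<delta> where "\<delta> = (e / 2) powr p"
  let ?E = "\<lambda>g. norm (f g) powr p"
  have "\<delta> > 0" using \<open>e > 0\<close> by (simp add: \<delta>_def)
  then obtain S where S: "finite S" "S \<subseteq> carrier G" "dist (sum ?E S) (infsum ?E (carrier G)) \<le> \<delta>"
    using infsum_finite_approximation[OF lp_space_summable[OF f]] by blast
  define f2 where "f2 g = (if g \<in> S then 0 else f g)" for g
  define ps :: "'a \<Rightarrow> 'a \<Rightarrow> complex" where "ps s g = (if g = s then 1 else 0)" for s g
  define C where "C = (\<Sum>s\<in>S. norm (f s))"
  have E2: "(\<lambda>g. norm (f2 g) powr p) summable_on carrier G"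
    by (rule summable_on_comparison_test[OF lp_space_summable[OF f]]) (auto simp: f2_def)
  then have f2: "f2 \<in> lp_space G p" using f by (simp add: lp_space_def f2_def)
  have "infsum (\<lambda>g. norm (f2 g) powr p) (carrier G) = infsum ?E (carrier G - S)"
    by (rule infsum_cong_neutral) (use p in \<open>auto simp: f2_def\<close>)
  also have "\<dots> = infsum ?E (carrier G) - sum ?E S"
    using infsum_Diff[OF lp_space_summable[OF f] _ S(2)] S(1) by simp
  also have "\<dots> \<le> \<delta>" using S(3) by (simp add: dist_real_def abs_le_iff)
  finally have n2: "lp_norm G p f2 \<le> e / 2"
    using p \<open>e > 0\<close> lp_norm_le_iff[of p "e / 2" G f2] by (simp add: \<delta>_def)
  have ps: "ps s \<in> lp_space G p" if "s \<in> S" for s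
  proof -
    have "(\<lambda>g. norm (ps s g) powr p) summable_on carrier G \<longleftrightarrow> (\<lambda>g. norm (ps s g) powr p) summable_on {s}"
      by (rule summable_on_cong_neutral) (use that S p in \<open>auto simp: ps_def\<close>)
    then show ?thesis using that S by (auto simp: lp_space_def ps_def)
  qed
  have split: "f = (\<lambda>g. f2 g + (\<Sum>s\<in>S. f s * ps s g))"
    using S(1) by (auto simp: fun_eq_iff f2_def ps_def if_distrib[of "(*) _"] cong: if_cong)
  have avg: "ergodic_average w N f =
      (\<lambda>g. ergodic_average w N f2 g + (\<Sum>s\<in>S. f s * ergodic_average w N (ps s) g))" for N
  proof
    fix g
    let ?T = "\<lambda>j h. translate G (w [^] Suc j) h g"
    have "?T j f = ?T j f2 + (\<Sum>s\<in>S. f s * ?T j (ps s))" for j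
      by (subst split) (simp add: translate_def)
    then have "ergodic_average w N f g = 1 / of_nat N * ((\<Sum>j<N. ?T j f2) + (\<Sum>s\<in>S. f s * (\<Sum>j<N. ?T j (ps s))))"
      unfolding ergodic_average_def sum_distrib_left[of "f _"]
      by (subst sum.swap) (simp only: sum.distrib)
    then show "ergodic_average w N f g = ergodic_average w N f2 g + (\<Sum>s\<in>S. f s * ergodic_average w N (ps s) g)"
      unfolding ergodic_average_def by (simp only: distrib_left sum_distrib_left mult.left_commute)
  qed
  have bound: "lp_norm G p (ergodic_average w N f) \<le> e / 2 + C * real N powr ((1 - p) / p)" if N: "N > 0" for N
  proof -
    have "lp_norm G p (ergodic_average w N f) \<le> lp_norm G p (ergodic_average w N f2)
        + lp_norm G p (\<lambda>g. \<Sum>s\<in>S. f s * ergodic_average w N (ps s) g)"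
      unfolding avg using p
      by (intro lp_norm_triangle ergodic_average_lp_space lp_space_sum lp_space_cmult w f2 ps S) auto
    also have "lp_norm G p (ergodic_average w N f2) \<le> e / 2"
      using lp_norm_ergodic_average_le[OF w(1) f2, of N] n2 p by simp
    also have "lp_norm G p (\<lambda>g. \<Sum>s\<in>S. f s * ergodic_average w N (ps s) g)
        \<le> (\<Sum>s\<in>S. lp_norm G p (\<lambda>g. f s * ergodic_average w N (ps s) g))"
      using p by (intro lp_norm_sum_le ergodic_average_lp_space lp_space_cmult w ps S) auto
    also have "\<dots> = (\<Sum>s\<in>S. norm (f s) * lp_norm G p (ergodic_average w N (ps s)))"
      using p by (simp add: lp_norm_cmult)
    also have "\<dots> \<le> (\<Sum>s\<in>S. norm (f s) * real N powr ((1 - p) / p))"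
      using S p N unfolding ps_def
      by (intro sum_mono mult_left_mono lp_norm_ergodic_average_point_mass w) auto
    finally show ?thesis by (simp add: C_def sum_distrib_right)
  qed
  \<comment> \<open>The exponent is negative because \<open>p > 1\<close>; for \<open>p = 1\<close>
    the bound would not decay.\<close>
  have "(\<lambda>N. real N powr ((1 - p) / p)) \<longlonglongrightarrow> 0"
    using p by (intro tendsto_neg_powr filterlim_real_sequentially) (simp add: divide_neg_pos)
  then have "(\<lambda>N. e / 2 + C * real N powr ((1 - p) / p)) \<longlonglongrightarrow> e / 2 + C * 0"
    by (intro tendsto_intros)
  then have "\<forall>\<^sub>F N in sequentially. e / 2 + C * real N powr ((1 - p) / p) < e"
    by (rule order_tendstoD(2)) (use \<open>e > 0\<close> in simp)
  then show "\<forall>\<^sub>F N in sequentially. lp_norm G p (ergodic_average w N f) < e"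
    using eventually_gt_at_top[of 0] by eventually_elim (rule le_less_trans[OF bound])
next
  fix e :: real assume "e < 0"
  then show "\<forall>\<^sub>F N in sequentially. e < lp_norm G p (ergodic_average w N f)"
    using less_le_trans[OF _ lp_norm_nonneg] by (intro always_eventually allI) blast
qed

text \<open>The form used for chains and cochains alike: the approximants on the left are those in
  the image of \<open>1 - T\<close>, hence the ones that become boundaries or coboundaries.\<close>

lemma limitin_minus_ergodic_average:
  assumes w: "w \<in> carrier G" "inj (\<lambda>k::nat. w [^] k)" and f: "f \<in> lp_space G p" and p: "p > 1"
  shows "limitin (lp_topology G p) (\<lambda>N g. f g - ergodic_average w N f g) f sequentially"
proof -
  have "lp_norm G p (\<lambda>g. f g - ergodic_average w N f g - f g) = lp_norm G p (ergodic_average w N f)" for N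
    using lp_norm_minus_commute[of G p "\<lambda>g. 0" "ergodic_average w N f"] by simp
  then show ?thesis
    using ergodic_average_tendsto_zero[OF assms] p f
    by (simp add: limitin_lp_topology lp_space_diff ergodic_average_lp_space w)
qed

end

section \<open>Dual bases and chain homotopies\<close>

context left_module begin

lemma smult_l_null [simp]: "x \<in> carrier M \<Longrightarrow> \<zero>\<^bsub>R\<^esub> \<odot>\<^bsub>M\<^esub> x = \<zero>\<^bsub>M\<^esub>"
  using smult_l_distr[of "\<zero>\<^bsub>R\<^esub>" "\<zero>\<^bsub>R\<^esub>" x] by (simp add: M.add.l_cancel_one')

lemma smult_r_null [simp]: "a \<in> carrier R \<Longrightarrow> a \<odot>\<^bsub>M\<^esub> \<zero>\<^bsub>M\<^esub> = \<zero>\<^bsub>M\<^esub>"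
  using smult_r_distr[of a "\<zero>\<^bsub>M\<^esub>" "\<zero>\<^bsub>M\<^esub>"] by (simp add: M.add.l_cancel_one')

lemma smult_r_minus:
  assumes "a \<in> carrier R" "x \<in> carrier M"
  shows "a \<odot>\<^bsub>M\<^esub> (\<ominus>\<^bsub>M\<^esub> x) = \<ominus>\<^bsub>M\<^esub> (a \<odot>\<^bsub>M\<^esub> x)"
  using assms smult_r_distr[of a x "\<ominus>\<^bsub>M\<^esub> x"] by (intro M.add.inv_equality[symmetric]) (auto simp: M.r_neg M.a_comm)

lemma smult_finsum:
  assumes "finite A" "a \<in> carrier R" "m \<in> A \<rightarrow> carrier M"
  shows "a \<odot>\<^bsub>M\<^esub> (\<Oplus>\<^bsub>M\<^esub>b\<in>A. m b) = (\<Oplus>\<^bsub>M\<^esub>b\<in>A. a \<odot>\<^bsub>M\<^esub> m b)"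
  using assms by (induction A rule: finite_induct) (auto simp: smult_r_distr Pi_iff)

lemma finsum_smult_superset:
  assumes "finite A" "{b. c b \<noteq> \<zero>\<^bsub>R\<^esub>} \<subseteq> A" "\<And>b. b \<in> A \<Longrightarrow> c b \<in> carrier R" "\<And>b. b \<in> A \<Longrightarrow> m b \<in> carrier M"
  shows "(\<Oplus>\<^bsub>M\<^esub>b\<in>{b. c b \<noteq> \<zero>\<^bsub>R\<^esub>}. c b \<odot>\<^bsub>M\<^esub> m b) = (\<Oplus>\<^bsub>M\<^esub>b\<in>A. c b \<odot>\<^bsub>M\<^esub> m b)"
  using assms by (intro M.add.finprod_mono_neutral_cong_left) auto

end

section \<open>Linear maps, dual bases and lifting\<close>

lemma linear_map_closed: "linear_map R M N h \<Longrightarrow> x \<in> carrier M \<Longrightarrow> h x \<in> carrier N"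
  by (auto simp: linear_map_def)

lemma linear_map_add:
  "linear_map R M N h \<Longrightarrow> x \<in> carrier M \<Longrightarrow> y \<in> carrier M \<Longrightarrow> h (x \<oplus>\<^bsub>M\<^esub> y) = h x \<oplus>\<^bsub>N\<^esub> h y"
  by (auto simp: linear_map_def)

lemma linear_map_smult:
  "linear_map R M N h \<Longrightarrow> a \<in> carrier R \<Longrightarrow> x \<in> carrier M \<Longrightarrow> h (a \<odot>\<^bsub>M\<^esub> x) = a \<odot>\<^bsub>N\<^esub> h x"
  by (auto simp: linear_map_def)

text \<open>The source enters only through its zero, so that \<open>free_module R B\<close>
  qualifies directly.\<close>

lemma linear_map_zero:
  assumes h: "linear_map R M N h" and N: "abelian_group N" and "\<zero>\<^bsub>M\<^esub> \<in> carrier M" "\<zero>\<^bsub>M\<^esub> \<oplus>\<^bsub>M\<^esub> \<zero>\<^bsub>M\<^esub> = \<zero>\<^bsub>M\<^esub>"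
  shows "h \<zero>\<^bsub>M\<^esub> = \<zero>\<^bsub>N\<^esub>"
proof -
  interpret N: abelian_group N by fact
  show ?thesis
    using linear_map_add[OF h, of "\<zero>\<^bsub>M\<^esub>" "\<zero>\<^bsub>M\<^esub>"] linear_map_closed[OF h, of "\<zero>\<^bsub>M\<^esub>"] assms(3,4)
    by (simp add: N.add.l_cancel_one')
qed

lemma linear_map_minus:
  assumes h: "linear_map R M N h" and "left_module R M" "left_module R N" and x: "x \<in> carrier M"
  shows "h (\<ominus>\<^bsub>M\<^esub> x) = \<ominus>\<^bsub>N\<^esub> h x"
proof -
  interpret M: left_module R M by fact
  interpret N: left_module R N by fact
  have "h (\<ominus>\<^bsub>M\<^esub> x) \<oplus>\<^bsub>N\<^esub> h x = \<zero>\<^bsub>N\<^esub>"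
    using linear_map_add[OF h, of "\<ominus>\<^bsub>M\<^esub> x" x] linear_map_zero[OF h] x
    by (simp add: M.M.l_neg N.M.abelian_group_axioms)
  then show ?thesis using x linear_map_closed[OF h] by (intro N.M.minus_equality[symmetric]) auto
qed

lemma linear_map_finsum:
  assumes h: "linear_map R M N h" and "left_module R M" "left_module R N"
    and A: "finite A" "m \<in> A \<rightarrow> carrier M"
  shows "h (\<Oplus>\<^bsub>M\<^esub>b\<in>A. m b) = (\<Oplus>\<^bsub>N\<^esub>b\<in>A. h (m b))"
proof -
  interpret M: left_module R M by fact
  interpret N: left_module R N by fact
  show ?thesis using A
  proof (induction A rule: finite_induct)
    case empty
    then show ?case using linear_map_zero[OF h] by (simp add: N.M.abelian_group_axioms)
  next
    case (insert b A)
    then have "(\<lambda>b. h (m b)) \<in> A \<rightarrow> carrier N" "h (m b) \<in> carrier N"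
      using linear_map_closed[OF h] by auto
    then show ?case using insert linear_map_add[OF h] by (simp add: Pi_iff)
  qed
qed

text \<open>The dual basis of a projective module: elements \<open>r b\<close> together with
  coordinate functionals sending \<open>x\<close> to \<open>s x b\<close>. Bundling the functionals
  into one map to the free module encodes their linearity and the finiteness of the support at
  once.\<close>

definition dual_basis ::
  "('r, 'x) ring_scheme \<Rightarrow> ('r, 'm, 'y) module_scheme \<Rightarrow> 'b set \<Rightarrow> ('m \<Rightarrow> 'b \<Rightarrow> 'r) \<Rightarrow> ('b \<Rightarrow> 'm) \<Rightarrow> bool"
where
  "dual_basis R P B s r \<longleftrightarrow>
     r \<in> B \<rightarrow> carrier P \<and> linear_map R P (free_module R B) s \<and>
     (\<forall>x\<in>carrier P. x = (\<Oplus>\<^bsub>P\<^esub>b\<in>{b. s x b \<noteq> \<zero>\<^bsub>R\<^esub>}. s x b \<odot>\<^bsub>P\<^esub> r b))"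

lemma dual_basisD:
  assumes "dual_basis R P B s r"
  shows "b \<in> B \<Longrightarrow> r b \<in> carrier P"
    and "x \<in> carrier P \<Longrightarrow> finite {b. s x b \<noteq> \<zero>\<^bsub>R\<^esub>}"
    and "x \<in> carrier P \<Longrightarrow> {b. s x b \<noteq> \<zero>\<^bsub>R\<^esub>} \<subseteq> B"
    and "x \<in> carrier P \<Longrightarrow> b \<in> B \<Longrightarrow> s x b \<in> carrier R"
    and "x \<in> carrier P \<Longrightarrow> y \<in> carrier P \<Longrightarrow> s (x \<oplus>\<^bsub>P\<^esub> y) b = s x b \<oplus>\<^bsub>R\<^esub> s y b"
    and "a \<in> carrier R \<Longrightarrow> x \<in> carrier P \<Longrightarrow> s (a \<odot>\<^bsub>P\<^esub> x) b = a \<otimes>\<^bsub>R\<^esub> s x b"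
    and "x \<in> carrier P \<Longrightarrow> (\<Oplus>\<^bsub>P\<^esub>b\<in>{b. s x b \<noteq> \<zero>\<^bsub>R\<^esub>}. s x b \<odot>\<^bsub>P\<^esub> r b) = x"
proof -
  have s: "linear_map R P (free_module R B) s" using assms by (simp add: dual_basis_def)
  show "b \<in> B \<Longrightarrow> r b \<in> carrier P" using assms by (auto simp: dual_basis_def)
  show "x \<in> carrier P \<Longrightarrow> (\<Oplus>\<^bsub>P\<^esub>b\<in>{b. s x b \<noteq> \<zero>\<^bsub>R\<^esub>}. s x b \<odot>\<^bsub>P\<^esub> r b) = x"
    using assms unfolding dual_basis_def by (metis (no_types, lifting))
  show "x \<in> carrier P \<Longrightarrow> finite {b. s x b \<noteq> \<zero>\<^bsub>R\<^esub>}"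
    "x \<in> carrier P \<Longrightarrow> {b. s x b \<noteq> \<zero>\<^bsub>R\<^esub>} \<subseteq> B"
    "x \<in> carrier P \<Longrightarrow> b \<in> B \<Longrightarrow> s x b \<in> carrier R"
    using linear_map_closed[OF s, of x] by (auto simp: free_module_def)
  show "x \<in> carrier P \<Longrightarrow> y \<in> carrier P \<Longrightarrow> s (x \<oplus>\<^bsub>P\<^esub> y) b = s x b \<oplus>\<^bsub>R\<^esub> s y b"
    using linear_map_add[OF s, of x y] by (simp add: free_module_def)
  show "a \<in> carrier R \<Longrightarrow> x \<in> carrier P \<Longrightarrow> s (a \<odot>\<^bsub>P\<^esub> x) b = a \<otimes>\<^bsub>R\<^esub> s x b"
    using linear_map_smult[OF s, of a x] by (simp add: free_module_def)
qed

text \<open>Induction over \<open>A\<close> with \<open>v\<close> arbitrary: splitting off the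
  coordinate at one basis element leaves a vector supported on the remaining ones.\<close>

lemma free_module_expansion:
  fixes B :: "'b set"
  assumes P: "left_module R P" and r: "linear_map R (free_module R B) P r"
    and v: "v \<in> carrier (free_module R B)" and A: "finite A" "A \<subseteq> B" "{b. v b \<noteq> \<zero>\<^bsub>R\<^esub>} \<subseteq> A"
  shows "r v = (\<Oplus>\<^bsub>P\<^esub>b\<in>A. v b \<odot>\<^bsub>P\<^esub> r (\<lambda>c. if c = b then \<one>\<^bsub>R\<^esub> else \<zero>\<^bsub>R\<^esub>))"
proof -
  interpret P: left_module R P by fact
  define e where "e b = (\<lambda>c. if c = b then \<one>\<^bsub>R\<^esub> else \<zero>\<^bsub>R\<^esub>)" for b :: 'b
  have e: "e b \<in> carrier (free_module R B)" if "b \<in> B" for b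
  proof -
    have "{c. e b c \<noteq> \<zero>\<^bsub>R\<^esub>} \<subseteq> {b}" by (auto simp: e_def)
    then show ?thesis using that by (auto simp: free_module_def e_def intro: finite_subset)
  qed
  have "r v = (\<Oplus>\<^bsub>P\<^esub>b\<in>A. v b \<odot>\<^bsub>P\<^esub> r (e b))" using A(1,2) v A(3)
  proof (induction A arbitrary: v rule: finite_induct)
    case empty
    then have "v = \<zero>\<^bsub>free_module R B\<^esub>" by (auto simp: free_module_def)
    moreover have "r \<zero>\<^bsub>free_module R B\<^esub> = \<zero>\<^bsub>P\<^esub>"
      by (rule linear_map_zero[OF r P.M.abelian_group_axioms]) (auto simp: free_module_def)
    ultimately show ?case by simp
  next
    case (insert b A)
    have vR: "v c \<in> carrier R" for c using insert.prems(2) by (cases "c \<in> B") (auto simp: free_module_def)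
    define v' where "v' = v(b := \<zero>\<^bsub>R\<^esub>)"
    have sub: "{c. v' c \<noteq> \<zero>\<^bsub>R\<^esub>} \<subseteq> A" "{c. v' c \<noteq> \<zero>\<^bsub>R\<^esub>} \<subseteq> {c. v c \<noteq> \<zero>\<^bsub>R\<^esub>}" using insert.prems(3) by (auto simp: v'_def)
    then have v': "v' \<in> carrier (free_module R B)"
      using insert.prems(2) finite_subset[OF sub(1) insert.hyps(1)] by (auto simp: free_module_def v'_def)
    have b: "b \<in> B" "A \<subseteq> B" using insert.prems by auto
    have be: "v b \<odot>\<^bsub>free_module R B\<^esub> e b \<in> carrier (free_module R B)"
    proof -
      have "{c. v b \<otimes>\<^bsub>R\<^esub> e b c \<noteq> \<zero>\<^bsub>R\<^esub>} \<subseteq> {b}" using vR by (auto simp: e_def)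
      then show ?thesis using b vR by (auto simp: free_module_def e_def intro: finite_subset)
    qed
    have "v = (v b \<odot>\<^bsub>free_module R B\<^esub> e b) \<oplus>\<^bsub>free_module R B\<^esub> v'"
      using vR by (auto simp: free_module_def v'_def e_def)
    then have "r v = (v b \<odot>\<^bsub>P\<^esub> r (e b)) \<oplus>\<^bsub>P\<^esub> r v'"
      using linear_map_add[OF r be v'] linear_map_smult[OF r vR e[OF b(1)]] by simp
    also have "r v' = (\<Oplus>\<^bsub>P\<^esub>c\<in>A. v' c \<odot>\<^bsub>P\<^esub> r (e c))" by (rule insert.IH[OF b(2) v' sub(1)])
    also have "\<dots> = (\<Oplus>\<^bsub>P\<^esub>c\<in>A. v c \<odot>\<^bsub>P\<^esub> r (e c))"
      using insert.hyps vR b e linear_map_closed[OF r] by (intro P.M.finsum_cong') (auto simp: v'_def)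
    finally show ?case
      using insert.hyps b vR e linear_map_closed[OF r] by (subst P.M.finsum_insert) (auto simp: subset_iff)
  qed
  then show ?thesis by (simp only: e_def)
qed

text \<open>The section provides the coordinates, and the images of the standard basis vectors under
  the retraction are the elements of the dual basis.\<close>

lemma projective_module_dual_basis:
  fixes P :: "('r, 'm, 'y) module_scheme"
  assumes "projective_module R P"
  shows "\<exists>(B :: 'm set) s r. dual_basis R P B s r"
proof -
  obtain B :: "'m set" and s r where P: "left_module R P" and s: "linear_map R P (free_module R B) s"
    and r: "linear_map R (free_module R B) P r" and rs: "\<And>x. x \<in> carrier P \<Longrightarrow> r (s x) = x"
    using assms by (auto simp: projective_module_def)
  interpret P: left_module R P by fact
  define e where "e b = r (\<lambda>c. if c = b then \<one>\<^bsub>R\<^esub> else \<zero>\<^bsub>R\<^esub>)" for b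
  have e: "e b \<in> carrier P" if "b \<in> B" for b
  proof -
    have "{c. (if c = b then \<one>\<^bsub>R\<^esub> else \<zero>\<^bsub>R\<^esub>) \<noteq> \<zero>\<^bsub>R\<^esub>} \<subseteq> {b}" by auto
    then show ?thesis unfolding e_def using that
      by (intro linear_map_closed[OF r]) (auto simp: free_module_def intro: finite_subset)
  qed
  have "x = (\<Oplus>\<^bsub>P\<^esub>b\<in>{b. s x b \<noteq> \<zero>\<^bsub>R\<^esub>}. s x b \<odot>\<^bsub>P\<^esub> e b)" if x: "x \<in> carrier P" for x
  proof -
    have sx: "s x \<in> carrier (free_module R B)" by (rule linear_map_closed[OF s x])
    then have "finite {b. s x b \<noteq> \<zero>\<^bsub>R\<^esub>}" "{b. s x b \<noteq> \<zero>\<^bsub>R\<^esub>} \<subseteq> B" by (auto simp: free_module_def)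
    then show ?thesis using free_module_expansion[OF P r sx] rs[OF x] by (simp add: e_def)
  qed
  then have "dual_basis R P B s e" using e s by (auto simp: dual_basis_def)
  then show ?thesis by blast
qed

text \<open>The values of \<open>f\<close> at the dual basis elements are lifted one by one, and the
  coordinate functionals extend the choice linearly. Surjectivity of \<open>g\<close> is replaced by
  the inclusion \<open>fg\<close>, the form in which exactness of a resolution provides it.\<close>

lemma projective_module_lift:
  fixes P :: "('r, 'm, 'y) module_scheme"
  assumes P: "projective_module R P" and M: "left_module R M" and N: "left_module R N"
    and f: "linear_map R P N f" and g: "linear_map R M N g" and fg: "f ` carrier P \<subseteq> g ` carrier M"
  shows "\<exists>h. linear_map R P M h \<and> (\<forall>x\<in>carrier P. g (h x) = f x)"
proof -
  obtain B :: "'m set" and s r where db: "dual_basis R P B s r" using projective_module_dual_basis[OF P] by blast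
  note D = dual_basisD[OF db]
  have P': "left_module R P" using P by (simp add: projective_module_def)
  interpret P: left_module R P by (rule P')
  interpret M: left_module R M by (rule M)
  interpret N: left_module R N by (rule N)
  have "\<exists>m. \<forall>b\<in>B. m b \<in> carrier M \<and> g (m b) = f (r b)"
    using fg D(1) by (intro bchoice) (force simp: image_subset_iff)
  then obtain m where m: "\<And>b. b \<in> B \<Longrightarrow> m b \<in> carrier M" "\<And>b. b \<in> B \<Longrightarrow> g (m b) = f (r b)" by blast
  define h where "h x = (\<Oplus>\<^bsub>M\<^esub>b\<in>{b. s x b \<noteq> \<zero>\<^bsub>R\<^esub>}. s x b \<odot>\<^bsub>M\<^esub> m b)" for x
  have h: "h x = (\<Oplus>\<^bsub>M\<^esub>b\<in>A. s x b \<odot>\<^bsub>M\<^esub> m b)"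
    if "x \<in> carrier P" "finite A" "A \<subseteq> B" "{b. s x b \<noteq> \<zero>\<^bsub>R\<^esub>} \<subseteq> A" for x A
    unfolding h_def using that D(4) m(1) by (intro M.finsum_smult_superset) auto
  have "linear_map R P M h"
    unfolding linear_map_def
  proof (intro conjI ballI funcsetI)
    fix x assume x: "x \<in> carrier P"
    show "h x \<in> carrier M"
      unfolding h_def using D(2,3,4)[OF x] m(1) by (intro M.M.finsum_closed) auto
    fix y assume y: "y \<in> carrier P"
    have xy: "x \<oplus>\<^bsub>P\<^esub> y \<in> carrier P" using x y by simp
    \<comment> \<open>A common finite index set turns the three sums, originally over different
      supports, into sums that can be added termwise.\<close>
    obtain A where A: "finite A" "A \<subseteq> B" "{b. s x b \<noteq> \<zero>\<^bsub>R\<^esub>} \<subseteq> A" "{b. s y b \<noteq> \<zero>\<^bsub>R\<^esub>} \<subseteq> A"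
      "{b. s (x \<oplus>\<^bsub>P\<^esub> y) b \<noteq> \<zero>\<^bsub>R\<^esub>} \<subseteq> A"
      using D(2,3)[OF x] D(2,3)[OF y] D(2,3)[OF xy]
        that[of "{b. s x b \<noteq> \<zero>\<^bsub>R\<^esub>} \<union> {b. s y b \<noteq> \<zero>\<^bsub>R\<^esub>} \<union> {b. s (x \<oplus>\<^bsub>P\<^esub> y) b \<noteq> \<zero>\<^bsub>R\<^esub>}"] by blast
    have c: "s x b \<in> carrier R" "s y b \<in> carrier R" "m b \<in> carrier M" if "b \<in> A" for b
      using that A D(4) x y m(1) by blast+
    have "h (x \<oplus>\<^bsub>P\<^esub> y) = (\<Oplus>\<^bsub>M\<^esub>b\<in>A. s (x \<oplus>\<^bsub>P\<^esub> y) b \<odot>\<^bsub>M\<^esub> m b)" by (rule h[OF xy A(1,2,5)])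
    also have "\<dots> = (\<Oplus>\<^bsub>M\<^esub>b\<in>A. s x b \<odot>\<^bsub>M\<^esub> m b \<oplus>\<^bsub>M\<^esub> s y b \<odot>\<^bsub>M\<^esub> m b)"
      unfolding D(5)[OF x y] using c by (intro M.M.finsum_cong') (auto simp: M.smult_l_distr)
    also have "\<dots> = (\<Oplus>\<^bsub>M\<^esub>b\<in>A. s x b \<odot>\<^bsub>M\<^esub> m b) \<oplus>\<^bsub>M\<^esub> (\<Oplus>\<^bsub>M\<^esub>b\<in>A. s y b \<odot>\<^bsub>M\<^esub> m b)"
      using c by (intro M.M.finsum_addf) auto
    also have "(\<Oplus>\<^bsub>M\<^esub>b\<in>A. s x b \<odot>\<^bsub>M\<^esub> m b) = h x" by (rule h[OF x A(1,2,3), symmetric])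
    also have "(\<Oplus>\<^bsub>M\<^esub>b\<in>A. s y b \<odot>\<^bsub>M\<^esub> m b) = h y" by (rule h[OF y A(1,2,4), symmetric])
    finally show "h (x \<oplus>\<^bsub>P\<^esub> y) = h x \<oplus>\<^bsub>M\<^esub> h y" .
  next
    fix a x assume a: "a \<in> carrier R" and x: "x \<in> carrier P"
    have ax: "a \<odot>\<^bsub>P\<^esub> x \<in> carrier P" using a x by simp
    obtain A where A: "finite A" "A \<subseteq> B" "{b. s x b \<noteq> \<zero>\<^bsub>R\<^esub>} \<subseteq> A" "{b. s (a \<odot>\<^bsub>P\<^esub> x) b \<noteq> \<zero>\<^bsub>R\<^esub>} \<subseteq> A"
      using D(2,3)[OF x] D(2,3)[OF ax]
        that[of "{b. s x b \<noteq> \<zero>\<^bsub>R\<^esub>} \<union> {b. s (a \<odot>\<^bsub>P\<^esub> x) b \<noteq> \<zero>\<^bsub>R\<^esub>}"] by blast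
    have c: "s x b \<in> carrier R" "m b \<in> carrier M" if "b \<in> A" for b
      using that A D(4) x m(1) by blast+
    have "h (a \<odot>\<^bsub>P\<^esub> x) = (\<Oplus>\<^bsub>M\<^esub>b\<in>A. s (a \<odot>\<^bsub>P\<^esub> x) b \<odot>\<^bsub>M\<^esub> m b)" by (rule h[OF ax A(1,2,4)])
    also have "\<dots> = (\<Oplus>\<^bsub>M\<^esub>b\<in>A. a \<odot>\<^bsub>M\<^esub> (s x b \<odot>\<^bsub>M\<^esub> m b))"
      unfolding D(6)[OF a x] using c a by (intro M.M.finsum_cong') (auto simp: M.smult_assoc)
    also have "\<dots> = a \<odot>\<^bsub>M\<^esub> (\<Oplus>\<^bsub>M\<^esub>b\<in>A. s x b \<odot>\<^bsub>M\<^esub> m b)"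
      using c a A by (intro M.smult_finsum[symmetric]) auto
    also have "(\<Oplus>\<^bsub>M\<^esub>b\<in>A. s x b \<odot>\<^bsub>M\<^esub> m b) = h x" by (rule h[OF x A(1,2,3), symmetric])
    finally show "h (a \<odot>\<^bsub>P\<^esub> x) = a \<odot>\<^bsub>M\<^esub> h x" .
  qed
  moreover have "g (h x) = f x" if x: "x \<in> carrier P" for x
  proof -
    let ?A = "{b. s x b \<noteq> \<zero>\<^bsub>R\<^esub>}"
    have c: "b \<in> B" "s x b \<in> carrier R" "m b \<in> carrier M" "r b \<in> carrier P" if "b \<in> ?A" for b
      using that D(1,3,4) x m(1) by blast+
    have "g (h x) = (\<Oplus>\<^bsub>N\<^esub>b\<in>?A. g (s x b \<odot>\<^bsub>M\<^esub> m b))"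
      unfolding h_def by (rule linear_map_finsum[OF g M N D(2)[OF x]]) (use c in auto)
    also have "\<dots> = (\<Oplus>\<^bsub>N\<^esub>b\<in>?A. f (s x b \<odot>\<^bsub>P\<^esub> r b))"
      using c linear_map_smult[OF g] linear_map_smult[OF f] linear_map_closed[OF f] m(2)
      by (intro N.M.finsum_cong') auto
    also have "\<dots> = f (\<Oplus>\<^bsub>P\<^esub>b\<in>?A. s x b \<odot>\<^bsub>P\<^esub> r b)"
      by (rule linear_map_finsum[OF f P' N D(2)[OF x], symmetric]) (use c in auto)
    finally show ?thesis using D(7)[OF x] by simp
  qed
  ultimately show ?thesis by blast
qed

section \<open>Central group elements and the homotopy\<close>

definition group_element :: "'g \<Rightarrow> 'g \<Rightarrow> int" where
  "group_element w = (\<lambda>g. if g = w then 1 else 0)"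

context group begin

lemma group_element_closed [simp, intro]:
  "w \<in> carrier G \<Longrightarrow> group_element w \<in> carrier (int_group_ring G)"
  by (auto simp: int_group_ring_def group_element_def)

lemma group_convolution_group_element:
  assumes "w \<in> carrier G"
  shows "group_convolution G (group_element w) f g = (if g \<in> carrier G then f (inv w \<otimes> g) else 0)"
  using group_convolution_superset[of "{w}" "group_element w" g f] assms
  by (cases "g \<in> carrier G") (auto simp: group_element_def group_convolution_def)

lemma group_convolution_group_element_complex:
  assumes "w \<in> carrier G"
  shows "group_convolution G (group_element w) f = translate G w f"
  using group_convolution_group_element[OF assms] by (auto simp: translate_def)

text \<open>Convolution by \<open>group_element w\<close> shifts the argument by
  \<open>inv w\<close>, and this shift commutes with those by \<open>inv x\<close> because
  \<open>inv w\<close> is central too.\<close>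

lemma group_convolution_central:
  assumes w: "w \<in> carrier G" "\<And>y. y \<in> carrier G \<Longrightarrow> w \<otimes> y = y \<otimes> w" and a: "a \<in> carrier (int_group_ring G)"
  shows "group_convolution G (group_element w) (group_convolution G a f)
    = group_convolution G a (group_convolution G (group_element w) f)"
proof
  fix g
  have c: "inv w \<otimes> y = y \<otimes> inv w" if "y \<in> carrier G" for y
    using w(2)[OF that] w(1) that by (metis inv_closed inv_solve_left inv_solve_right m_assoc m_closed)
  have "of_int (a x) * f (inv x \<otimes> (inv w \<otimes> g)) = of_int (a x) * f (inv w \<otimes> (inv x \<otimes> g))"
    if "x \<in> carrier G" "g \<in> carrier G" for x
    using c[of "inv x"] that w(1) by (simp flip: m_assoc)
  then show "group_convolution G (group_element w) (group_convolution G a f) g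
    = group_convolution G a (group_convolution G (group_element w) f) g"
    using w(1) by (auto simp: group_convolution_group_element group_convolution_def[of G a] intro!: sum.cong)
qed

text \<open>Commutation of the two convolutions, evaluated on the unit of the ring.\<close>

lemma group_element_commute:
  assumes w: "w \<in> carrier G" "\<And>y. y \<in> carrier G \<Longrightarrow> w \<otimes> y = y \<otimes> w" and a: "a \<in> carrier (int_group_ring G)"
  shows "group_element w \<otimes>\<^bsub>int_group_ring G\<^esub> a = a \<otimes>\<^bsub>int_group_ring G\<^esub> group_element w"
  using group_convolution_central[OF w a, of "group_element \<one>"]
    group_convolution_one_right[OF a] group_convolution_one_right[OF group_element_closed[OF w(1)]]
  by (simp add: int_group_ring_def group_element_def)

text \<open>Over a noncommutative ring, multiplication by an element is linear when the element is
  central. The resulting map is the chain map to be contracted.\<close>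

lemma linear_map_one_minus_central:
  assumes M: "left_module (int_group_ring G) M" and w: "w \<in> carrier G" "\<And>y. y \<in> carrier G \<Longrightarrow> w \<otimes> y = y \<otimes> w"
  shows "linear_map (int_group_ring G) M M (\<lambda>x. x \<ominus>\<^bsub>M\<^esub> (group_element w \<odot>\<^bsub>M\<^esub> x))"
proof -
  interpret M: left_module "int_group_ring G" M by (rule M)
  have e: "group_element w \<in> carrier (int_group_ring G)" using w by simp
  show ?thesis
    unfolding linear_map_def
  proof (intro conjI ballI funcsetI)
    fix x assume x: "x \<in> carrier M"
    then show "x \<ominus>\<^bsub>M\<^esub> (group_element w \<odot>\<^bsub>M\<^esub> x) \<in> carrier M" using e by simp
    fix y assume y: "y \<in> carrier M"
    show "(x \<oplus>\<^bsub>M\<^esub> y) \<ominus>\<^bsub>M\<^esub> (group_element w \<odot>\<^bsub>M\<^esub> (x \<oplus>\<^bsub>M\<^esub> y))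
      = (x \<ominus>\<^bsub>M\<^esub> (group_element w \<odot>\<^bsub>M\<^esub> x)) \<oplus>\<^bsub>M\<^esub> (y \<ominus>\<^bsub>M\<^esub> (group_element w \<odot>\<^bsub>M\<^esub> y))"
      using x y e by (simp add: M.smult_r_distr a_minus_def M.M.minus_add M.M.a_ac)
  next
    fix a x assume a: "a \<in> carrier (int_group_ring G)" and x: "x \<in> carrier M"
    have "group_element w \<odot>\<^bsub>M\<^esub> (a \<odot>\<^bsub>M\<^esub> x) = a \<odot>\<^bsub>M\<^esub> (group_element w \<odot>\<^bsub>M\<^esub> x)"
      using M.smult_assoc[OF e a x] M.smult_assoc[OF a e x] group_element_commute[OF w a] by simp
    then show "(a \<odot>\<^bsub>M\<^esub> x) \<ominus>\<^bsub>M\<^esub> (group_element w \<odot>\<^bsub>M\<^esub> (a \<odot>\<^bsub>M\<^esub> x)) = a \<odot>\<^bsub>M\<^esub> (x \<ominus>\<^bsub>M\<^esub> (group_element w \<odot>\<^bsub>M\<^esub> x))"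
      using a x e by (simp add: M.smult_r_distr M.smult_r_minus a_minus_def)
  qed
qed

text \<open>The augmentation of a group element is 1, so \<open>1 - w\<close> induces zero on the
  trivial module, and a chain map of a projective resolution that lifts zero is
  null-homotopic.\<close>

lemma central_action_homotopic_to_identity:
  assumes res: "projective_resolution G F d \<epsilon>"
    and w: "w \<in> carrier G" "\<And>y. y \<in> carrier G \<Longrightarrow> w \<otimes> y = y \<otimes> w"
  shows "\<exists>h. (\<forall>i. linear_map (int_group_ring G) (F i) (F (Suc i)) (h i)) \<and>
    (\<forall>x\<in>carrier (F 0). d (Suc 0) (h 0 x) = x \<ominus>\<^bsub>F 0\<^esub> (group_element w \<odot>\<^bsub>F 0\<^esub> x)) \<and>
    (\<forall>i. \<forall>x\<in>carrier (F (Suc i)). d (Suc (Suc i)) (h (Suc i) x) \<oplus>\<^bsub>F (Suc i)\<^esub> h i (d (Suc i) x)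
       = x \<ominus>\<^bsub>F (Suc i)\<^esub> (group_element w \<odot>\<^bsub>F (Suc i)\<^esub> x))"
proof -
  let ?R = "int_group_ring G"
  define D where "D i x = x \<ominus>\<^bsub>F i\<^esub> (group_element w \<odot>\<^bsub>F i\<^esub> x)" for i x
  have proj: "projective_module ?R (F i)" and d: "linear_map ?R (F (Suc i)) (F i) (d (Suc i))"
    and im: "d (Suc (Suc i)) ` carrier (F (Suc (Suc i))) = {x \<in> carrier (F (Suc i)). d (Suc i) x = \<zero>\<^bsub>F i\<^esub>}" for i
    using res by (auto simp: projective_resolution_def)
  have \<epsilon>: "linear_map ?R (F 0) (trivial_int_module G) \<epsilon>"
    and im0: "d (Suc 0) ` carrier (F (Suc 0)) = {x \<in> carrier (F 0). \<epsilon> x = 0}"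
    using res by (auto simp: projective_resolution_def)
  have FM: "left_module ?R (F i)" for i using proj by (simp add: projective_module_def)
  have D: "linear_map ?R (F i) (F i) (D i)" for i
    unfolding D_def by (rule linear_map_one_minus_central[OF FM w])
  have e: "group_element w \<in> carrier ?R" using w by simp
  have dD: "d (Suc i) (D (Suc i) x) = D i (d (Suc i) x)" if x: "x \<in> carrier (F (Suc i))" for i x
  proof -
    interpret M: left_module ?R "F (Suc i)" by (rule FM)
    have "d (Suc i) (D (Suc i) x) = d (Suc i) x \<oplus>\<^bsub>F i\<^esub> d (Suc i) (\<ominus>\<^bsub>F (Suc i)\<^esub> (group_element w \<odot>\<^bsub>F (Suc i)\<^esub> x))"
      unfolding D_def a_minus_def using x e by (intro linear_map_add[OF d]) auto
    then show ?thesis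
      using x e linear_map_minus[OF d FM FM, of "group_element w \<odot>\<^bsub>F (Suc i)\<^esub> x"] linear_map_smult[OF d e x]
      by (simp add: D_def a_minus_def)
  qed
  \<comment> \<open>What \<open>h\<close> at level \<open>i\<close> must satisfy for the next level
    to exist: \<open>d h d = D d\<close>, which makes \<open>D - h d\<close> one level up a map into
    cycles. The last clause keeps the identity at level 0, since \<open>Q\<close> only relates
    consecutive levels.\<close>
  define P where "P i h \<longleftrightarrow> linear_map ?R (F i) (F (Suc i)) h \<and>
    (\<forall>x\<in>carrier (F (Suc i)). d (Suc i) (h (d (Suc i) x)) = D i (d (Suc i) x)) \<and>
    (i = 0 \<longrightarrow> (\<forall>x\<in>carrier (F 0). d (Suc 0) (h x) = D 0 x))" for i h
  define Q where "Q i h h' \<longleftrightarrow>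
    (\<forall>x\<in>carrier (F (Suc i)). d (Suc (Suc i)) (h' x) \<oplus>\<^bsub>F (Suc i)\<^esub> h (d (Suc i) x) = D (Suc i) x)" for i h h'
  have "\<exists>h. P 0 h"
  proof -
    interpret F0: left_module ?R "F 0" by (rule FM)
    interpret Z: left_module ?R "trivial_int_module G" by (rule left_module_trivial)
    have "\<epsilon> (D 0 x) = 0" if x: "x \<in> carrier (F 0)" for x
    proof -
      have "\<epsilon> (D 0 x) = \<epsilon> x \<oplus>\<^bsub>trivial_int_module G\<^esub> \<epsilon> (\<ominus>\<^bsub>F 0\<^esub> (group_element w \<odot>\<^bsub>F 0\<^esub> x))"
        unfolding D_def a_minus_def using x e by (intro linear_map_add[OF \<epsilon>]) auto
      also have "\<epsilon> (\<ominus>\<^bsub>F 0\<^esub> (group_element w \<odot>\<^bsub>F 0\<^esub> x)) = \<ominus>\<^bsub>trivial_int_module G\<^esub> \<epsilon> (group_element w \<odot>\<^bsub>F 0\<^esub> x)"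
        using x e by (intro linear_map_minus[OF \<epsilon> FM left_module_trivial]) auto
      also have "\<epsilon> (group_element w \<odot>\<^bsub>F 0\<^esub> x) = group_element w \<odot>\<^bsub>trivial_int_module G\<^esub> \<epsilon> x"
        by (rule linear_map_smult[OF \<epsilon> e x])
      also have "\<dots> = \<epsilon> x"
      proof -
        have "{g. g \<in> carrier G \<and> group_element w g \<noteq> 0} = {w}" using w by (auto simp: group_element_def)
        then show ?thesis by (simp add: trivial_int_module_def group_element_def)
      qed
      finally have "\<epsilon> (D 0 x) = \<zero>\<^bsub>trivial_int_module G\<^esub>"
        using linear_map_closed[OF \<epsilon> x] by (simp add: Z.M.r_neg)
      then show ?thesis by (simp add: trivial_int_module_def)
    qed
    then have "D 0 ` carrier (F 0) \<subseteq> d (Suc 0) ` carrier (F (Suc 0))"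
      unfolding im0 using linear_map_closed[OF D] by blast
    then obtain h where "linear_map ?R (F 0) (F (Suc 0)) h" "\<forall>x\<in>carrier (F 0). d (Suc 0) (h x) = D 0 x"
      using projective_module_lift[OF proj FM FM D d] by blast
    then show ?thesis unfolding P_def using linear_map_closed[OF d] by blast
  qed
  moreover have "\<exists>h'. P (Suc i) h' \<and> Q i h h'" if "P i h" for i h
  proof -
    interpret M: left_module ?R "F (Suc i)" by (rule FM)
    interpret N: left_module ?R "F i" by (rule FM)
    have h: "linear_map ?R (F i) (F (Suc i)) h"
      "\<And>x. x \<in> carrier (F (Suc i)) \<Longrightarrow> d (Suc i) (h (d (Suc i) x)) = D i (d (Suc i) x)"
      using that by (auto simp: P_def)
    define f where "f x = D (Suc i) x \<ominus>\<^bsub>F (Suc i)\<^esub> h (d (Suc i) x)" for x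
    have hd: "h (d (Suc i) x) \<in> carrier (F (Suc i))" if "x \<in> carrier (F (Suc i))" for x
      by (intro linear_map_closed[OF h(1)] linear_map_closed[OF d] that)
    have Dc: "D (Suc i) x \<in> carrier (F (Suc i))" if "x \<in> carrier (F (Suc i))" for x
      by (rule linear_map_closed[OF D that])
    have f: "linear_map ?R (F (Suc i)) (F (Suc i)) f"
      unfolding linear_map_def
    proof (intro conjI ballI funcsetI)
      fix x assume x: "x \<in> carrier (F (Suc i))"
      then show "f x \<in> carrier (F (Suc i))" using hd Dc by (simp add: f_def)
      fix y assume y: "y \<in> carrier (F (Suc i))"
      show "f (x \<oplus>\<^bsub>F (Suc i)\<^esub> y) = f x \<oplus>\<^bsub>F (Suc i)\<^esub> f y"
        using x y hd[OF x] hd[OF y] Dc[OF x] Dc[OF y] linear_map_add[OF D x y] linear_map_add[OF d x y]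
          linear_map_add[OF h(1) linear_map_closed[OF d x] linear_map_closed[OF d y]]
        by (simp add: f_def a_minus_def M.M.minus_add M.M.a_ac)
    next
      fix a x assume a: "a \<in> carrier ?R" and x: "x \<in> carrier (F (Suc i))"
      show "f (a \<odot>\<^bsub>F (Suc i)\<^esub> x) = a \<odot>\<^bsub>F (Suc i)\<^esub> f x"
        using a x hd[OF x] Dc[OF x] linear_map_smult[OF D a x] linear_map_smult[OF d a x]
          linear_map_smult[OF h(1) a linear_map_closed[OF d x]]
        by (simp add: f_def a_minus_def M.smult_r_distr M.smult_r_minus)
    qed
    have "d (Suc i) (f x) = \<zero>\<^bsub>F i\<^esub>" if x: "x \<in> carrier (F (Suc i))" for x
    proof -
      have "d (Suc i) (f x) = d (Suc i) (D (Suc i) x) \<oplus>\<^bsub>F i\<^esub> d (Suc i) (\<ominus>\<^bsub>F (Suc i)\<^esub> h (d (Suc i) x))"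
        unfolding f_def a_minus_def using hd[OF x] Dc[OF x] by (intro linear_map_add[OF d]) auto
      also have "\<dots> = d (Suc i) (D (Suc i) x) \<ominus>\<^bsub>F i\<^esub> D i (d (Suc i) x)"
        using linear_map_minus[OF d FM FM hd[OF x]] h(2)[OF x] by (simp add: a_minus_def)
      finally show ?thesis
        unfolding dD[OF x] using linear_map_closed[OF D linear_map_closed[OF d x]] by (simp add: a_minus_def N.M.r_neg)
    qed
    then have "f ` carrier (F (Suc i)) \<subseteq> d (Suc (Suc i)) ` carrier (F (Suc (Suc i)))"
      unfolding im using linear_map_closed[OF f] by blast
    then obtain h' where h': "linear_map ?R (F (Suc i)) (F (Suc (Suc i))) h'"
      "\<And>x. x \<in> carrier (F (Suc i)) \<Longrightarrow> d (Suc (Suc i)) (h' x) = f x"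
      using projective_module_lift[OF proj FM FM f d] by blast
    have "Q i h h'"
      unfolding Q_def using h'(2) hd Dc by (simp add: f_def a_minus_def M.M.a_assoc M.M.l_neg)
    \<comment> \<open>On boundaries the correction term \<open>h d\<close> vanishes since
      \<open>d d = 0\<close>, so \<open>d h'\<close> agrees with \<open>D\<close> there and the
      invariant passes to \<open>h'\<close>.\<close>
    moreover have "d (Suc (Suc i)) (h' (d (Suc (Suc i)) x)) = D (Suc i) (d (Suc (Suc i)) x)"
      if x: "x \<in> carrier (F (Suc (Suc i)))" for x
    proof -
      have y: "d (Suc (Suc i)) x \<in> carrier (F (Suc i))" "d (Suc i) (d (Suc (Suc i)) x) = \<zero>\<^bsub>F i\<^esub>"
        using im[of i] x by blast+
      have "h \<zero>\<^bsub>F i\<^esub> = \<zero>\<^bsub>F (Suc i)\<^esub>"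
        by (rule linear_map_zero[OF h(1) M.M.abelian_group_axioms]) auto
      then show ?thesis using h'(2)[OF y(1)] y Dc[OF y(1)] by (simp add: f_def a_minus_def)
    qed
    ultimately show ?thesis using h'(1) by (auto simp: P_def)
  qed
  ultimately obtain h where "\<And>i. P i (h i) \<and> Q i (h i) (h (Suc i))"
    using dependent_nat_choice[of P Q] by blast
  then show ?thesis unfolding P_def Q_def D_def by blast
qed

end

section \<open>Tensor products\<close>

declare carrier_free_Abelian_group_iff [simp del]

text \<open>A right module stored by \<open>to_right_module\<close> obeys associativity in the
  opposite order and is in general no \<open>left_module\<close>. The locale therefore asks of the
  scalars only that the defining relations stay inside the free group.\<close>

locale tensor_pair = M: abelian_group M + N: abelian_group N
  for R :: "('r, 'x) ring_scheme" and M :: "('r, 'm, 'y) module_scheme" and N :: "('r, 'n, 'z) module_scheme" +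
  assumes smult_left: "\<And>a x. a \<in> carrier R \<Longrightarrow> x \<in> carrier M \<Longrightarrow> a \<odot>\<^bsub>M\<^esub> x \<in> carrier M"
    and smult_right: "\<And>a y. a \<in> carrier R \<Longrightarrow> y \<in> carrier N \<Longrightarrow> a \<odot>\<^bsub>N\<^esub> y \<in> carrier N"
begin

abbreviation "FA \<equiv> free_Abelian_group (carrier M \<times> carrier N)"
abbreviation "T \<equiv> tensor_product R M N"
abbreviation "K \<equiv> tensor_kernel R M N"
abbreviation "tc \<equiv> tensor_class R M N"

lemma FA_iff: "u \<in> carrier FA \<longleftrightarrow> Poly_Mapping.keys u \<subseteq> carrier M \<times> carrier N"
  by (simp add: free_Abelian_group_def)

lemma FA_frag_of [simp, intro]: "x \<in> carrier M \<Longrightarrow> y \<in> carrier N \<Longrightarrow> frag_of (x, y) \<in> carrier FA"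
  by (simp add: FA_iff)

lemma FA_zero [simp]: "0 \<in> carrier FA"
  by (simp add: FA_iff)

lemma FA_add [simp, intro]: "u \<in> carrier FA \<Longrightarrow> v \<in> carrier FA \<Longrightarrow> u + v \<in> carrier FA"
  using keys_add[of u v] by (auto simp: FA_iff)

lemma FA_diff [simp, intro]: "u \<in> carrier FA \<Longrightarrow> v \<in> carrier FA \<Longrightarrow> u - v \<in> carrier FA"
  using keys_diff[of u v] by (auto simp: FA_iff)

lemma FA_sum [intro]: "(\<And>i. i \<in> I \<Longrightarrow> u i \<in> carrier FA) \<Longrightarrow> (\<Sum>i\<in>I. u i) \<in> carrier FA"
  by (induction I rule: infinite_finite_induct) auto

lemma comm_group_FA: "comm_group FA"
  by (rule abelian_free_Abelian_group)

lemma tensor_relations_subset: "tensor_relations R M N \<subseteq> carrier FA"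
  by (auto simp: tensor_relations_def smult_left smult_right intro!: FA_diff)

lemma subgroup_tensor_kernel: "subgroup K FA"
  unfolding tensor_kernel_def
  by (rule group.generate_is_subgroup[OF group_free_Abelian_group tensor_relations_subset])

lemma normal_tensor_kernel: "K \<lhd> FA"
  by (rule comm_group.subgroup_imp_normal[OF comm_group_FA subgroup_tensor_kernel])

lemma tensor_kernel_subset: "K \<subseteq> carrier FA"
  by (rule subgroup.subset[OF subgroup_tensor_kernel])

lemma tensor_kernel_zero: "0 \<in> K"
  using subgroup.one_closed[OF subgroup_tensor_kernel] by simp

lemma tensor_kernel_add: "u \<in> K \<Longrightarrow> v \<in> K \<Longrightarrow> u + v \<in> K"
  using subgroup.m_closed[OF subgroup_tensor_kernel] by simp

lemma tensor_kernel_minus: "u \<in> K \<Longrightarrow> - u \<in> K"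
  using subgroup.m_inv_closed[OF subgroup_tensor_kernel] tensor_kernel_subset
  by (fastforce simp: FA_iff)

lemma tensor_kernel_induct [consumes 1, case_names zero relation add minus]:
  assumes u: "u \<in> K" and 0: "P 0" and rel: "\<And>r. r \<in> tensor_relations R M N \<Longrightarrow> P r"
    and add: "\<And>u v. P u \<Longrightarrow> P v \<Longrightarrow> P (u + v)" and minus: "\<And>u. P u \<Longrightarrow> P (- u)"
  shows "P u"
  using u unfolding tensor_kernel_def
proof (induction rule: generate.induct)
  case (inv r)
  then have "inv\<^bsub>FA\<^esub> r = - r" using tensor_relations_subset by (fastforce simp: FA_iff)
  then show ?case using minus rel inv by simp
qed (use 0 rel add in auto)

lemma tensor_class_eq: "tc u = (\<lambda>k. k + u) ` K"
  by (auto simp: tensor_class_def r_coset_def)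

text \<open>Stated for arbitrary formal sums, since a coset is a translate of \<open>K\<close> in
  the group of all of them.\<close>

lemma tensor_class_eq_iff: "tc u = tc v \<longleftrightarrow> u - v \<in> K"
proof
  assume "tc u = tc v"
  moreover have "u \<in> tc u" unfolding tensor_class_eq using tensor_kernel_zero by force
  ultimately show "u - v \<in> K" unfolding tensor_class_eq by auto
next
  assume k: "u - v \<in> K"
  have "k + u \<in> tc v" if "k \<in> K" for k
    unfolding tensor_class_eq using tensor_kernel_add[OF that k] by (intro image_eqI[of _ _ "k + (u - v)"]) auto
  moreover have "k + v \<in> tc u" if "k \<in> K" for k
    unfolding tensor_class_eq using tensor_kernel_add[OF that tensor_kernel_minus[OF k]]
    by (intro image_eqI[of _ _ "k + - (u - v)"]) auto
  ultimately show "tc u = tc v" unfolding tensor_class_eq by blast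
qed

lemma tensor_class_add_cong: "tc u = tc u' \<Longrightarrow> tc v = tc v' \<Longrightarrow> tc (u + v) = tc (u' + v')"
  unfolding tensor_class_eq_iff using tensor_kernel_add[of "u - u'" "v - v'"] by (simp add: algebra_simps)

lemma tensor_class_minus_cong: "tc u = tc u' \<Longrightarrow> tc (- u) = tc (- u')"
  unfolding tensor_class_eq_iff using tensor_kernel_minus[of "u - u'"] by simp

lemma tensor_class_sum_cong:
  assumes "\<And>i. i \<in> I \<Longrightarrow> tc (u i) = tc (v i)"
  shows "tc (\<Sum>i\<in>I. u i) = tc (\<Sum>i\<in>I. v i)"
  using assms
proof (induction I rule: infinite_finite_induct)
  case (insert i I)
  have "tc (u i + sum u I) = tc (v i + sum v I)"
    by (intro tensor_class_add_cong insert.IH insert.prems) auto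
  then show ?case using insert.hyps by simp
qed simp_all

lemma carrier_tensor_product: "carrier T = tc ` carrier FA"
  by (auto simp: tensor_product_def FactGroup_def RCOSETS_def tensor_class_def)

lemma tensor_class_closed [simp, intro]: "u \<in> carrier FA \<Longrightarrow> tc u \<in> carrier T"
  by (simp add: carrier_tensor_product)

lemma comm_group_tensor_product: "comm_group T"
  unfolding tensor_product_def by (rule comm_group.abelian_FactGroup[OF comm_group_FA subgroup_tensor_kernel])

lemma tensor_product_mult:
  "u \<in> carrier FA \<Longrightarrow> v \<in> carrier FA \<Longrightarrow> tc u \<otimes>\<^bsub>T\<^esub> tc v = tc (u + v)"
  using normal.rcos_sum[OF normal_tensor_kernel, of u v]
  by (simp add: tensor_product_def FactGroup_def tensor_class_def)

lemma tensor_product_one: "\<one>\<^bsub>T\<^esub> = tc 0"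
  by (simp add: tensor_product_def FactGroup_def tensor_class_eq)

lemma tensor_class_eq_one_iff: "tc u = \<one>\<^bsub>T\<^esub> \<longleftrightarrow> u \<in> K"
  by (simp add: tensor_product_one tensor_class_eq_iff)

lemma finprod_tensor_class:
  assumes "finite I" "\<And>i. i \<in> I \<Longrightarrow> u i \<in> carrier FA"
  shows "(\<Otimes>\<^bsub>T\<^esub>i\<in>I. tc (u i)) = tc (\<Sum>i\<in>I. u i)"
proof -
  interpret T: comm_group T by (rule comm_group_tensor_product)
  show ?thesis using assms
    by (induction I rule: finite_induct) (auto simp: tensor_product_one tensor_product_mult FA_sum)
qed

lemma tensor_class_add_left:
  assumes "x \<in> carrier M" "x' \<in> carrier M" "y \<in> carrier N"
  shows "tc (frag_of (x \<oplus>\<^bsub>M\<^esub> x', y)) = tc (frag_of (x, y) + frag_of (x', y))"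
  unfolding tensor_class_eq_iff tensor_kernel_def diff_diff_eq[symmetric]
  by (rule generate.incl) (use assms in \<open>unfold tensor_relations_def, blast\<close>)

lemma tensor_class_add_right:
  assumes "x \<in> carrier M" "y \<in> carrier N" "y' \<in> carrier N"
  shows "tc (frag_of (x, y \<oplus>\<^bsub>N\<^esub> y')) = tc (frag_of (x, y) + frag_of (x, y'))"
  unfolding tensor_class_eq_iff tensor_kernel_def diff_diff_eq[symmetric]
  by (rule generate.incl) (use assms in \<open>unfold tensor_relations_def, blast\<close>)

lemma tensor_class_smult:
  assumes "a \<in> carrier R" "x \<in> carrier M" "y \<in> carrier N"
  shows "tc (frag_of (a \<odot>\<^bsub>M\<^esub> x, y)) = tc (frag_of (x, a \<odot>\<^bsub>N\<^esub> y))"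
  unfolding tensor_class_eq_iff tensor_kernel_def
  by (rule generate.incl) (use assms in \<open>unfold tensor_relations_def, blast\<close>)

lemma tensor_class_zero_left:
  assumes "y \<in> carrier N"
  shows "tc (frag_of (\<zero>\<^bsub>M\<^esub>, y)) = tc 0"
proof -
  have "- frag_of (\<zero>\<^bsub>M\<^esub>, y) \<in> K"
    using tensor_class_add_left[of "\<zero>\<^bsub>M\<^esub>" "\<zero>\<^bsub>M\<^esub>" y] assms by (simp add: tensor_class_eq_iff)
  from tensor_kernel_minus[OF this] show ?thesis by (simp add: tensor_class_eq_iff)
qed

lemma tensor_class_zero_right:
  assumes "x \<in> carrier M"
  shows "tc (frag_of (x, \<zero>\<^bsub>N\<^esub>)) = tc 0"
proof -
  have "- frag_of (x, \<zero>\<^bsub>N\<^esub>) \<in> K"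
    using tensor_class_add_right[of x "\<zero>\<^bsub>N\<^esub>" "\<zero>\<^bsub>N\<^esub>"] assms by (simp add: tensor_class_eq_iff)
  from tensor_kernel_minus[OF this] show ?thesis by (simp add: tensor_class_eq_iff)
qed

lemma tensor_class_minus_left:
  assumes "x \<in> carrier M" "y \<in> carrier N"
  shows "tc (frag_of (\<ominus>\<^bsub>M\<^esub> x, y)) = tc (- frag_of (x, y))"
proof -
  have "tc (frag_of (\<ominus>\<^bsub>M\<^esub> x, y) + frag_of (x, y)) = tc 0"
    using tensor_class_add_left[of "\<ominus>\<^bsub>M\<^esub> x" x y] tensor_class_zero_left assms by (simp add: M.l_neg)
  then show ?thesis by (simp add: tensor_class_eq_iff)
qed

lemma tensor_class_minus_right:
  assumes "x \<in> carrier M" "y \<in> carrier N"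
  shows "tc (frag_of (x, \<ominus>\<^bsub>N\<^esub> y)) = tc (- frag_of (x, y))"
proof -
  have "tc (frag_of (x, \<ominus>\<^bsub>N\<^esub> y) + frag_of (x, y)) = tc 0"
    using tensor_class_add_right[of x "\<ominus>\<^bsub>N\<^esub> y" y] tensor_class_zero_right assms by (simp add: N.l_neg)
  then show ?thesis by (simp add: tensor_class_eq_iff)
qed

lemma tensor_class_finsum_left:
  assumes "finite A" "m \<in> A \<rightarrow> carrier M" "y \<in> carrier N"
  shows "tc (frag_of (\<Oplus>\<^bsub>M\<^esub>b\<in>A. m b, y)) = tc (\<Sum>b\<in>A. frag_of (m b, y))"
  using assms
proof (induction A rule: finite_induct)
  case empty
  then show ?case by (simp add: tensor_class_zero_left)
next
  case (insert b A)
  then have "tc (frag_of (m b \<oplus>\<^bsub>M\<^esub> (\<Oplus>\<^bsub>M\<^esub>b\<in>A. m b), y)) = tc (frag_of (m b, y) + frag_of (\<Oplus>\<^bsub>M\<^esub>b\<in>A. m b, y))"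
    by (intro tensor_class_add_left) (auto intro: M.finsum_closed)
  also have "\<dots> = tc (frag_of (m b, y) + (\<Sum>b\<in>A. frag_of (m b, y)))"
    using insert by (intro tensor_class_add_cong) auto
  finally show ?case using insert by (simp add: Pi_iff)
qed

lemma tensor_class_finsum_right:
  assumes "finite A" "m \<in> A \<rightarrow> carrier N" "x \<in> carrier M"
  shows "tc (frag_of (x, \<Oplus>\<^bsub>N\<^esub>b\<in>A. m b)) = tc (\<Sum>b\<in>A. frag_of (x, m b))"
  using assms
proof (induction A rule: finite_induct)
  case empty
  then show ?case by (simp add: tensor_class_zero_right)
next
  case (insert b A)
  then have "tc (frag_of (x, m b \<oplus>\<^bsub>N\<^esub> (\<Oplus>\<^bsub>N\<^esub>b\<in>A. m b))) = tc (frag_of (x, m b) + frag_of (x, \<Oplus>\<^bsub>N\<^esub>b\<in>A. m b))"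
    by (intro tensor_class_add_right) (auto intro: N.finsum_closed)
  also have "\<dots> = tc (frag_of (x, m b) + (\<Sum>b\<in>A. frag_of (x, m b)))"
    using insert by (intro tensor_class_add_cong) auto
  finally show ?case using insert by (simp add: Pi_iff)
qed

text \<open>Integer coefficients are removed: multiplicities become repetitions in the list, and a
  sign is moved into the first factor. This produces the sums over tuples on which the topology of
  chains is defined.\<close>

lemma tensor_product_elementary_sum:
  assumes "c \<in> carrier T"
  shows "\<exists>ps. set ps \<subseteq> carrier M \<times> carrier N \<and> c = tc (\<Sum>q\<leftarrow>ps. frag_of q)"
proof -
  obtain u where u: "u \<in> carrier FA" "c = tc u" using assms by (auto simp: carrier_tensor_product)
  have "\<exists>ps. set ps \<subseteq> carrier M \<times> carrier N \<and> tc u = tc (\<Sum>q\<leftarrow>ps. frag_of q)"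
    using u(1)[unfolded FA_iff]
  proof (induction u rule: frag_induction)
    case zero
    show ?case by (rule exI[of _ "[]"]) simp
  next
    case (one q)
    then show ?case by (intro exI[of _ "[q]"]) simp
  next
    case (diff u v)
    then obtain ps qs where ps: "set ps \<subseteq> carrier M \<times> carrier N" "tc u = tc (\<Sum>q\<leftarrow>ps. frag_of q)"
      and qs: "set qs \<subseteq> carrier M \<times> carrier N" "tc v = tc (\<Sum>q\<leftarrow>qs. frag_of q)" by blast
    let ?n = "\<lambda>(x, y). (\<ominus>\<^bsub>M\<^esub> x, y)"
    have "tc (\<Sum>q\<leftarrow>map ?n qs. frag_of q) = tc (- (\<Sum>q\<leftarrow>qs. frag_of q))" using qs(1)
    proof (induction qs)
      case (Cons q qs)
      then have "tc (frag_of (?n q) + (\<Sum>q\<leftarrow>map ?n qs. frag_of q)) = tc (- frag_of q + - (\<Sum>q\<leftarrow>qs. frag_of q))"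
        by (intro tensor_class_add_cong) (auto simp: tensor_class_minus_left)
      then show ?case by simp
    qed simp
    then have "tc (u + - v) = tc ((\<Sum>q\<leftarrow>ps. frag_of q) + (\<Sum>q\<leftarrow>map ?n qs. frag_of q))"
      using ps qs tensor_class_minus_cong[OF qs(2)] by (intro tensor_class_add_cong) auto
    then show ?case using ps(1) qs(1) by (intro exI[of _ "ps @ map ?n qs"]) auto
  qed
  then show ?thesis using u by simp
qed

end

lemma tensor_relations_cases [consumes 1, case_names left right smult]:
  assumes "r \<in> tensor_relations R M N"
  obtains x x' y where "x \<in> carrier M" "x' \<in> carrier M" "y \<in> carrier N"
      "r = frag_of (x \<oplus>\<^bsub>M\<^esub> x', y) - frag_of (x, y) - frag_of (x', y)"
  | x y y' where "x \<in> carrier M" "y \<in> carrier N" "y' \<in> carrier N"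
      "r = frag_of (x, y \<oplus>\<^bsub>N\<^esub> y') - frag_of (x, y) - frag_of (x, y')"
  | a x y where "a \<in> carrier R" "x \<in> carrier M" "y \<in> carrier N"
      "r = frag_of (a \<odot>\<^bsub>M\<^esub> x, y) - frag_of (x, a \<odot>\<^bsub>N\<^esub> y)"
  using assms unfolding tensor_relations_def
  apply (elim UnE CollectE exE conjE)
  subgoal by (rule that(1))
  subgoal by (rule that(2))
  subgoal by (rule that(3))
  done

text \<open>Both factors are mapped at once. With the identity on the right this gives the induced
  boundary maps; with a homotopy on the left and the ergodic potential on the right it is applied to
  the relation expressing that a chain is a cycle.\<close>

lemma tensor_bimap_kernel:
  assumes "tensor_pair R M N" "tensor_pair R M' N"
    and h: "linear_map R M M' h" and t: "linear_map R N N t"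
    and u: "u \<in> tensor_kernel R M N"
  shows "frag_extend (\<lambda>(x, y). frag_of (h x, t y)) u \<in> tensor_kernel R M' N"
proof -
  interpret A: tensor_pair R M N by fact
  interpret B: tensor_pair R M' N by fact
  let ?f = "frag_extend (\<lambda>(x, y). frag_of (h x, t y))"
  show ?thesis using u
  proof (induction rule: A.tensor_kernel_induct)
    case zero
    then show ?case by (simp add: B.tensor_kernel_zero)
  next
    case (relation r)
    then have "?f r \<in> tensor_relations R M' N"
    proof (cases rule: tensor_relations_cases)
      case (left x x' y)
      then have "?f r = frag_of (h x \<oplus>\<^bsub>M'\<^esub> h x', t y) - frag_of (h x, t y) - frag_of (h x', t y)"
        by (simp add: frag_extend_diff linear_map_add[OF h])
      then show ?thesis
        unfolding tensor_relations_def using left linear_map_closed[OF h] linear_map_closed[OF t] by blast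
    next
      case (right x y y')
      then have "?f r = frag_of (h x, t y \<oplus>\<^bsub>N\<^esub> t y') - frag_of (h x, t y) - frag_of (h x, t y')"
        by (simp add: frag_extend_diff linear_map_add[OF t])
      then show ?thesis
        unfolding tensor_relations_def using right linear_map_closed[OF h] linear_map_closed[OF t] by blast
    next
      case (smult a x y)
      then have "?f r = frag_of (a \<odot>\<^bsub>M'\<^esub> h x, t y) - frag_of (h x, a \<odot>\<^bsub>N\<^esub> t y)"
        by (simp add: frag_extend_diff linear_map_smult[OF h] linear_map_smult[OF t])
      then show ?thesis
        unfolding tensor_relations_def using smult linear_map_closed[OF h] linear_map_closed[OF t] by blast
    qed
    then show ?case unfolding tensor_kernel_def by (rule generate.incl)
  next
    case (add u v)
    then show ?case by (simp add: frag_extend_add B.tensor_kernel_add)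
  next
    case (minus u)
    then show ?case by (simp add: frag_extend_minus B.tensor_kernel_minus)
  qed
qed

lemma tensor_map_class:
  assumes "tensor_pair R M N" "tensor_pair R M' N" and h: "linear_map R M M' h"
  shows "tensor_map R M' N h (tensor_class R M N u) =
    tensor_class R M' N (frag_extend (\<lambda>(x, y). frag_of (h x, y)) u)"
proof -
  interpret A: tensor_pair R M N by fact
  interpret B: tensor_pair R M' N by fact
  let ?f = "frag_extend (\<lambda>(x, y). frag_of (h x, y))"
  have id: "linear_map R N N (\<lambda>y. y)" by (simp add: linear_map_def)
  have "tensor_class R M' N (?f v) = tensor_class R M' N (?f u)" if "v \<in> tensor_class R M N u" for v
  proof -
    have "v - u \<in> tensor_kernel R M N" using that by (auto simp: A.tensor_class_eq)
    from tensor_bimap_kernel[OF assms id this] show ?thesis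
      by (simp add: B.tensor_class_eq_iff frag_extend_diff)
  qed
  moreover have "tensor_class R M N u \<noteq> {}" unfolding A.tensor_class_eq using A.tensor_kernel_zero by blast
  ultimately have "(\<lambda>u. tensor_class R M' N (?f u)) ` tensor_class R M N u = {tensor_class R M' N (?f u)}" by auto
  then show ?thesis unfolding tensor_map_def by simp
qed

section \<open>Complex-valued functionals on tensor products\<close>

definition frag_sum :: "('a \<Rightarrow> complex) \<Rightarrow> ('a \<Rightarrow>\<^sub>0 int) \<Rightarrow> complex" where
  "frag_sum \<beta> u = (\<Sum>q\<in>Poly_Mapping.keys u. of_int (Poly_Mapping.lookup u q) * \<beta> q)"

lemma frag_sum_superset:
  assumes "finite S" "Poly_Mapping.keys u \<subseteq> S"
  shows "frag_sum \<beta> u = (\<Sum>q\<in>S. of_int (Poly_Mapping.lookup u q) * \<beta> q)"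
  unfolding frag_sum_def by (rule sum.mono_neutral_left) (use assms in \<open>auto simp: in_keys_iff\<close>)

lemma frag_sum_of [simp]: "frag_sum \<beta> (frag_of q) = \<beta> q"
  by (simp add: frag_sum_def)

lemma frag_sum_zero [simp]: "frag_sum \<beta> 0 = 0"
  by (simp add: frag_sum_def)

lemma frag_sum_minus: "frag_sum \<beta> (- u) = - frag_sum \<beta> u"
  by (simp add: frag_sum_def sum_negf)

lemma frag_sum_add: "frag_sum \<beta> (u + v) = frag_sum \<beta> u + frag_sum \<beta> v"
proof -
  let ?S = "Poly_Mapping.keys u \<union> Poly_Mapping.keys v"
  have S: "finite ?S" by simp
  have "frag_sum \<beta> (u + v) = (\<Sum>q\<in>?S. of_int (Poly_Mapping.lookup (u + v) q) * \<beta> q)"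
    by (rule frag_sum_superset[OF S keys_add])
  also have "\<dots> = frag_sum \<beta> u + frag_sum \<beta> v"
    using frag_sum_superset[OF S, of u \<beta>] frag_sum_superset[OF S, of v \<beta>]
    by (simp add: lookup_add distrib_right sum.distrib)
  finally show ?thesis .
qed

lemma frag_sum_diff: "frag_sum \<beta> (u - v) = frag_sum \<beta> u - frag_sum \<beta> v"
  using frag_sum_add[of \<beta> u "- v"] by (simp add: frag_sum_minus)

lemma frag_sum_sum: "frag_sum \<beta> (\<Sum>i\<in>I. u i) = (\<Sum>i\<in>I. frag_sum \<beta> (u i))"
  by (induction I rule: infinite_finite_induct) (auto simp: frag_sum_add)

text \<open>The universal property of the tensor product for complex-valued balanced maps. It is the
  means by which coordinates of a chain become well defined.\<close>

lemma (in tensor_pair) frag_sum_balanced: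
  assumes "\<And>x x' y. x \<in> carrier M \<Longrightarrow> x' \<in> carrier M \<Longrightarrow> y \<in> carrier N \<Longrightarrow> \<beta> (x \<oplus>\<^bsub>M\<^esub> x', y) = \<beta> (x, y) + \<beta> (x', y)"
    and "\<And>x y y'. x \<in> carrier M \<Longrightarrow> y \<in> carrier N \<Longrightarrow> y' \<in> carrier N \<Longrightarrow> \<beta> (x, y \<oplus>\<^bsub>N\<^esub> y') = \<beta> (x, y) + \<beta> (x, y')"
    and "\<And>a x y. a \<in> carrier R \<Longrightarrow> x \<in> carrier M \<Longrightarrow> y \<in> carrier N \<Longrightarrow> \<beta> (a \<odot>\<^bsub>M\<^esub> x, y) = \<beta> (x, a \<odot>\<^bsub>N\<^esub> y)"
    and "tc u = tc v"
  shows "frag_sum \<beta> u = frag_sum \<beta> v"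
proof -
  have "frag_sum \<beta> w = 0" if "w \<in> K" for w
    using that
  proof (induction rule: tensor_kernel_induct)
    case (relation r)
    then show ?case by (cases rule: tensor_relations_cases) (simp_all add: frag_sum_diff assms(1-3))
  qed (auto simp: frag_sum_add frag_sum_minus)
  then show ?thesis using assms(4) by (fastforce simp: tensor_class_eq_iff frag_sum_diff)
qed

section \<open>Reduced cohomology\<close>

lemma carrier_lp_module [simp]: "carrier (lp_module G p) = lp_space G p"
  and add_lp_module [simp]: "f \<oplus>\<^bsub>lp_module G p\<^esub> f' = (\<lambda>g. f g + f' g)"
  and zero_lp_module [simp]: "\<zero>\<^bsub>lp_module G p\<^esub> = (\<lambda>g. 0)"
  and smult_lp_module [simp]: "a \<odot>\<^bsub>lp_module G p\<^esub> f = group_convolution G a f"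
  by (simp_all add: lp_module_def)

lemma carrier_to_right_module [simp]: "carrier (to_right_module G M) = carrier M"
  and add_to_right_module [simp]: "add (to_right_module G M) = add M"
  and zero_to_right_module [simp]: "\<zero>\<^bsub>to_right_module G M\<^esub> = \<zero>\<^bsub>M\<^esub>"
  and smult_to_right_module [simp]: "a \<odot>\<^bsub>to_right_module G M\<^esub> x = group_ring_involution G a \<odot>\<^bsub>M\<^esub> x"
  and a_inv_to_right_module [simp]: "\<ominus>\<^bsub>to_right_module G M\<^esub> x = \<ominus>\<^bsub>M\<^esub> x"
  and finsum_to_right_module [simp]: "finsum (to_right_module G M) = finsum M"
  by (simp_all add: to_right_module_def a_inv_def finsum_def fun_eq_iff)

lemma abelian_group_to_right_module: "abelian_group M \<Longrightarrow> abelian_group (to_right_module G M)"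
  by (simp add: abelian_group_def abelian_monoid_def abelian_group_axioms_def to_right_module_def)

lemma group_convolution_cmult_sum:
  fixes c :: "'i \<Rightarrow> complex"
  shows "group_convolution G a (\<lambda>g. \<Sum>i\<in>I. c i * f i g) = (\<lambda>g. \<Sum>i\<in>I. c i * group_convolution G a (f i) g)"
proof
  fix g
  show "group_convolution G a (\<lambda>g. \<Sum>i\<in>I. c i * f i g) g = (\<Sum>i\<in>I. c i * group_convolution G a (f i) g)"
  proof (cases "g \<in> carrier G")
    case True
    then show ?thesis
      by (simp add: group_convolution_def sum_distrib_left mult.left_commute sum.swap[of _ I])
  qed (simp add: group_convolution_def)
qed

context group begin

lemma group_convolution_eq_sum_translate:
  fixes f :: "'a \<Rightarrow> complex"
  assumes "a \<in> carrier (int_group_ring G)"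
  shows "group_convolution G a f = (\<lambda>g. \<Sum>x\<in>{x \<in> carrier G. a x \<noteq> 0}. of_int (a x) * translate G x f g)"
  by (auto simp: group_convolution_def translate_def fun_eq_iff)

lemma group_convolution_lp_space:
  assumes a: "a \<in> carrier (int_group_ring G)" and f: "f \<in> lp_space G p" and p: "p \<ge> 1"
  shows "group_convolution G a f \<in> lp_space G p"
proof -
  have "finite {x \<in> carrier G. a x \<noteq> 0}" using a by (auto simp: int_group_ring_def)
  then show ?thesis
    unfolding group_convolution_eq_sum_translate[OF a]
    by (intro lp_space_sum lp_space_cmult translate_lp_space f p) auto
qed

lemma left_module_lp:
  assumes p: "p \<ge> 1"
  shows "left_module (int_group_ring G) (lp_module G p)"
proof -
  have "abelian_group (lp_module G p)"
  proof (rule abelian_groupI)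
    fix f assume "f \<in> carrier (lp_module G p)"
    then show "\<exists>f'\<in>carrier (lp_module G p). f' \<oplus>\<^bsub>lp_module G p\<^esub> f = \<zero>\<^bsub>lp_module G p\<^esub>"
      using lp_space_uminus[of f G p] by (intro bexI[of _ "\<lambda>g. - f g"]) auto
  qed (use p in \<open>auto simp: lp_space_add add_ac\<close>)
  then show ?thesis
  proof (intro left_module.intro ring_int_group_ring left_module_axioms.intro)
    fix a b f assume a: "a \<in> carrier (int_group_ring G)" and f: "f \<in> carrier (lp_module G p)"
    show "a \<odot>\<^bsub>lp_module G p\<^esub> f \<in> carrier (lp_module G p)"
      using a f p by (simp add: group_convolution_lp_space)
    assume b: "b \<in> carrier (int_group_ring G)"
    show "(a \<oplus>\<^bsub>int_group_ring G\<^esub> b) \<odot>\<^bsub>lp_module G p\<^esub> f = a \<odot>\<^bsub>lp_module G p\<^esub> f \<oplus>\<^bsub>lp_module G p\<^esub> b \<odot>\<^bsub>lp_module G p\<^esub> f"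
      using group_convolution_add_left[OF a b, of f] by (simp add: int_group_ring_def)
    show "(a \<otimes>\<^bsub>int_group_ring G\<^esub> b) \<odot>\<^bsub>lp_module G p\<^esub> f = a \<odot>\<^bsub>lp_module G p\<^esub> (b \<odot>\<^bsub>lp_module G p\<^esub> f)"
      using group_convolution_assoc[OF a b, of f] by (simp add: int_group_ring_def)
  next
    fix f assume "f \<in> carrier (lp_module G p)"
    then show "\<one>\<^bsub>int_group_ring G\<^esub> \<odot>\<^bsub>lp_module G p\<^esub> f = f"
      using group_convolution_one[of f] by (simp add: int_group_ring_def lp_space_outside)
  next
    fix a f f'
    show "a \<odot>\<^bsub>lp_module G p\<^esub> (f \<oplus>\<^bsub>lp_module G p\<^esub> f') = a \<odot>\<^bsub>lp_module G p\<^esub> f \<oplus>\<^bsub>lp_module G p\<^esub> a \<odot>\<^bsub>lp_module G p\<^esub> f'"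
      using group_convolution_add_right[of G a f f'] by simp
  qed
qed

lemma a_inv_lp_module:
  assumes "p \<ge> 1" "f \<in> lp_space G p"
  shows "\<ominus>\<^bsub>lp_module G p\<^esub> f = (\<lambda>g. - f g)"
proof -
  interpret L: left_module "int_group_ring G" "lp_module G p" by (rule left_module_lp) fact
  show ?thesis using assms by (intro L.M.minus_equality) (auto simp: lp_space_uminus)
qed

lemma finsum_lp_module:
  assumes p: "p \<ge> 1" and "finite A" "\<And>b. b \<in> A \<Longrightarrow> f b \<in> lp_space G p"
  shows "(\<Oplus>\<^bsub>lp_module G p\<^esub>b\<in>A. f b) = (\<lambda>g. \<Sum>b\<in>A. f b g)"
proof -
  interpret L: left_module "int_group_ring G" "lp_module G p" by (rule left_module_lp) fact
  show ?thesis using assms(2,3)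
    by (induction A rule: finite_induct) (auto simp: Pi_iff)
qed

lemma group_ring_involution_closed [simp, intro]:
  assumes "a \<in> carrier (int_group_ring G)"
  shows "group_ring_involution G a \<in> carrier (int_group_ring G)"
proof -
  have "{g. group_ring_involution G a g \<noteq> 0} \<subseteq> (\<lambda>x. inv x) ` {x. a x \<noteq> 0}"
    by (force simp: group_ring_involution_def image_iff split: if_splits)
  moreover have "finite {x. a x \<noteq> 0}" using assms by (simp add: int_group_ring_def)
  ultimately have "finite {g. group_ring_involution G a g \<noteq> 0}" by (meson finite_imageI finite_subset)
  then show ?thesis unfolding int_group_ring_def by (simp add: group_ring_involution_def)
qed

lemma group_ring_involution_involution:
  "a \<in> carrier (int_group_ring G) \<Longrightarrow> group_ring_involution G (group_ring_involution G a) = a"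
  by (auto simp: group_ring_involution_def int_group_ring_def fun_eq_iff)

lemma group_ring_involution_group_element:
  "w \<in> carrier G \<Longrightarrow> group_ring_involution G (group_element w) = group_element (inv w)"
  by (auto simp: group_ring_involution_def group_element_def fun_eq_iff)

lemma group_ring_involution_mult:
  assumes a: "a \<in> carrier (int_group_ring G)" and b: "b \<in> carrier (int_group_ring G)"
  shows "group_ring_involution G (group_convolution G a b) =
    group_convolution G (group_ring_involution G b) (group_ring_involution G a)"
proof
  fix g
  show "group_ring_involution G (group_convolution G a b) g =
    group_convolution G (group_ring_involution G b) (group_ring_involution G a) g"
  proof (cases "g \<in> carrier G")
    case g: True
    let ?A = "{x. a x \<noteq> 0}" and ?B = "{y. group_ring_involution G b y \<noteq> 0}"
    have A: "finite ?A" "?A \<subseteq> carrier G" and B: "finite ?B" "?B \<subseteq> carrier G"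
      using a group_ring_involution_closed[OF b] by (auto simp: int_group_ring_def)
    \<comment> \<open>The support of \<open>y \<mapsto> a (inv g \<otimes> y)\<close>, which is the
      second factor of \<open>?t\<close>; substituting \<open>y = g \<otimes> x\<close> then gives a
      sum over the support of \<open>a\<close>.\<close>
    let ?P = "(\<otimes>) g ` ?A"
    let ?t = "\<lambda>y. group_ring_involution G b y * group_ring_involution G a (inv y \<otimes> g)"
    have P: "finite ?P" "?P \<subseteq> carrier G" using A g by auto
    have "group_convolution G (group_ring_involution G b) (group_ring_involution G a) g = sum ?t (?P \<union> ?B)"
      using group_convolution_superset[of "?P \<union> ?B" "group_ring_involution G b" g "group_ring_involution G a"] P B g by auto
    also have "\<dots> = sum ?t ?P"
    proof (rule sum.mono_neutral_right)
      show "\<forall>y\<in>?P \<union> ?B - ?P. ?t y = 0"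
      proof
        fix y assume y: "y \<in> ?P \<union> ?B - ?P"
        then have yc: "y \<in> carrier G" using B P by blast
        have "y = g \<otimes> (inv g \<otimes> y)" using g yc by (simp flip: m_assoc)
        then have "a (inv g \<otimes> y) = 0" using y by blast
        then show "?t y = 0" using g yc by (simp add: group_ring_involution_def inv_mult_group)
      qed
    qed (use P B in auto)
    also have "\<dots> = (\<Sum>x\<in>?A. ?t (g \<otimes> x))"
    proof (subst sum.reindex)
      show "inj_on ((\<otimes>) g) ?A" using A g by (auto simp: inj_on_def subset_iff)
    qed simp
    also have "\<dots> = (\<Sum>x\<in>?A. a x * b (inv x \<otimes> inv g))"
      using A g by (intro sum.cong) (auto simp: group_ring_involution_def inv_mult_group m_assoc subset_iff)
    also have "\<dots> = group_convolution G a b (inv g)"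
      using group_convolution_superset[OF A, of a "inv g" b] g by simp
    finally show ?thesis using g by (simp add: group_ring_involution_def)
  qed (simp add: group_ring_involution_def group_convolution_def)
qed

lemma tensor_pair_lp:
  assumes p: "p \<ge> 1" and M: "left_module (int_group_ring G) M"
  shows "tensor_pair (int_group_ring G) (to_right_module G M) (lp_module G p)"
proof -
  interpret M: left_module "int_group_ring G" M by (rule M)
  interpret L: left_module "int_group_ring G" "lp_module G p" by (rule left_module_lp[OF p])
  have "abelian_group (to_right_module G M)"
    by (rule abelian_group_to_right_module) (rule M.M.abelian_group_axioms)
  then show ?thesis
    using L.smult_closed
    by (intro tensor_pair.intro tensor_pair_axioms.intro L.M.abelian_group_axioms) auto
qed

lemma linear_map_to_right_module:
  "linear_map (int_group_ring G) M M' h \<Longrightarrow> linear_map (int_group_ring G) (to_right_module G M) (to_right_module G M') h"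
  by (auto simp: linear_map_def)

text \<open>Powers of a central element are central, so all translations involved commute with the
  group ring. Linearity lets the potential act on cochains by composition and on chains through the
  second tensor factor.\<close>

lemma linear_map_ergodic_potential:
  assumes w: "w \<in> carrier G" "\<And>y. y \<in> carrier G \<Longrightarrow> w \<otimes> y = y \<otimes> w" and p: "p \<ge> 1"
  shows "linear_map (int_group_ring G) (lp_module G p) (lp_module G p) (ergodic_potential w N)"
proof -
  have comm: "(w [^] (j::nat)) \<otimes> y = y \<otimes> (w [^] j)" if "y \<in> carrier G" for j y
  proof (induction j)
    case (Suc j)
    then show ?case using w that by (metis m_assoc nat_pow_Suc nat_pow_closed)
  qed (use that in simp)
  have conv: "translate G (w [^] j) (group_convolution G a f) = group_convolution G a (translate G (w [^] j) f)"
    if "a \<in> carrier (int_group_ring G)" for a f and j :: nat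
    using group_convolution_central[of "w [^] j" a f] comm w(1) that
    by (simp add: group_convolution_group_element_complex)
  have add: "translate G v (\<lambda>g. f g + f' g) = (\<lambda>g. translate G v f g + translate G v f' g)" for v f f'
    by (auto simp: translate_def)
  show ?thesis
    unfolding linear_map_def
  proof (intro conjI ballI funcsetI)
    fix f assume "f \<in> carrier (lp_module G p)"
    then show "ergodic_potential w N f \<in> carrier (lp_module G p)"
      using w(1) p by (simp add: ergodic_potential_lp_space)
    fix f'
    show "ergodic_potential w N (f \<oplus>\<^bsub>lp_module G p\<^esub> f') =
        ergodic_potential w N f \<oplus>\<^bsub>lp_module G p\<^esub> ergodic_potential w N f'"
      by (simp add: ergodic_potential_def add distrib_left sum.distrib)
  next
    fix a f assume "a \<in> carrier (int_group_ring G)"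
    then show "ergodic_potential w N (a \<odot>\<^bsub>lp_module G p\<^esub> f) = a \<odot>\<^bsub>lp_module G p\<^esub> ergodic_potential w N f"
      unfolding smult_lp_module ergodic_potential_def group_convolution_cmult_sum by (simp add: conv)
  qed
qed

end

lemma trivial_group_Mod_self:
  assumes G: "group G" and C: "subgroup C G"
  shows "trivial_group (G\<lparr>carrier := C\<rparr> Mod C)"
proof -
  interpret C: group "G\<lparr>carrier := C\<rparr>" by (rule subgroup.subgroup_is_group[OF C G])
  have CC: "subgroup C (G\<lparr>carrier := C\<rparr>)" using C.subgroup_self by simp
  then have "C \<lhd> G\<lparr>carrier := C\<rparr>"
    using C.m_closed C.inv_closed by (simp add: C.normal_inv_iff)
  then have "group (G\<lparr>carrier := C\<rparr> Mod C)"
    by (rule normal.factorgroup_is_group)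
  moreover have "carrier (G\<lparr>carrier := C\<rparr> Mod C) = {C}"
    using C.coset_join2[OF _ CC] subgroup.one_closed[OF C] by (auto simp: FactGroup_def RCOSETS_def)
  ultimately show ?thesis by (simp add: trivial_group_def FactGroup_def)
qed

lemma limitin_imp_in_closure_of:
  assumes "limitin Y f l F" "F \<noteq> bot" "\<forall>\<^sub>F n in F. f n \<in> S"
  shows "l \<in> Y closure_of S"
  unfolding in_closure_of
proof (intro conjI allI impI)
  show "l \<in> topspace Y" using assms(1) by (simp add: limitin_def)
  fix U assume "l \<in> U \<and> openin Y U"
  then have "\<forall>\<^sub>F n in F. f n \<in> U" using assms(1) by (simp add: limitin_def)
  with assms(3) have "\<forall>\<^sub>F n in F. f n \<in> S \<and> f n \<in> U" by (rule eventually_conj)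
  then show "\<exists>y. y \<in> S \<and> y \<in> U" using assms(2) eventually_happens by blast
qed

lemma group_Hom_group:
  assumes M: "left_module R M" and N: "left_module R N"
  shows "group (Hom_group R M N)"
proof (rule groupI)
  interpret M: left_module R M by (rule M)
  interpret N: left_module R N by (rule N)
  fix \<phi> assume \<phi>: "\<phi> \<in> carrier (Hom_group R M N)"
  then have l: "linear_map R M N \<phi>" and e: "\<phi> \<in> extensional (carrier M)" by (auto simp: Hom_group_def)
  note c = linear_map_closed[OF l]
  show "\<one>\<^bsub>Hom_group R M N\<^esub> \<otimes>\<^bsub>Hom_group R M N\<^esub> \<phi> = \<phi>"
    using c e by (auto simp: Hom_group_def fun_eq_iff restrict_def extensional_def)
  have "linear_map R M N (\<lambda>x\<in>carrier M. \<ominus>\<^bsub>N\<^esub> \<phi> x)"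
    unfolding linear_map_def using c linear_map_add[OF l] linear_map_smult[OF l]
    by (auto simp: N.M.minus_add N.smult_r_minus)
  then show "\<exists>\<psi>\<in>carrier (Hom_group R M N). \<psi> \<otimes>\<^bsub>Hom_group R M N\<^esub> \<phi> = \<one>\<^bsub>Hom_group R M N\<^esub>"
    using c by (intro bexI[of _ "\<lambda>x\<in>carrier M. \<ominus>\<^bsub>N\<^esub> \<phi> x"]) (auto simp: Hom_group_def N.M.l_neg)
  fix \<psi> assume \<psi>: "\<psi> \<in> carrier (Hom_group R M N)"
  then have l': "linear_map R M N \<psi>" by (auto simp: Hom_group_def)
  note c' = linear_map_closed[OF l']
  have "linear_map R M N (\<lambda>x\<in>carrier M. \<phi> x \<oplus>\<^bsub>N\<^esub> \<psi> x)"
    unfolding linear_map_def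
    using c c' linear_map_add[OF l] linear_map_smult[OF l] linear_map_add[OF l'] linear_map_smult[OF l']
    by (auto simp: N.M.a_ac N.smult_r_distr)
  then show "\<phi> \<otimes>\<^bsub>Hom_group R M N\<^esub> \<psi> \<in> carrier (Hom_group R M N)"
    by (auto simp: Hom_group_def)
  fix \<chi>' assume "\<chi>' \<in> carrier (Hom_group R M N)"
  then have "\<And>x. x \<in> carrier M \<Longrightarrow> \<chi>' x \<in> carrier N" by (auto simp: Hom_group_def linear_map_def)
  then show "\<phi> \<otimes>\<^bsub>Hom_group R M N\<^esub> \<psi> \<otimes>\<^bsub>Hom_group R M N\<^esub> \<chi>' = \<phi> \<otimes>\<^bsub>Hom_group R M N\<^esub> (\<psi> \<otimes>\<^bsub>Hom_group R M N\<^esub> \<chi>')"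
    using c c' by (auto simp: Hom_group_def fun_eq_iff N.M.a_assoc)
next
  interpret M: left_module R M by (rule M)
  interpret N: left_module R N by (rule N)
  show "\<one>\<^bsub>Hom_group R M N\<^esub> \<in> carrier (Hom_group R M N)"
    by (auto simp: Hom_group_def linear_map_def)
qed

text \<open>Cocycles arise with \<open>S\<close> the image of the boundary map.\<close>

lemma subgroup_kernel_precompose:
  assumes M: "left_module R M" and N: "left_module R N" and S: "S \<subseteq> carrier M"
  shows "subgroup {\<phi> \<in> carrier (Hom_group R M N). \<forall>x\<in>S. \<phi> x = \<zero>\<^bsub>N\<^esub>} (Hom_group R M N)"
proof -
  interpret N: left_module R N by (rule N)
  interpret H: group "Hom_group R M N" by (rule group_Hom_group[OF M N])
  have mult: "(\<phi> \<otimes>\<^bsub>Hom_group R M N\<^esub> \<psi>) x = \<phi> x \<oplus>\<^bsub>N\<^esub> \<psi> x" if "x \<in> S" for \<phi> \<psi> x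
    using that S by (auto simp: Hom_group_def)
  have one: "\<one>\<^bsub>Hom_group R M N\<^esub> x = \<zero>\<^bsub>N\<^esub>" if "x \<in> S" for x
    using that S by (auto simp: Hom_group_def)
  show ?thesis
  proof (rule H.subgroupI)
    show "{\<phi> \<in> carrier (Hom_group R M N). \<forall>x\<in>S. \<phi> x = \<zero>\<^bsub>N\<^esub>} \<noteq> {}"
      using one H.one_closed by blast
    fix \<phi> assume \<phi>: "\<phi> \<in> {\<phi> \<in> carrier (Hom_group R M N). \<forall>x\<in>S. \<phi> x = \<zero>\<^bsub>N\<^esub>}"
    have "(inv\<^bsub>Hom_group R M N\<^esub> \<phi>) x = \<zero>\<^bsub>N\<^esub>" if x: "x \<in> S" for x
    proof -
      have "linear_map R M N (inv\<^bsub>Hom_group R M N\<^esub> \<phi>)" using H.inv_closed[of \<phi>] \<phi> by (simp add: Hom_group_def)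
      then have "(inv\<^bsub>Hom_group R M N\<^esub> \<phi>) x \<in> carrier N" using x S by (auto intro: linear_map_closed)
      moreover have "(inv\<^bsub>Hom_group R M N\<^esub> \<phi>) x \<oplus>\<^bsub>N\<^esub> \<phi> x = \<zero>\<^bsub>N\<^esub>"
        using mult[OF x, of "inv\<^bsub>Hom_group R M N\<^esub> \<phi>" \<phi>] one[OF x] \<phi> by simp
      ultimately show ?thesis using \<phi> x by simp
    qed
    then show "inv\<^bsub>Hom_group R M N\<^esub> \<phi> \<in> {\<phi> \<in> carrier (Hom_group R M N). \<forall>x\<in>S. \<phi> x = \<zero>\<^bsub>N\<^esub>}"
      using \<phi> by simp
    fix \<psi> assume "\<psi> \<in> {\<phi> \<in> carrier (Hom_group R M N). \<forall>x\<in>S. \<phi> x = \<zero>\<^bsub>N\<^esub>}"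
    then show "\<phi> \<otimes>\<^bsub>Hom_group R M N\<^esub> \<psi> \<in> {\<phi> \<in> carrier (Hom_group R M N). \<forall>x\<in>S. \<phi> x = \<zero>\<^bsub>N\<^esub>}"
      using \<phi> mult by simp
  qed auto
qed

lemma projective_resolution_linear_boundary:
  "projective_resolution G F d \<epsilon> \<Longrightarrow> linear_map (int_group_ring G) (F (Suc i)) (F i) (d (Suc i))"
  by (simp add: projective_resolution_def)

lemma projective_resolution_left_module:
  "projective_resolution G F d \<epsilon> \<Longrightarrow> left_module (int_group_ring G) (F i)"
  by (simp add: projective_resolution_def projective_module_def)

lemma projective_resolution_boundary_boundary:
  assumes "projective_resolution G F d \<epsilon>" "x \<in> carrier (F (Suc (Suc i)))"
  shows "d (Suc i) (d (Suc (Suc i)) x) = \<zero>\<^bsub>F i\<^esub>"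
  using assms unfolding projective_resolution_def by blast

lemma carrier_lp_cochains:
  "carrier (lp_cochains G p M) =
    {\<phi> \<in> extensional (carrier M). linear_map (int_group_ring G) M (lp_module G p) \<phi>}"
  by (simp add: lp_cochains_def Hom_group_def)

text \<open>This description as an annihilator is the one from which the subgroup property and
  closedness are derived.\<close>

lemma lp_cocycles_eq:
  assumes "\<And>x. x \<in> carrier (F (Suc i)) \<Longrightarrow> d (Suc i) x \<in> carrier (F i)"
  shows "lp_cocycles G p F d i = {\<phi> \<in> carrier (lp_cochains G p (F i)).
    \<forall>x\<in>d (Suc i) ` carrier (F (Suc i)). \<phi> x = \<zero>\<^bsub>lp_module G p\<^esub>}"
  by (auto simp: lp_cocycles_def kernel_def lp_coboundary_def lp_cochains_def Hom_group_def compose_def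
      restrict_def fun_eq_iff)

context group begin

text \<open>The cocycle condition says that each number \<open>\<phi> (d (Suc i) x) g\<close> is
  zero, and each of them depends continuously on \<open>\<phi>\<close>: evaluation at an element,
  followed by a coordinate.\<close>

lemma closedin_lp_cocycles:
  assumes d: "\<And>x. x \<in> carrier (F (Suc i)) \<Longrightarrow> d (Suc i) x \<in> carrier (F i)" and p: "p \<ge> 1"
  shows "closedin (lp_cochain_topology G p (F i)) (lp_cocycles G p F d i)"
proof -
  let ?Y = "lp_cochain_topology G p (F i)"
  have top: "topspace ?Y = carrier (lp_cochains G p (F i))"
  proof -
    have "carrier (lp_cochains G p (F i)) \<subseteq> carrier (F i) \<rightarrow>\<^sub>E lp_space G p"
      by (auto simp: carrier_lp_cochains linear_map_def PiE_def)
    then show ?thesis using p by (auto simp: lp_cochain_topology_def)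
  qed
  have c: "closedin ?Y {\<phi> \<in> topspace ?Y. \<phi> (d (Suc i) x) g \<in> {0}}" if x: "x \<in> carrier (F (Suc i))" for x g
  proof (rule closedin_continuous_map_preimage)
    have "continuous_map ?Y (lp_topology G p) (\<lambda>\<phi>. \<phi> (d (Suc i) x))"
      unfolding lp_cochain_topology_def
      by (intro continuous_map_from_subtopology continuous_map_product_projection d x)
    from continuous_map_compose[OF this continuous_map_lp_eval[OF p, of G g]]
    show "continuous_map ?Y euclidean (\<lambda>\<phi>. \<phi> (d (Suc i) x) g)" by (simp add: o_def)
  qed simp
  have "lp_cocycles G p F d i = topspace ?Y \<inter> (\<Inter>x\<in>carrier (F (Suc i)). \<Inter>g. {\<phi> \<in> topspace ?Y. \<phi> (d (Suc i) x) g \<in> {0}})"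
    by (subst lp_cocycles_eq[of F i d, OF d]) (auto simp: top fun_eq_iff)
  also have "closedin ?Y \<dots>"
  proof (cases "carrier (F (Suc i)) = {}")
    case False
    then show ?thesis by (intro closedin_Int closedin_topspace closedin_INT) (use c in auto)
  qed simp
  finally show ?thesis .
qed

text \<open>The approximants \<open>\<psi> N\<close>, the cocycle minus its average, equal
  \<open>Q N \<circ> \<phi> \<circ> (1 - z)\<close> for positive \<open>N\<close>, and the homotopy
  replaces \<open>1 - z\<close> by \<open>d h + h d\<close>. The first part dies since
  \<open>\<phi>\<close> is a cocycle, and the second is a coboundary.\<close>

lemma lp_cocycle_in_closure_of_coboundaries:
  assumes res: "projective_resolution G F d \<epsilon>" and p: "p > 1"
    and z: "z \<in> carrier G" "\<And>y. y \<in> carrier G \<Longrightarrow> z \<otimes> y = y \<otimes> z" "inj (\<lambda>k::nat. z [^] k)"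
    and \<phi>: "\<phi> \<in> lp_cocycles G p F d i"
  shows "\<phi> \<in> lp_cochain_topology G p (F i) closure_of lp_coboundaries G p F d i"
proof -
  have p1: "p \<ge> 1" using p by simp
  note d = projective_resolution_linear_boundary[OF res]
  note FM = projective_resolution_left_module[OF res]
  interpret L: left_module "int_group_ring G" "lp_module G p" by (rule left_module_lp[OF p1])
  interpret M: left_module "int_group_ring G" "F i" by (rule FM)
  have e: "group_element z \<in> carrier (int_group_ring G)" using z(1) by simp
  have "\<phi> \<in> carrier (lp_cochains G p (F i))" and \<phi>0: "\<And>x. x \<in> carrier (F (Suc i)) \<Longrightarrow> \<phi> (d (Suc i) x) = (\<lambda>g. 0)"
    using \<phi> lp_cocycles_eq[of F i d G p] linear_map_closed[OF d] by auto
  then have l: "linear_map (int_group_ring G) (F i) (lp_module G p) \<phi>" and \<phi>ext: "\<phi> \<in> extensional (carrier (F i))"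
    by (auto simp: carrier_lp_cochains)
  have \<phi>c: "\<phi> x \<in> lp_space G p" if "x \<in> carrier (F i)" for x
    using linear_map_closed[OF l that] by simp
  obtain h where h: "\<And>i. linear_map (int_group_ring G) (F i) (F (Suc i)) (h i)"
    and h0: "\<And>x. x \<in> carrier (F 0) \<Longrightarrow> d (Suc 0) (h 0 x) = x \<ominus>\<^bsub>F 0\<^esub> (group_element z \<odot>\<^bsub>F 0\<^esub> x)"
    and hS: "\<And>i x. x \<in> carrier (F (Suc i)) \<Longrightarrow> d (Suc (Suc i)) (h (Suc i) x) \<oplus>\<^bsub>F (Suc i)\<^esub> h i (d (Suc i) x)
       = x \<ominus>\<^bsub>F (Suc i)\<^esub> (group_element z \<odot>\<^bsub>F (Suc i)\<^esub> x)"
    using central_action_homotopic_to_identity[OF res z(1,2)] by metis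
  define Q where "Q N = ergodic_potential z N" for N
  have Q: "linear_map (int_group_ring G) (lp_module G p) (lp_module G p) (Q N)" for N
    unfolding Q_def by (rule linear_map_ergodic_potential[OF z(1,2) p1])
  define \<psi> where "\<psi> N = (\<lambda>x\<in>carrier (F i). \<lambda>g. \<phi> x g - ergodic_average z N (\<phi> x) g)" for N
  have \<psi>Q: "\<psi> N x = Q N (\<phi> (x \<ominus>\<^bsub>F i\<^esub> (group_element z \<odot>\<^bsub>F i\<^esub> x)))" if x: "x \<in> carrier (F i)" and N: "N > 0" for N x
  proof -
    have "\<phi> (x \<ominus>\<^bsub>F i\<^esub> (group_element z \<odot>\<^bsub>F i\<^esub> x)) = \<phi> x \<oplus>\<^bsub>lp_module G p\<^esub> \<phi> (\<ominus>\<^bsub>F i\<^esub> (group_element z \<odot>\<^bsub>F i\<^esub> x))"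
      unfolding a_minus_def using x e by (intro linear_map_add[OF l]) auto
    also have "\<phi> (\<ominus>\<^bsub>F i\<^esub> (group_element z \<odot>\<^bsub>F i\<^esub> x)) = \<ominus>\<^bsub>lp_module G p\<^esub> (group_element z \<odot>\<^bsub>lp_module G p\<^esub> \<phi> x)"
      using linear_map_minus[OF l FM L.left_module_axioms] linear_map_smult[OF l e x] x e by simp
    finally have "Q N (\<phi> (x \<ominus>\<^bsub>F i\<^esub> (group_element z \<odot>\<^bsub>F i\<^esub> x))) =
        Q N (\<phi> x) \<oplus>\<^bsub>lp_module G p\<^esub> \<ominus>\<^bsub>lp_module G p\<^esub> (group_element z \<odot>\<^bsub>lp_module G p\<^esub> Q N (\<phi> x))"
      using linear_map_minus[OF Q L.left_module_axioms L.left_module_axioms] linear_map_add[OF Q]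
        linear_map_smult[OF Q e] linear_map_closed[OF l x] L.smult_closed[OF e] L.M.a_inv_closed by metis
    also have "\<dots> = (\<lambda>g. Q N (\<phi> x) g - translate G z (Q N (\<phi> x)) g)"
      using linear_map_closed[OF Q, of "\<phi> x"] \<phi>c[OF x] p1 z(1)
      by (simp add: group_convolution_group_element_complex a_inv_lp_module translate_lp_space)
    also have "\<dots> = \<psi> N x"
      unfolding Q_def ergodic_potential_minus_translate[OF z(1) \<phi>c[OF x] N] using x by (simp add: \<psi>_def)
    finally show ?thesis by simp
  qed
  have zero: "Q N (\<phi> (d (Suc i) y)) = (\<lambda>g. 0)" if "y \<in> carrier (F (Suc i))" for N y
    using \<phi>0[OF that] linear_map_zero[OF Q L.M.abelian_group_axioms, of N] p1 by simp
  have cob: "\<psi> N \<in> lp_coboundaries G p F d i" if N: "N > 0" for N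
  proof (cases i)
    case 0
    \<comment> \<open>There is no \<open>h d\<close> term in degree 0, so the approximants are zero,
      the only coboundary there.\<close>
    have "\<psi> N x = (\<lambda>g. 0)" if x: "x \<in> carrier (F 0)" for x
      using \<psi>Q[of x N] N x zero[of "h 0 x" N] h0[OF x] linear_map_closed[OF h x] by (simp add: 0)
    then show ?thesis by (auto simp: 0 lp_coboundaries_def lp_cochains_def Hom_group_def \<psi>_def fun_eq_iff)
  next
    case (Suc k)
    \<comment> \<open>The cochain one degree lower whose coboundary is the surviving term
      \<open>Q N \<circ> \<phi> \<circ> h \<circ> d\<close>.\<close>
    define \<theta> where "\<theta> = (\<lambda>y\<in>carrier (F k). Q N (\<phi> (h k y)))"
    have hk: "h k y \<in> carrier (F i)" if "y \<in> carrier (F k)" for y using linear_map_closed[OF h that] by (simp add: Suc)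
    interpret K: left_module "int_group_ring G" "F k" by (rule FM)
    have "linear_map (int_group_ring G) (F k) (lp_module G p) \<theta>"
      unfolding linear_map_def
    proof (intro conjI ballI funcsetI)
      fix x assume x: "x \<in> carrier (F k)"
      then show "\<theta> x \<in> carrier (lp_module G p)"
        unfolding \<theta>_def using linear_map_closed[OF Q linear_map_closed[OF l hk[OF x]]] by simp
      fix y assume y: "y \<in> carrier (F k)"
      show "\<theta> (x \<oplus>\<^bsub>F k\<^esub> y) = \<theta> x \<oplus>\<^bsub>lp_module G p\<^esub> \<theta> y"
        using x y linear_map_add[OF h x y] linear_map_add[OF l hk[OF x] hk[OF y]]
          linear_map_add[OF Q linear_map_closed[OF l hk[OF x]] linear_map_closed[OF l hk[OF y]], of N]
        by (simp add: \<theta>_def Suc)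
    next
      fix a x assume a: "a \<in> carrier (int_group_ring G)" and x: "x \<in> carrier (F k)"
      show "\<theta> (a \<odot>\<^bsub>F k\<^esub> x) = a \<odot>\<^bsub>lp_module G p\<^esub> \<theta> x"
        using a x linear_map_smult[OF h a x] linear_map_smult[OF l a hk[OF x]]
          linear_map_smult[OF Q a linear_map_closed[OF l hk[OF x]], of N]
        by (simp add: \<theta>_def Suc)
    qed
    then have "\<theta> \<in> carrier (lp_cochains G p (F k))" by (simp add: carrier_lp_cochains \<theta>_def)
    moreover have "\<psi> N = lp_coboundary F d i \<theta>"
    proof
      fix x
      show "\<psi> N x = lp_coboundary F d i \<theta> x"
      proof (cases "x \<in> carrier (F i)")
        case x: True
        have dx: "d i x \<in> carrier (F k)" using x linear_map_closed[OF d, of x k] by (simp add: Suc)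
        have 1: "d (Suc i) (h i x) \<in> carrier (F i)" by (rule linear_map_closed[OF d linear_map_closed[OF h x]])
        have "\<psi> N x = Q N (\<phi> (d (Suc i) (h i x) \<oplus>\<^bsub>F i\<^esub> h k (d i x)))"
          using \<psi>Q[OF x N] hS[of x k] x by (simp add: Suc)
        also have "\<dots> = Q N (\<phi> (d (Suc i) (h i x))) \<oplus>\<^bsub>lp_module G p\<^esub> Q N (\<phi> (h k (d i x)))"
          using linear_map_add[OF l 1 hk[OF dx]]
            linear_map_add[OF Q linear_map_closed[OF l 1] linear_map_closed[OF l hk[OF dx]], of N] by simp
        also have "\<dots> = Q N (\<phi> (h k (d i x)))" using zero[OF linear_map_closed[OF h x]] by simp
        finally show ?thesis using x dx by (simp add: lp_coboundary_def compose_def \<theta>_def)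
      qed (simp add: \<psi>_def lp_coboundary_def compose_def)
    qed
    ultimately show ?thesis by (auto simp: lp_coboundaries_def Suc)
  qed
  have "limitin (lp_cochain_topology G p (F i)) \<psi> \<phi> sequentially"
  proof -
    \<comment> \<open>Pointwise convergence takes place in the full product. To obtain it in the
      subspace, \<open>\<psi> N\<close> has to be a cochain, which follows from its form as a
      composition of linear maps.\<close>
    have cochain: "\<psi> N \<in> carrier (lp_cochains G p (F i))" if "N > 0" for N
    proof -
      have D: "linear_map (int_group_ring G) (F i) (F i) (\<lambda>x. x \<ominus>\<^bsub>F i\<^esub> (group_element z \<odot>\<^bsub>F i\<^esub> x))"
        by (rule linear_map_one_minus_central[OF FM z(1,2)])
      have "linear_map (int_group_ring G) (F i) (lp_module G p) (\<psi> N)"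
        unfolding linear_map_def
      proof (intro conjI ballI funcsetI)
        fix x assume x: "x \<in> carrier (F i)"
        note Dx = linear_map_closed[OF D x]
        show "\<psi> N x \<in> carrier (lp_module G p)"
          unfolding \<psi>Q[OF x that] by (rule linear_map_closed[OF Q linear_map_closed[OF l Dx]])
        fix y assume y: "y \<in> carrier (F i)"
        note Dy = linear_map_closed[OF D y]
        show "\<psi> N (x \<oplus>\<^bsub>F i\<^esub> y) = \<psi> N x \<oplus>\<^bsub>lp_module G p\<^esub> \<psi> N y"
          unfolding \<psi>Q[OF x that] \<psi>Q[OF y that] \<psi>Q[OF M.M.a_closed[OF x y] that] linear_map_add[OF D x y]
            linear_map_add[OF l Dx Dy] linear_map_add[OF Q linear_map_closed[OF l Dx] linear_map_closed[OF l Dy]] ..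
      next
        fix a x assume a: "a \<in> carrier (int_group_ring G)" and x: "x \<in> carrier (F i)"
        note Dx = linear_map_closed[OF D x]
        show "\<psi> N (a \<odot>\<^bsub>F i\<^esub> x) = a \<odot>\<^bsub>lp_module G p\<^esub> \<psi> N x"
          unfolding \<psi>Q[OF x that] \<psi>Q[OF M.smult_closed[OF a x] that] linear_map_smult[OF D a x]
            linear_map_smult[OF l a Dx] linear_map_smult[OF Q a linear_map_closed[OF l Dx]] ..
      qed
      then show ?thesis by (simp add: carrier_lp_cochains \<psi>_def)
    qed
    have "limitin (product_topology (\<lambda>x. lp_topology G p) (carrier (F i))) \<psi> \<phi> sequentially"
      unfolding limitin_componentwise
    proof (intro conjI ballI \<phi>ext)
      show "\<forall>\<^sub>F N in sequentially. \<psi> N \<in> topspace (product_topology (\<lambda>x. lp_topology G p) (carrier (F i)))"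
        using p1 \<phi>c z(1) by (intro always_eventually) (auto simp: \<psi>_def lp_space_diff ergodic_average_lp_space)
      fix x assume x: "x \<in> carrier (F i)"
      show "limitin (lp_topology G p) (\<lambda>N. \<psi> N x) (\<phi> x) sequentially"
        using limitin_minus_ergodic_average[OF z(1,3) \<phi>c[OF x] p] x by (simp add: \<psi>_def)
    qed
    moreover have "\<forall>\<^sub>F N in sequentially. \<psi> N \<in> carrier (lp_cochains G p (F i))"
      using eventually_gt_at_top[of 0] by eventually_elim (rule cochain)
    ultimately show ?thesis
      unfolding lp_cochain_topology_def limitin_subtopology
      using \<open>\<phi> \<in> carrier (lp_cochains G p (F i))\<close> by simp
  qed
  moreover have "\<forall>\<^sub>F N in sequentially. \<psi> N \<in> lp_coboundaries G p F d i"
    using eventually_gt_at_top[of 0] by eventually_elim (rule cob)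
  ultimately show ?thesis by (rule limitin_imp_in_closure_of[OF _ sequentially_bot])
qed

text \<open>The closure stays inside the cocycles because these are closed and contain the
  coboundaries; density gives the other inclusion, so a group is divided by itself.\<close>

theorem trivial_reduced_lp_cohomology:
  assumes res: "projective_resolution G F d \<epsilon>" and p: "p > 1"
    and z: "z \<in> carrier G" "\<And>y. y \<in> carrier G \<Longrightarrow> z \<otimes> y = y \<otimes> z" "inj (\<lambda>k::nat. z [^] k)"
  shows "trivial_group (reduced_lp_cohomology G p F d i)"
proof -
  have p1: "p \<ge> 1" using p by simp
  note d = projective_resolution_linear_boundary[OF res]
  note FM = projective_resolution_left_module[OF res]
  note L = left_module_lp[OF p1]
  have dc: "d (Suc i) x \<in> carrier (F i)" if "x \<in> carrier (F (Suc i))" for x i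
    by (rule linear_map_closed[OF d that])
  have eq: "lp_cocycles G p F d i = {\<phi> \<in> carrier (lp_cochains G p (F i)).
      \<forall>x\<in>d (Suc i) ` carrier (F (Suc i)). \<phi> x = \<zero>\<^bsub>lp_module G p\<^esub>}"
    by (rule lp_cocycles_eq) (rule dc)
  have sub: "subgroup (lp_cocycles G p F d i) (lp_cochains G p (F i))"
    unfolding eq unfolding lp_cochains_def using dc by (intro subgroup_kernel_precompose FM L) auto
  have "lp_coboundaries G p F d i \<subseteq> lp_cocycles G p F d i"
  proof (cases i)
    case 0
    then show ?thesis using subgroup.one_closed[OF sub] by (simp add: lp_coboundaries_def)
  next
    case (Suc k)
    interpret K: left_module "int_group_ring G" "F k" by (rule FM)
    interpret N: left_module "int_group_ring G" "lp_module G p" by (rule L)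
    have "lp_coboundary F d i \<theta> \<in> lp_cocycles G p F d i" if "\<theta> \<in> carrier (lp_cochains G p (F k))" for \<theta>
    proof -
      interpret M: left_module "int_group_ring G" "F i" by (rule FM)
      have t: "linear_map (int_group_ring G) (F k) (lp_module G p) \<theta>" using that by (simp add: carrier_lp_cochains)
      have di: "linear_map (int_group_ring G) (F i) (F k) (d i)" using d[of k] by (simp add: Suc)
      have "linear_map (int_group_ring G) (F i) (lp_module G p) (lp_coboundary F d i \<theta>)"
        unfolding linear_map_def lp_coboundary_def
        using linear_map_closed[OF di] linear_map_closed[OF t] linear_map_add[OF di] linear_map_add[OF t]
          linear_map_smult[OF di] linear_map_smult[OF t]
        by (auto simp: compose_def)
      moreover have "lp_coboundary F d i \<theta> \<in> extensional (carrier (F i))" by (simp add: lp_coboundary_def)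
      moreover have "lp_coboundary F d i \<theta> (d (Suc i) x) = \<zero>\<^bsub>lp_module G p\<^esub>" if x: "x \<in> carrier (F (Suc i))" for x
        using projective_resolution_boundary_boundary[OF res, of x k] x dc[OF x]
          linear_map_zero[OF t N.M.abelian_group_axioms]
        by (simp add: lp_coboundary_def compose_def Suc)
      ultimately show ?thesis by (auto simp: eq carrier_lp_cochains)
    qed
    then show ?thesis by (auto simp: lp_coboundaries_def Suc)
  qed
  then have "lp_cochain_topology G p (F i) closure_of lp_coboundaries G p F d i \<subseteq> lp_cocycles G p F d i"
    by (rule closure_of_minimal) (rule closedin_lp_cocycles[OF _ p1], rule dc)
  then have "lp_cochain_topology G p (F i) closure_of lp_coboundaries G p F d i = lp_cocycles G p F d i"
    using lp_cocycle_in_closure_of_coboundaries[OF res p z] by blast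
  then show ?thesis
    using trivial_group_Mod_self[OF _ sub] group_Hom_group[OF FM L, of i]
    by (simp add: reduced_lp_cohomology_def lp_cochains_def)
qed

end

section \<open>Reduced homology\<close>

context group begin

section \<open>Chains as finite sums and their topology\<close>

lemma lp_chain_sum_eq:
  assumes M: "left_module (int_group_ring G) M" and p: "p \<ge> 1"
    and xs: "set xs \<subseteq> carrier M" and f: "\<And>j. j < length xs \<Longrightarrow> f j \<in> lp_space G p"
  shows "lp_chain_sum G p M xs f =
    tensor_class (int_group_ring G) (to_right_module G M) (lp_module G p) (\<Sum>j<length xs. frag_of (xs ! j, f j))"
proof -
  interpret T: tensor_pair "int_group_ring G" "to_right_module G M" "lp_module G p"
    by (rule tensor_pair_lp[OF p M])
  show ?thesis
    unfolding lp_chain_sum_def lp_chains_def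
    by (intro T.finprod_tensor_class T.FA_frag_of) (use xs f nth_mem in auto)
qed

text \<open>A list of elementary tensors is split into its left entries, which stay fixed, and the
  tuple of its right entries, a point of a finite power of l^p(G) in which limits can be
  taken.\<close>

lemma lp_chain_exhaust:
  assumes M: "left_module (int_group_ring G) M" and p: "p \<ge> 1" and c: "c \<in> carrier (lp_chains G p M)"
  obtains xs f where "set xs \<subseteq> carrier M" "f \<in> {..<length xs} \<rightarrow>\<^sub>E lp_space G p" "c = lp_chain_sum G p M xs f"
proof -
  interpret T: tensor_pair "int_group_ring G" "to_right_module G M" "lp_module G p"
    by (rule tensor_pair_lp[OF p M])
  obtain ps where ps: "set ps \<subseteq> carrier M \<times> lp_space G p" "c = T.tc (\<Sum>q\<leftarrow>ps. frag_of q)"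
    using T.tensor_product_elementary_sum[of c] c by (auto simp: lp_chains_def)
  define xs f where "xs = map fst ps" and "f = (\<lambda>j\<in>{..<length ps}. snd (ps ! j))"
  have mem: "ps ! j \<in> carrier M \<times> lp_space G p" if "j < length ps" for j using ps(1) that nth_mem by blast
  have xs: "set xs \<subseteq> carrier M" using ps(1) by (auto simp: xs_def)
  have f: "f \<in> {..<length xs} \<rightarrow>\<^sub>E lp_space G p" using mem by (auto simp: f_def xs_def mem_Times_iff)
  have "(\<Sum>q\<leftarrow>ps. frag_of q) = (\<Sum>j<length xs. frag_of (xs ! j, f j))"
    by (simp add: sum_list_sum_nth xs_def f_def atLeast0LessThan)
  then have "c = lp_chain_sum G p M xs f"
    using ps(2) lp_chain_sum_eq[OF M p xs, of f] f by (auto simp: PiE_mem)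
  with xs f show ?thesis by (rule that)
qed

lemma lp_chain_sum_closed:
  assumes M: "left_module (int_group_ring G) M" and p: "p \<ge> 1"
    and xs: "set xs \<subseteq> carrier M" and f: "\<And>j. j < length xs \<Longrightarrow> f j \<in> lp_space G p"
  shows "lp_chain_sum G p M xs f \<in> carrier (lp_chains G p M)"
proof -
  interpret T: tensor_pair "int_group_ring G" "to_right_module G M" "lp_module G p"
    by (rule tensor_pair_lp[OF p M])
  have "lp_chain_sum G p M xs f = T.tc (\<Sum>j<length xs. frag_of (xs ! j, f j))"
    by (rule lp_chain_sum_eq[OF M p xs]) (rule f)
  moreover have "(\<Sum>j<length xs. frag_of (xs ! j, f j)) \<in> carrier T.FA"
    by (intro T.FA_sum T.FA_frag_of) (use xs f nth_mem in auto)
  ultimately show ?thesis unfolding lp_chains_def by (simp only: T.tensor_class_closed)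
qed

lemma topspace_lp_chain_topology:
  assumes M: "left_module (int_group_ring G) M" and p: "p \<ge> 1"
  shows "topspace (lp_chain_topology G p M) = carrier (lp_chains G p M)"
proof
  show "topspace (lp_chain_topology G p M) \<subseteq> carrier (lp_chains G p M)"
    using openin_topspace[of "lp_chain_topology G p M"] by (simp only: openin_lp_chain_topology lp_chain_open_def)
  have "{f \<in> {..<length xs} \<rightarrow>\<^sub>E lp_space G p. lp_chain_sum G p M xs f \<in> carrier (lp_chains G p M)} =
      topspace (product_topology (\<lambda>j. lp_topology G p) {..<length xs})" if "set xs \<subseteq> carrier M" for xs
    using lp_chain_sum_closed[OF M p that] p by (auto simp: PiE_mem)
  then have "openin (lp_chain_topology G p M) (carrier (lp_chains G p M))"
    unfolding openin_lp_chain_topology lp_chain_open_def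
    by (intro conjI subset_refl allI impI) (simp only: openin_topspace)
  then show "carrier (lp_chains G p M) \<subseteq> topspace (lp_chain_topology G p M)" by (rule openin_subset)
qed

text \<open>The topology is final with respect to the chain sums, so closed sets are tested by
  preimages just as open ones.\<close>

lemma closedin_lp_chain_topology:
  assumes M: "left_module (int_group_ring G) M" and p: "p \<ge> 1" and C: "C \<subseteq> carrier (lp_chains G p M)"
    and cl: "\<And>xs. set xs \<subseteq> carrier M \<Longrightarrow> closedin (product_topology (\<lambda>j. lp_topology G p) {..<length xs})
      {f \<in> {..<length xs} \<rightarrow>\<^sub>E lp_space G p. lp_chain_sum G p M xs f \<in> C}"
  shows "closedin (lp_chain_topology G p M) C"
  unfolding closedin_def topspace_lp_chain_topology[OF M p] openin_lp_chain_topology lp_chain_open_def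
proof (intro conjI C allI impI)
  fix xs assume xs: "set xs \<subseteq> carrier M"
  have "{f \<in> {..<length xs} \<rightarrow>\<^sub>E lp_space G p. lp_chain_sum G p M xs f \<in> carrier (lp_chains G p M) - C}
    = topspace (product_topology (\<lambda>j. lp_topology G p) {..<length xs}) -
      {f \<in> {..<length xs} \<rightarrow>\<^sub>E lp_space G p. lp_chain_sum G p M xs f \<in> C}"
    using lp_chain_sum_closed[OF M p xs] p by (auto simp: PiE_mem)
  then show "openin (product_topology (\<lambda>j. lp_topology G p) {..<length xs})
      {f \<in> {..<length xs} \<rightarrow>\<^sub>E lp_space G p. lp_chain_sum G p M xs f \<in> carrier (lp_chains G p M) - C}"
    using openin_diff[OF openin_topspace cl[OF xs]] by simp
qed blast

text \<open>On a projective module the coordinate functions of a dual basis separate chains.\<close>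

lemma lp_chain_sum_eq_one_iff:
  assumes M: "left_module (int_group_ring G) M" and db: "dual_basis (int_group_ring G) M B s r" and p: "p \<ge> 1"
    and xs: "set xs \<subseteq> carrier M" and f: "\<And>j. j < length xs \<Longrightarrow> f j \<in> lp_space G p"
  shows "lp_chain_sum G p M xs f = \<one>\<^bsub>lp_chains G p M\<^esub> \<longleftrightarrow>
    (\<forall>b\<in>B. \<forall>g. (\<Sum>j<length xs. group_convolution G (group_ring_involution G (s (xs ! j) b)) (f j) g) = 0)"
    (is "_ \<longleftrightarrow> (\<forall>b\<in>B. \<forall>g. ?\<theta> b g = 0)")
proof -
  let ?R = "int_group_ring G"
  interpret M: left_module ?R M by (rule M)
  interpret T: tensor_pair ?R "to_right_module G M" "lp_module G p"
    by (rule tensor_pair_lp[OF p M])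
  note D = dual_basisD[OF db]
  let ?u = "\<Sum>j<length xs. frag_of (xs ! j, f j)"
  have xsj: "xs ! j \<in> carrier M" if "j < length xs" for j using xs that nth_mem by blast
  have "lp_chain_sum G p M xs f = \<one>\<^bsub>lp_chains G p M\<^esub> \<longleftrightarrow> T.tc ?u = T.tc 0"
    using lp_chain_sum_eq[OF M p xs, of f] f by (simp add: lp_chains_def T.tensor_product_one)
  also have "\<dots> \<longleftrightarrow> (\<forall>b\<in>B. \<forall>g. ?\<theta> b g = 0)"
  proof (intro iffI ballI allI)
    fix b g assume eq: "T.tc ?u = T.tc 0" and b: "b \<in> B"
    \<comment> \<open>The coordinate at \<open>b\<close>, evaluated at \<open>g\<close>: the
      involution lets \<open>s x b\<close> act on the second factor. Since the involution reverses
      products, this function is balanced.\<close>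
    let ?\<beta> = "\<lambda>(x, h). group_convolution G (group_ring_involution G (s x b)) h g"
    have "frag_sum ?\<beta> ?u = frag_sum ?\<beta> 0"
    proof (rule T.frag_sum_balanced[OF _ _ _ eq])
      fix x x' h assume "x \<in> carrier (to_right_module G M)" "x' \<in> carrier (to_right_module G M)"
      then have x: "x \<in> carrier M" "x' \<in> carrier M" by auto
      have "group_ring_involution G (s (x \<oplus>\<^bsub>M\<^esub> x') b) =
          (\<lambda>g. group_ring_involution G (s x b) g + group_ring_involution G (s x' b) g)"
        unfolding D(5)[OF x] by (auto simp: group_ring_involution_def int_group_ring_def)
      then show "?\<beta> (x \<oplus>\<^bsub>to_right_module G M\<^esub> x', h) = ?\<beta> (x, h) + ?\<beta> (x', h)"
        using group_convolution_add_left[of "group_ring_involution G (s x b)" "group_ring_involution G (s x' b)" h]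
          x b D(4) by simp
    next
      fix x h h'
      show "?\<beta> (x, h \<oplus>\<^bsub>lp_module G p\<^esub> h') = ?\<beta> (x, h) + ?\<beta> (x, h')"
        by (simp add: group_convolution_add_right)
    next
      fix a x h assume a: "a \<in> carrier ?R" and "x \<in> carrier (to_right_module G M)"
      then have x: "x \<in> carrier M" by simp
      have "s (group_ring_involution G a \<odot>\<^bsub>M\<^esub> x) b = group_convolution G (group_ring_involution G a) (s x b)"
        using D(6)[OF group_ring_involution_closed[OF a] x, of b] by (simp add: int_group_ring_def)
      then have "group_ring_involution G (s (group_ring_involution G a \<odot>\<^bsub>M\<^esub> x) b) =
          group_convolution G (group_ring_involution G (s x b)) a"
        using a D(4)[OF x b] by (simp add: group_ring_involution_mult group_ring_involution_involution)
      then show "?\<beta> (a \<odot>\<^bsub>to_right_module G M\<^esub> x, h) = ?\<beta> (x, a \<odot>\<^bsub>lp_module G p\<^esub> h)"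
        using group_convolution_assoc[of "group_ring_involution G (s x b)" a h] a D(4)[OF x b] by simp
    qed
    then show "?\<theta> b g = 0" by (simp add: frag_sum_sum)
  next
    assume \<theta>: "\<forall>b\<in>B. \<forall>g. ?\<theta> b g = 0"
    \<comment> \<open>With the finitely many basis elements that occur,
      \<open>x_j \<otimes> f_j\<close> is expanded as the sum of the
      \<open>r b \<otimes> k j b\<close>. Summing over \<open>j\<close> first collects the vanishing
      coordinate at \<open>b\<close> in the second factor.\<close>
    define A where "A = (\<Union>j<length xs. {b. s (xs ! j) b \<noteq> \<zero>\<^bsub>?R\<^esub>})"
    have A: "finite A" "A \<subseteq> B" using D(2,3) xsj by (auto simp: A_def)
    define k where "k j b = group_convolution G (group_ring_involution G (s (xs ! j) b)) (f j)" for j b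
    have k: "k j b \<in> lp_space G p" if "j < length xs" "b \<in> A" for j b
      unfolding k_def using that A D(4) xsj f p by (intro group_convolution_lp_space) auto
    have rA: "r b \<in> carrier M" if "b \<in> A" for b using that A D(1) by blast
    have 1: "T.tc (frag_of (xs ! j, f j)) = T.tc (\<Sum>b\<in>A. frag_of (r b, k j b))" if j: "j < length xs" for j
    proof -
      have sR: "s (xs ! j) b \<in> carrier ?R" if "b \<in> A" for b using that A D(4) xsj[OF j] by blast
      have "xs ! j = (\<Oplus>\<^bsub>M\<^esub>b\<in>A. s (xs ! j) b \<odot>\<^bsub>M\<^esub> r b)"
        using M.finsum_smult_superset[OF A(1), of "s (xs ! j)" r] sR rA D(7)[OF xsj[OF j]] j by (force simp: A_def)
      then have "T.tc (frag_of (xs ! j, f j)) = T.tc (frag_of (\<Oplus>\<^bsub>to_right_module G M\<^esub>b\<in>A. s (xs ! j) b \<odot>\<^bsub>M\<^esub> r b, f j))"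
        by simp
      also have "\<dots> = T.tc (\<Sum>b\<in>A. frag_of (s (xs ! j) b \<odot>\<^bsub>M\<^esub> r b, f j))"
        by (rule T.tensor_class_finsum_left) (use A sR rA f j in auto)
      also have "\<dots> = T.tc (\<Sum>b\<in>A. frag_of (r b, k j b))"
      proof (rule T.tensor_class_sum_cong)
        fix b assume b: "b \<in> A"
        show "T.tc (frag_of (s (xs ! j) b \<odot>\<^bsub>M\<^esub> r b, f j)) = T.tc (frag_of (r b, k j b))"
          using T.tensor_class_smult[of "group_ring_involution G (s (xs ! j) b)" "r b" "f j"] sR[OF b] rA[OF b] f[OF j]
          by (simp add: k_def group_ring_involution_involution)
      qed
      finally show ?thesis .
    qed
    have "T.tc ?u = T.tc (\<Sum>j<length xs. \<Sum>b\<in>A. frag_of (r b, k j b))"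
      by (rule T.tensor_class_sum_cong) (use 1 in auto)
    also have "\<dots> = T.tc (\<Sum>b\<in>A. \<Sum>j<length xs. frag_of (r b, k j b))" by (subst sum.swap) simp
    also have "\<dots> = T.tc (\<Sum>b\<in>A. 0)"
    proof (rule T.tensor_class_sum_cong)
      fix b assume b: "b \<in> A"
      have "(\<Oplus>\<^bsub>lp_module G p\<^esub>j\<in>{..<length xs}. k j b) = (\<lambda>g. ?\<theta> b g)"
        using finsum_lp_module[OF p, of "{..<length xs}" "\<lambda>j. k j b"] k b by (simp add: k_def)
      also have "\<dots> = \<zero>\<^bsub>lp_module G p\<^esub>" using \<theta> b A by auto
      finally have 0: "(\<Oplus>\<^bsub>lp_module G p\<^esub>j\<in>{..<length xs}. k j b) = \<zero>\<^bsub>lp_module G p\<^esub>" .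
      have "T.tc (\<Sum>j<length xs. frag_of (r b, k j b)) = T.tc (frag_of (r b, \<Oplus>\<^bsub>lp_module G p\<^esub>j\<in>{..<length xs}. k j b))"
        by (rule T.tensor_class_finsum_right[symmetric]) (use k b rA in auto)
      then show "T.tc (\<Sum>j<length xs. frag_of (r b, k j b)) = T.tc 0"
        unfolding 0 using T.tensor_class_zero_right[of "r b"] rA[OF b] by simp
    qed
    finally show "T.tc ?u = T.tc 0" by simp
  qed
  finally show ?thesis .
qed

text \<open>The finite support of \<open>a\<close> leaves a finite combination of point
  evaluations.\<close>

lemma continuous_map_lp_group_convolution:
  assumes a: "a \<in> carrier (int_group_ring G)" and p: "p \<ge> 1"
  shows "continuous_map (lp_topology G p) euclidean (\<lambda>f. group_convolution G a f g)"
proof -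
  have cmult: "continuous_map Y euclidean (\<lambda>x. c * h x)" if "continuous_map Y euclidean h"
    for Y :: "('a \<Rightarrow> complex) topology" and c :: complex and h
    using that by (simp add: continuous_map_atin tendsto_mult)
  have fin: "finite {x \<in> carrier G. a x \<noteq> 0}" using a by (auto simp: int_group_ring_def)
  have "continuous_map (lp_topology G p) euclidean
      (\<lambda>f. \<Sum>x\<in>{x \<in> carrier G. a x \<noteq> 0}. of_int (a x) * translate G x f g)"
    unfolding translate_def
    by (intro continuous_map_sum fin cmult) (use continuous_map_lp_eval[OF p] in auto)
  then show ?thesis by (simp add: group_convolution_eq_sum_translate[OF a])
qed

text \<open>Since the coordinates of a dual basis separate chains, the condition is the vanishing of
  numbers that depend continuously on the coefficient tuple.\<close>

lemma closedin_lp_chain_sum_eq_one: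
  fixes M :: "('a \<Rightarrow> int, 'm) module"
  assumes P: "projective_module (int_group_ring G) M" and p: "p \<ge> 1" and xs: "set xs \<subseteq> carrier M"
  shows "closedin (product_topology (\<lambda>j. lp_topology G p) {..<length xs})
    {f \<in> {..<length xs} \<rightarrow>\<^sub>E lp_space G p. lp_chain_sum G p M xs f = \<one>\<^bsub>lp_chains G p M\<^esub>}"
proof -
  have M: "left_module (int_group_ring G) M" using P by (simp add: projective_module_def)
  obtain B :: "'m set" and s r where db: "dual_basis (int_group_ring G) M B s r"
    using projective_module_dual_basis[OF P] by blast
  let ?Y = "product_topology (\<lambda>j. lp_topology G p) {..<length xs}"
  let ?\<theta> = "\<lambda>b g f. \<Sum>j<length xs. group_convolution G (group_ring_involution G (s (xs ! j) b)) (f j) g"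
  have top: "topspace ?Y = {..<length xs} \<rightarrow>\<^sub>E lp_space G p" using p by simp
  have c: "closedin ?Y {f \<in> topspace ?Y. ?\<theta> b g f \<in> {0}}" if b: "b \<in> B" for b g
  proof (rule closedin_continuous_map_preimage)
    show "continuous_map ?Y euclidean (?\<theta> b g)"
    proof (intro continuous_map_sum)
      fix j assume j: "j \<in> {..<length xs}"
      then have "s (xs ! j) b \<in> carrier (int_group_ring G)" using xs b dual_basisD(4)[OF db] nth_mem by blast
      then show "continuous_map ?Y euclidean (\<lambda>f. group_convolution G (group_ring_involution G (s (xs ! j) b)) (f j) g)"
        using continuous_map_compose[OF continuous_map_product_projection[OF j, of "\<lambda>j. lp_topology G p"]
            continuous_map_lp_group_convolution[OF group_ring_involution_closed p]]
        by (simp add: o_def)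
    qed simp
  qed simp
  have "{f \<in> {..<length xs} \<rightarrow>\<^sub>E lp_space G p. lp_chain_sum G p M xs f = \<one>\<^bsub>lp_chains G p M\<^esub>}
      = {f \<in> {..<length xs} \<rightarrow>\<^sub>E lp_space G p. \<forall>b\<in>B. \<forall>g. ?\<theta> b g f = 0}"
    by (intro Collect_cong conj_cong refl lp_chain_sum_eq_one_iff[OF M db p xs]) auto
  also have "\<dots> = topspace ?Y \<inter> (\<Inter>b\<in>B. \<Inter>g. {f \<in> topspace ?Y. ?\<theta> b g f \<in> {0}})"
    unfolding top by blast
  also have "closedin ?Y \<dots>"
  proof (cases "B = {}")
    case False
    then show ?thesis by (intro closedin_Int closedin_topspace closedin_INT) (use c in auto)
  qed (use closedin_topspace[of ?Y] in simp)
  finally show ?thesis .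
qed

section \<open>The boundary map, cycles and boundaries\<close>

lemma lp_boundary_class:
  assumes res: "projective_resolution G F d \<epsilon>" and p: "p \<ge> 1"
  shows "lp_boundary G p F d (Suc k) (tensor_class (int_group_ring G) (to_right_module G (F (Suc k))) (lp_module G p) u) =
    tensor_class (int_group_ring G) (to_right_module G (F k)) (lp_module G p)
      (frag_extend (\<lambda>(x, y). frag_of (d (Suc k) x, y)) u)"
proof -
  have "linear_map (int_group_ring G) (to_right_module G (F (Suc k))) (to_right_module G (F k)) (d (Suc k))"
    by (rule linear_map_to_right_module[OF projective_resolution_linear_boundary[OF res]])
  then show ?thesis
    using tensor_map_class[OF tensor_pair_lp[OF p projective_resolution_left_module[OF res, of "Suc k"]]
        tensor_pair_lp[OF p projective_resolution_left_module[OF res, of k]]]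
    by (simp add: lp_boundary_def)
qed

lemma lp_boundary_chain_sum:
  assumes res: "projective_resolution G F d \<epsilon>" and p: "p \<ge> 1"
    and xs: "set xs \<subseteq> carrier (F (Suc k))" and f: "\<And>j. j < length xs \<Longrightarrow> f j \<in> lp_space G p"
  shows "lp_boundary G p F d (Suc k) (lp_chain_sum G p (F (Suc k)) xs f) =
    lp_chain_sum G p (F k) (map (d (Suc k)) xs) f"
proof -
  note FM = projective_resolution_left_module[OF res]
  have dxs: "set (map (d (Suc k)) xs) \<subseteq> carrier (F k)"
    using xs linear_map_closed[OF projective_resolution_linear_boundary[OF res]] by auto
  have "lp_chain_sum G p (F (Suc k)) xs f =
      tensor_class (int_group_ring G) (to_right_module G (F (Suc k))) (lp_module G p) (\<Sum>j<length xs. frag_of (xs ! j, f j))"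
    by (rule lp_chain_sum_eq[OF FM p xs]) (rule f)
  moreover have "lp_chain_sum G p (F k) (map (d (Suc k)) xs) f =
      tensor_class (int_group_ring G) (to_right_module G (F k)) (lp_module G p)
        (\<Sum>j<length xs. frag_of (d (Suc k) (xs ! j), f j))"
    using lp_chain_sum_eq[OF FM p dxs, of f] f by simp
  ultimately show ?thesis
    by (simp add: lp_boundary_class[OF res p] frag_extend_sum o_def)
qed

lemma group_hom_lp_boundary:
  assumes res: "projective_resolution G F d \<epsilon>" and p: "p \<ge> 1"
  shows "group_hom (lp_chains G p (F (Suc k))) (lp_chains G p (F k)) (lp_boundary G p F d (Suc k))"
proof -
  let ?R = "int_group_ring G"
  note FM = projective_resolution_left_module[OF res]
  interpret A: tensor_pair ?R "to_right_module G (F (Suc k))" "lp_module G p" by (rule tensor_pair_lp[OF p FM])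
  interpret B: tensor_pair ?R "to_right_module G (F k)" "lp_module G p" by (rule tensor_pair_lp[OF p FM])
  interpret GA: comm_group A.T by (rule A.comm_group_tensor_product)
  interpret GB: comm_group B.T by (rule B.comm_group_tensor_product)
  let ?f = "frag_extend (\<lambda>(x, y). frag_of (d (Suc k) x, y))"
  have f: "?f u \<in> carrier B.FA" if u: "u \<in> carrier A.FA" for u
  proof -
    have "Poly_Mapping.keys (?f u) \<subseteq> (\<Union>q\<in>Poly_Mapping.keys u. Poly_Mapping.keys (case q of (x, y) \<Rightarrow> frag_of (d (Suc k) x, y)))"
      by (rule keys_frag_extend)
    also have "\<dots> \<subseteq> carrier (to_right_module G (F k)) \<times> carrier (lp_module G p)"
    proof (rule UN_least)
      fix q assume "q \<in> Poly_Mapping.keys u"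
      then obtain x y where q: "q = (x, y)" "x \<in> carrier (F (Suc k))" "y \<in> lp_space G p"
        using u unfolding A.FA_iff by auto
      then show "Poly_Mapping.keys (case q of (x, y) \<Rightarrow> frag_of (d (Suc k) x, y))
          \<subseteq> carrier (to_right_module G (F k)) \<times> carrier (lp_module G p)"
        using linear_map_closed[OF projective_resolution_linear_boundary[OF res] q(2)] by simp
    qed
    finally show ?thesis by (simp only: B.FA_iff)
  qed
  have "lp_boundary G p F d (Suc k) \<in> hom A.T B.T"
  proof (rule homI)
    fix c assume "c \<in> carrier A.T"
    then obtain u where u: "u \<in> carrier A.FA" "c = A.tc u" unfolding A.carrier_tensor_product by blast
    show "lp_boundary G p F d (Suc k) c \<in> carrier B.T"
      unfolding u(2) lp_boundary_class[OF res p] by (rule B.tensor_class_closed[OF f[OF u(1)]])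
    fix c' assume "c' \<in> carrier A.T"
    then obtain v where v: "v \<in> carrier A.FA" "c' = A.tc v" unfolding A.carrier_tensor_product by blast
    show "lp_boundary G p F d (Suc k) (c \<otimes>\<^bsub>A.T\<^esub> c') =
        lp_boundary G p F d (Suc k) c \<otimes>\<^bsub>B.T\<^esub> lp_boundary G p F d (Suc k) c'"
      unfolding u(2) v(2) A.tensor_product_mult[OF u(1) v(1)] lp_boundary_class[OF res p]
        B.tensor_product_mult[OF f[OF u(1)] f[OF v(1)]] frag_extend_add ..
  qed
  then show ?thesis
    unfolding lp_chains_def
    by (intro group_hom.intro group_hom_axioms.intro GA.group_axioms GB.group_axioms)
qed

lemma subgroup_lp_cycles:
  assumes res: "projective_resolution G F d \<epsilon>" and p: "p \<ge> 1"
  shows "subgroup (lp_cycles G p F d i) (lp_chains G p (F i))"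
proof (cases i)
  case 0
  interpret B: tensor_pair "int_group_ring G" "to_right_module G (F i)" "lp_module G p"
    by (rule tensor_pair_lp[OF p projective_resolution_left_module[OF res]])
  interpret GB: comm_group B.T by (rule B.comm_group_tensor_product)
  show ?thesis using GB.subgroup_self by (simp add: lp_cycles_def 0 lp_chains_def)
next
  case (Suc k)
  then show ?thesis
    using group_hom.subgroup_kernel[OF group_hom_lp_boundary[OF res p, of k]] by (simp add: lp_cycles_def)
qed

lemma lp_chain_sum_in_cycles_iff:
  assumes res: "projective_resolution G F d \<epsilon>" and p: "p \<ge> 1"
    and xs: "set xs \<subseteq> carrier (F (Suc k))" and f: "\<And>j. j < length xs \<Longrightarrow> f j \<in> lp_space G p"
  shows "lp_chain_sum G p (F (Suc k)) xs f \<in> lp_cycles G p F d (Suc k) \<longleftrightarrow>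
    lp_chain_sum G p (F k) (map (d (Suc k)) xs) f = \<one>\<^bsub>lp_chains G p (F k)\<^esub>"
proof -
  have "lp_chain_sum G p (F (Suc k)) xs f \<in> carrier (lp_chains G p (F (Suc k)))"
    by (rule lp_chain_sum_closed[OF projective_resolution_left_module[OF res] p xs]) (rule f)
  then show ?thesis
    using lp_boundary_chain_sum[OF res p xs, of f] f by (simp add: lp_cycles_def kernel_def)
qed

text \<open>In positive degree, being a cycle along a tuple \<open>xs\<close> means that the chain
  sum along the tuple of boundaries is trivial one degree lower, and there the coordinates of a dual
  basis apply.\<close>

lemma closedin_lp_cycles:
  assumes res: "projective_resolution G F d \<epsilon>" and p: "p \<ge> 1"
  shows "closedin (lp_chain_topology G p (F i)) (lp_cycles G p F d i)"
proof (cases i)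
  case 0
  then show ?thesis
    using closedin_topspace[of "lp_chain_topology G p (F i)"]
    by (simp add: lp_cycles_def topspace_lp_chain_topology[OF projective_resolution_left_module[OF res] p])
next
  case (Suc k)
  note FM = projective_resolution_left_module[OF res]
  have proj: "projective_module (int_group_ring G) (F k)" using res by (simp add: projective_resolution_def)
  show ?thesis unfolding Suc
  proof (rule closedin_lp_chain_topology[OF FM p])
    show "lp_cycles G p F d (Suc k) \<subseteq> carrier (lp_chains G p (F (Suc k)))"
      using subgroup.subset[OF subgroup_lp_cycles[OF res p]] .
    fix xs assume xs: "set xs \<subseteq> carrier (F (Suc k))"
    then have "set (map (d (Suc k)) xs) \<subseteq> carrier (F k)"
      using linear_map_closed[OF projective_resolution_linear_boundary[OF res]] by auto
    from closedin_lp_chain_sum_eq_one[OF proj p this]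
    have "closedin (product_topology (\<lambda>j. lp_topology G p) {..<length xs})
      {f \<in> {..<length xs} \<rightarrow>\<^sub>E lp_space G p. lp_chain_sum G p (F k) (map (d (Suc k)) xs) f = \<one>\<^bsub>lp_chains G p (F k)\<^esub>}"
      by simp
    moreover have "lp_chain_sum G p (F (Suc k)) xs f \<in> lp_cycles G p F d (Suc k) \<longleftrightarrow>
        lp_chain_sum G p (F k) (map (d (Suc k)) xs) f = \<one>\<^bsub>lp_chains G p (F k)\<^esub>"
      if "f \<in> {..<length xs} \<rightarrow>\<^sub>E lp_space G p" for f
      by (rule lp_chain_sum_in_cycles_iff[OF res p xs]) (use that in auto)
    ultimately show "closedin (product_topology (\<lambda>j. lp_topology G p) {..<length xs})
      {f \<in> {..<length xs} \<rightarrow>\<^sub>E lp_space G p. lp_chain_sum G p (F (Suc k)) xs f \<in> lp_cycles G p F d (Suc k)}"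
      by (simp cong: conj_cong)
  qed
qed

lemma lp_boundaries_subset_cycles:
  assumes res: "projective_resolution G F d \<epsilon>" and p: "p \<ge> 1"
  shows "lp_boundary G p F d (Suc i) ` carrier (lp_chains G p (F (Suc i))) \<subseteq> lp_cycles G p F d i"
proof (rule image_subsetI)
  fix c assume c: "c \<in> carrier (lp_chains G p (F (Suc i)))"
  note FM = projective_resolution_left_module[OF res]
  show "lp_boundary G p F d (Suc i) c \<in> lp_cycles G p F d i"
  proof (cases i)
    case 0
    interpret group_hom "lp_chains G p (F (Suc i))" "lp_chains G p (F i)" "lp_boundary G p F d (Suc i)"
      by (rule group_hom_lp_boundary[OF res p])
    show ?thesis using hom_closed[OF c] by (simp add: lp_cycles_def 0)
  next
    case (Suc k)
    interpret T: tensor_pair "int_group_ring G" "to_right_module G (F k)" "lp_module G p"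
      by (rule tensor_pair_lp[OF p FM])
    obtain xs f where xs: "set xs \<subseteq> carrier (F (Suc i))" and f: "f \<in> {..<length xs} \<rightarrow>\<^sub>E lp_space G p"
      and c: "c = lp_chain_sum G p (F (Suc i)) xs f"
      using lp_chain_exhaust[OF FM p c] by blast
    have fj: "f j \<in> lp_space G p" if "j < length xs" for j using f that by auto
    have dxs: "set (map (d (Suc i)) xs) \<subseteq> carrier (F (Suc k))"
      using xs linear_map_closed[OF projective_resolution_linear_boundary[OF res]] by (auto simp: Suc)
    then have ddxs: "set (map (d (Suc k)) (map (d (Suc i)) xs)) \<subseteq> carrier (F k)"
      using linear_map_closed[OF projective_resolution_linear_boundary[OF res]] by auto
    have "lp_chain_sum G p (F k) (map (d (Suc k)) (map (d (Suc i)) xs)) f =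
        T.tc (\<Sum>j<length xs. frag_of (map (d (Suc k)) (map (d (Suc i)) xs) ! j, f j))"
      using lp_chain_sum_eq[OF FM p ddxs, of f] fj by simp
    also have "\<dots> = T.tc (\<Sum>j<length xs. 0)"
    proof (rule T.tensor_class_sum_cong)
      fix j assume j: "j \<in> {..<length xs}"
      then have "map (d (Suc k)) (map (d (Suc i)) xs) ! j = \<zero>\<^bsub>F k\<^esub>"
        using xs nth_mem projective_resolution_boundary_boundary[OF res, of "xs ! j" k] by (auto simp: Suc)
      then show "T.tc (frag_of (map (d (Suc k)) (map (d (Suc i)) xs) ! j, f j)) = T.tc 0"
        using T.tensor_class_zero_left[of "f j"] fj j by simp
    qed
    finally have "lp_chain_sum G p (F k) (map (d (Suc k)) (map (d (Suc i)) xs)) f = \<one>\<^bsub>lp_chains G p (F k)\<^esub>"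
      by (simp add: T.tensor_product_one lp_chains_def)
    then have "lp_chain_sum G p (F (Suc k)) (map (d (Suc i)) xs) f \<in> lp_cycles G p F d (Suc k)"
      using lp_chain_sum_in_cycles_iff[OF res p dxs, of f] fj by simp
    moreover have "lp_boundary G p F d (Suc i) c = lp_chain_sum G p (F i) (map (d (Suc i)) xs) f"
      unfolding c by (rule lp_boundary_chain_sum[OF res p xs]) (rule fj)
    ultimately show ?thesis by (simp add: Suc)
  qed
qed

text \<open>Only the coefficients change while \<open>xs\<close> stays fixed. With
  \<open>f' j\<close> written as \<open>1 - T\<close> applied to \<open>Q (f j)\<close>, the factor
  \<open>1 - T\<close> moves across the tensor sign to become \<open>D\<close> on
  \<open>xs ! j\<close>, and the homotopy splits \<open>D\<close> into \<open>d h + h d\<close>. The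
  part with \<open>d h\<close> is a boundary, and the part with \<open>h d\<close> vanishes because
  the chain is a cycle.\<close>

lemma lp_chain_sum_minus_average_in_boundaries:
  assumes res: "projective_resolution G F d \<epsilon>" and p: "p \<ge> 1"
    and z: "z \<in> carrier G" "\<And>y. y \<in> carrier G \<Longrightarrow> z \<otimes> y = y \<otimes> z"
    and xs: "set xs \<subseteq> carrier (F i)" and f: "\<And>j. j < length xs \<Longrightarrow> f j \<in> lp_space G p"
    and cyc: "lp_chain_sum G p (F i) xs f \<in> lp_cycles G p F d i" and N: "N > 0"
    and f': "\<And>j. j < length xs \<Longrightarrow> f' j = (\<lambda>g. f j g - ergodic_average z N (f j) g)"
  shows "lp_chain_sum G p (F i) xs f' \<in> lp_boundary G p F d (Suc i) ` carrier (lp_chains G p (F (Suc i)))"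
proof -
  let ?R = "int_group_ring G"
  note FM = projective_resolution_left_module[OF res]
  note d = projective_resolution_linear_boundary[OF res]
  \<comment> \<open>Translation by \<open>z\<close> in the second factor corresponds to the right
    action of \<open>z\<close> on the first, that is, to left multiplication by
    \<open>inv z\<close>; so the homotopy is taken for the inverse.\<close>
  have w: "inv z \<in> carrier G" "\<And>y. y \<in> carrier G \<Longrightarrow> inv z \<otimes> y = y \<otimes> inv z"
    using z by (auto intro: inv_comm) (metis inv_closed inv_solve_left inv_solve_right m_assoc m_closed)
  obtain h where h: "\<And>i. linear_map ?R (F i) (F (Suc i)) (h i)"
    and h0: "\<And>x. x \<in> carrier (F 0) \<Longrightarrow> d (Suc 0) (h 0 x) = x \<ominus>\<^bsub>F 0\<^esub> (group_element (inv z) \<odot>\<^bsub>F 0\<^esub> x)"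
    and hS: "\<And>i x. x \<in> carrier (F (Suc i)) \<Longrightarrow> d (Suc (Suc i)) (h (Suc i) x) \<oplus>\<^bsub>F (Suc i)\<^esub> h i (d (Suc i) x)
       = x \<ominus>\<^bsub>F (Suc i)\<^esub> (group_element (inv z) \<odot>\<^bsub>F (Suc i)\<^esub> x)"
    using central_action_homotopic_to_identity[OF res w] by metis
  define Q where "Q = ergodic_potential z N"
  have Q: "linear_map ?R (lp_module G p) (lp_module G p) Q"
    unfolding Q_def by (rule linear_map_ergodic_potential[OF z p])
  interpret M: left_module ?R "F i" by (rule FM)
  interpret T: tensor_pair ?R "to_right_module G (F i)" "lp_module G p"
    by (rule tensor_pair_lp[OF p FM])
  have xsj: "xs ! j \<in> carrier (F i)" if "j < length xs" for j using xs that nth_mem by blast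
  have q: "Q (f j) \<in> lp_space G p" if "j < length xs" for j
    using linear_map_closed[OF Q, of "f j"] f[OF that] by simp
  have f'c: "f' j \<in> lp_space G p" if "j < length xs" for j
    unfolding f'[OF that] by (intro lp_space_diff ergodic_average_lp_space z f that p)
  define D where "D x = x \<ominus>\<^bsub>F i\<^esub> (group_element (inv z) \<odot>\<^bsub>F i\<^esub> x)" for x
  have dh: "d (Suc i) (h i x) \<in> carrier (F i)" if "x \<in> carrier (F i)" for x
    by (intro linear_map_closed[OF d] linear_map_closed[OF h] that)
  \<comment> \<open>The tensor relation for \<open>z\<close>, read through the right module
    structure: \<open>x \<otimes> z y = (inv z) x \<otimes> y\<close>.\<close>
  have move: "T.tc (frag_of (x, \<lambda>g. y g - translate G z y g)) = T.tc (frag_of (D x, y))"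
    if x: "x \<in> carrier (F i)" and y: "y \<in> lp_space G p" for x y
  proof -
    have zy: "translate G z y \<in> lp_space G p" by (rule translate_lp_space[OF z(1) y])
    have wx: "group_element (inv z) \<odot>\<^bsub>F i\<^esub> x \<in> carrier (F i)" using x w(1) by (intro M.smult_closed) auto
    have "T.tc (frag_of (x, \<lambda>g. y g - translate G z y g)) = T.tc (frag_of (x, y \<oplus>\<^bsub>lp_module G p\<^esub> (\<ominus>\<^bsub>lp_module G p\<^esub> translate G z y)))"
      using a_inv_lp_module[OF p zy] by simp
    also have "\<dots> = T.tc (frag_of (x, y) + frag_of (x, \<ominus>\<^bsub>lp_module G p\<^esub> translate G z y))"
      using x y zy T.N.a_inv_closed by (intro T.tensor_class_add_right) auto
    also have "\<dots> = T.tc (frag_of (x, y) + - frag_of (group_element (inv z) \<odot>\<^bsub>F i\<^esub> x, y))"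
    proof (rule T.tensor_class_add_cong[OF refl])
      have "T.tc (frag_of (x, \<ominus>\<^bsub>lp_module G p\<^esub> translate G z y)) = T.tc (- frag_of (x, translate G z y))"
        using x zy by (intro T.tensor_class_minus_right) auto
      also have "T.tc (frag_of (x, translate G z y)) = T.tc (frag_of (group_element (inv z) \<odot>\<^bsub>F i\<^esub> x, y))"
        using T.tensor_class_smult[of "group_element z" x y] x y z(1)
        by (simp add: group_convolution_group_element_complex group_ring_involution_group_element)
      then have "T.tc (- frag_of (x, translate G z y)) = T.tc (- frag_of (group_element (inv z) \<odot>\<^bsub>F i\<^esub> x, y))"
        by (rule T.tensor_class_minus_cong)
      finally show "T.tc (frag_of (x, \<ominus>\<^bsub>lp_module G p\<^esub> translate G z y)) = T.tc (- frag_of (group_element (inv z) \<odot>\<^bsub>F i\<^esub> x, y))" .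
    qed
    also have "\<dots> = T.tc (frag_of (x, y) + frag_of (\<ominus>\<^bsub>F i\<^esub> (group_element (inv z) \<odot>\<^bsub>F i\<^esub> x), y))"
      using T.tensor_class_minus_left[of "group_element (inv z) \<odot>\<^bsub>F i\<^esub> x" y] wx y
      by (intro T.tensor_class_add_cong refl) simp
    also have "\<dots> = T.tc (frag_of (D x, y))"
      using T.tensor_class_add_left[of x "\<ominus>\<^bsub>F i\<^esub> (group_element (inv z) \<odot>\<^bsub>F i\<^esub> x)" y] wx x y
      by (simp add: D_def a_minus_def)
    finally show ?thesis .
  qed
  have key: "T.tc (\<Sum>j<length xs. frag_of (D (xs ! j), Q (f j))) = T.tc (\<Sum>j<length xs. frag_of (d (Suc i) (h i (xs ! j)), Q (f j)))"
  proof (cases i)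
    case 0
    have "D (xs ! j) = d (Suc i) (h i (xs ! j))" if "j < length xs" for j
      using h0[of "xs ! j"] xsj[OF that] by (simp add: D_def 0)
    then show ?thesis by simp
  next
    case (Suc k)
    interpret B: tensor_pair ?R "to_right_module G (F k)" "lp_module G p"
      by (rule tensor_pair_lp[OF p FM])
    have di: "linear_map ?R (F i) (F k) (d i)" using d[of k] by (simp add: Suc)
    have hk: "linear_map ?R (F k) (F i) (h k)" using h[of k] by (simp add: Suc)
    have dxs: "set (map (d i) xs) \<subseteq> carrier (F k)" using xs linear_map_closed[OF di] by auto
    have "lp_chain_sum G p (F k) (map (d i) xs) f = \<one>\<^bsub>lp_chains G p (F k)\<^esub>"
      using lp_chain_sum_in_cycles_iff[OF res p, of xs k f] xs f cyc by (simp add: Suc)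
    then have "B.tc (\<Sum>j<length xs. frag_of (d i (xs ! j), f j)) = \<one>\<^bsub>B.T\<^esub>"
      using lp_chain_sum_eq[OF FM p dxs, of f] f by (simp add: lp_chains_def)
    then have "(\<Sum>j<length xs. frag_of (d i (xs ! j), f j)) \<in> B.K"
      by (simp only: B.tensor_class_eq_one_iff)
    \<comment> \<open>The cycle condition is an equality in degree \<open>k\<close>; applying
      \<open>h k\<close> to the left and \<open>Q\<close> to the right entries of its formal sum
      carries it to degree \<open>i\<close>.\<close>
    from tensor_bimap_kernel[OF B.tensor_pair_axioms T.tensor_pair_axioms linear_map_to_right_module[OF hk] Q this]
    have K: "(\<Sum>j<length xs. frag_of (h k (d i (xs ! j)), Q (f j))) \<in> T.K"
      by (simp add: frag_extend_sum o_def)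
    have "T.tc (\<Sum>j<length xs. frag_of (D (xs ! j), Q (f j))) =
        T.tc (\<Sum>j<length xs. frag_of (d (Suc i) (h i (xs ! j)), Q (f j)) + frag_of (h k (d i (xs ! j)), Q (f j)))"
    proof (rule T.tensor_class_sum_cong)
      fix j assume "j \<in> {..<length xs}"
      then have j: "j < length xs" by simp
      have "D (xs ! j) = d (Suc i) (h i (xs ! j)) \<oplus>\<^bsub>F i\<^esub> h k (d i (xs ! j))"
        using hS[of "xs ! j" k] xsj[OF j] by (simp add: D_def Suc)
      then show "T.tc (frag_of (D (xs ! j), Q (f j))) =
          T.tc (frag_of (d (Suc i) (h i (xs ! j)), Q (f j)) + frag_of (h k (d i (xs ! j)), Q (f j)))"
        using T.tensor_class_add_left[of "d (Suc i) (h i (xs ! j))" "h k (d i (xs ! j))" "Q (f j)"]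
          dh[OF xsj[OF j]] linear_map_closed[OF hk linear_map_closed[OF di xsj[OF j]]] q[OF j]
        by simp
    qed
    also have "\<dots> = T.tc ((\<Sum>j<length xs. frag_of (d (Suc i) (h i (xs ! j)), Q (f j))) + 0)"
      unfolding sum.distrib by (intro T.tensor_class_add_cong refl) (use K in \<open>simp add: T.tensor_class_eq_iff\<close>)
    finally show ?thesis by simp
  qed
  have hxs: "set (map (h i) xs) \<subseteq> carrier (F (Suc i))" using xs linear_map_closed[OF h] by auto
  have dhxs: "set (map (d (Suc i)) (map (h i) xs)) \<subseteq> carrier (F i)" using xs dh by auto
  have "lp_chain_sum G p (F i) xs f' = T.tc (\<Sum>j<length xs. frag_of (xs ! j, f' j))"
    by (rule lp_chain_sum_eq[OF FM p xs]) (rule f'c)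
  also have "\<dots> = T.tc (\<Sum>j<length xs. frag_of (D (xs ! j), Q (f j)))"
  proof (rule T.tensor_class_sum_cong)
    fix j assume "j \<in> {..<length xs}"
    then have j: "j < length xs" by simp
    have "f' j = (\<lambda>g. Q (f j) g - translate G z (Q (f j)) g)"
      unfolding f'[OF j] Q_def ergodic_potential_minus_translate[OF z(1) f[OF j] N] ..
    then show "T.tc (frag_of (xs ! j, f' j)) = T.tc (frag_of (D (xs ! j), Q (f j)))"
      using move[OF xsj[OF j] q[OF j]] by (simp only:)
  qed
  also note key
  also have "T.tc (\<Sum>j<length xs. frag_of (d (Suc i) (h i (xs ! j)), Q (f j))) =
      lp_chain_sum G p (F i) (map (d (Suc i)) (map (h i) xs)) (\<lambda>j. Q (f j))"
    using lp_chain_sum_eq[OF FM p dhxs, of "\<lambda>j. Q (f j)"] q by simp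
  also have "\<dots> = lp_boundary G p F d (Suc i) (lp_chain_sum G p (F (Suc i)) (map (h i) xs) (\<lambda>j. Q (f j)))"
    by (rule lp_boundary_chain_sum[OF res p hxs, symmetric]) (use q in simp)
  finally show ?thesis
    by (rule image_eqI) (rule lp_chain_sum_closed[OF FM p hxs], use q in simp)
qed

text \<open>An open neighbourhood of the chain pulls back along \<open>xs\<close> to an open set of
  coefficient tuples containing \<open>f\<close>. The tuples with the averages subtracted converge
  to \<open>f\<close>, so they eventually enter it, and their chain sums are boundaries.\<close>

lemma lp_cycle_in_closure_of_boundaries:
  assumes res: "projective_resolution G F d \<epsilon>" and p: "p > 1"
    and z: "z \<in> carrier G" "\<And>y. y \<in> carrier G \<Longrightarrow> z \<otimes> y = y \<otimes> z" "inj (\<lambda>k::nat. z [^] k)"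
    and c: "c \<in> lp_cycles G p F d i"
  shows "c \<in> lp_chain_topology G p (F i) closure_of
    (lp_boundary G p F d (Suc i) ` carrier (lp_chains G p (F (Suc i))))"
proof -
  have p1: "p \<ge> 1" using p by simp
  note FM = projective_resolution_left_module[OF res]
  have cc: "c \<in> carrier (lp_chains G p (F i))" using subgroup.subset[OF subgroup_lp_cycles[OF res p1]] c by blast
  obtain xs f where xs: "set xs \<subseteq> carrier (F i)" and f: "f \<in> {..<length xs} \<rightarrow>\<^sub>E lp_space G p"
    and eq: "c = lp_chain_sum G p (F i) xs f"
    using lp_chain_exhaust[OF FM p1 cc] by blast
  have fj: "f j \<in> lp_space G p" if "j < length xs" for j using f that by auto
  define f' where "f' N = (\<lambda>j\<in>{..<length xs}. \<lambda>g. f j g - ergodic_average z N (f j) g)" for N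
  let ?Y = "product_topology (\<lambda>j. lp_topology G p) {..<length xs}"
  have f'c: "f' N \<in> {..<length xs} \<rightarrow>\<^sub>E lp_space G p" for N
    unfolding f'_def using p1 fj z(1) by (auto intro!: lp_space_diff ergodic_average_lp_space)
  have lim: "limitin ?Y f' f sequentially"
    unfolding limitin_componentwise
  proof (intro conjI ballI)
    show "f \<in> extensional {..<length xs}" using f by (simp add: PiE_def)
    show "\<forall>\<^sub>F N in sequentially. f' N \<in> topspace ?Y"
      using f'c p1 by (intro always_eventually) simp
    fix j assume j: "j \<in> {..<length xs}"
    then show "limitin (lp_topology G p) (\<lambda>N. f' N j) (f j) sequentially"
      using limitin_minus_ergodic_average[OF z(1,3) fj p] by (simp add: f'_def)
  qed
  show ?thesis
    unfolding in_closure_of topspace_lp_chain_topology[OF FM p1]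
  proof (intro conjI cc allI impI)
    fix U assume U: "c \<in> U \<and> openin (lp_chain_topology G p (F i)) U"
    let ?V = "{f \<in> {..<length xs} \<rightarrow>\<^sub>E lp_space G p. lp_chain_sum G p (F i) xs f \<in> U}"
    have "openin ?Y ?V" using U xs by (simp add: openin_lp_chain_topology lp_chain_open_def)
    moreover have "f \<in> ?V" using f U eq by simp
    ultimately have "\<forall>\<^sub>F N in sequentially. f' N \<in> ?V" using lim unfolding limitin_def by blast
    \<comment> \<open>At \<open>N = 0\<close> nothing is subtracted, and the chain itself need not
      be a boundary.\<close>
    then have "\<forall>\<^sub>F N in sequentially. f' N \<in> ?V \<and> N > 0"
      using eventually_gt_at_top by (rule eventually_conj)
    then obtain N where N: "f' N \<in> ?V" "N > 0" by (auto dest: eventually_happens)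
    have "lp_chain_sum G p (F i) xs (f' N) \<in> lp_boundary G p F d (Suc i) ` carrier (lp_chains G p (F (Suc i)))"
      by (rule lp_chain_sum_minus_average_in_boundaries[OF res p1 z(1,2) xs fj c[unfolded eq] N(2)])
        (auto simp: f'_def)
    then show "\<exists>y. y \<in> lp_boundary G p F d (Suc i) ` carrier (lp_chains G p (F (Suc i))) \<and> y \<in> U"
      using N(1) by blast
  qed
qed

theorem trivial_reduced_lp_homology:
  assumes res: "projective_resolution G F d \<epsilon>" and p: "p > 1"
    and z: "z \<in> carrier G" "\<And>y. y \<in> carrier G \<Longrightarrow> z \<otimes> y = y \<otimes> z" "inj (\<lambda>k::nat. z [^] k)"
  shows "trivial_group (reduced_lp_homology G p F d i)"
proof -
  have p1: "p \<ge> 1" using p by simp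
  interpret T: tensor_pair "int_group_ring G" "to_right_module G (F i)" "lp_module G p"
    by (rule tensor_pair_lp[OF p1 projective_resolution_left_module[OF res]])
  interpret GT: comm_group T.T by (rule T.comm_group_tensor_product)
  let ?B = "lp_boundary G p F d (Suc i) ` carrier (lp_chains G p (F (Suc i)))"
  have "lp_chain_topology G p (F i) closure_of ?B = lp_cycles G p F d i"
  proof
    show "lp_chain_topology G p (F i) closure_of ?B \<subseteq> lp_cycles G p F d i"
      by (rule closure_of_minimal[OF lp_boundaries_subset_cycles[OF res p1] closedin_lp_cycles[OF res p1]])
    show "lp_cycles G p F d i \<subseteq> lp_chain_topology G p (F i) closure_of ?B"
      using lp_cycle_in_closure_of_boundaries[OF res p z] by blast
  qed
  then show ?thesis
    using trivial_group_Mod_self[OF _ subgroup_lp_cycles[OF res p1, of i]] GT.group_axioms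
    by (simp add: reduced_lp_homology_def lp_chains_def)
qed

end

theorem proposition6p6:
  fixes G :: "('g, 'x) monoid_scheme"
    and p :: real
    and F :: "nat \<Rightarrow> ('g \<Rightarrow> int, 'm) module"
    and d :: "nat \<Rightarrow> 'm \<Rightarrow> 'm"
    and \<epsilon> :: "'m \<Rightarrow> int"
    and n i :: nat
  assumes "p > 1"
    and "group G"
    and "finitely_generated_group G"
    and "infinite (carrier G)"
    and "nilpotent_group G"
    and "projective_resolution G F d \<epsilon>"
    and "\<forall>j\<le>n. finitely_generated_module (int_group_ring G) (F j)"
    and "i \<le> n"
  shows "trivial_group (reduced_lp_homology G p F d i) \<and>
         trivial_group (reduced_lp_cohomology G p F d i)"
proof -
  interpret group G by fact
  obtain z where z: "z \<in> carrier G" "\<And>y. y \<in> carrier G \<Longrightarrow> z \<otimes>\<^bsub>G\<^esub> y = y \<otimes>\<^bsub>G\<^esub> z" "inj (\<lambda>k::nat. z [^]\<^bsub>G\<^esub> k)"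
    using infinite_order_central_element[OF assms(3,5,4)] by blast
  show ?thesis
    using trivial_reduced_lp_homology[OF assms(6,1) z] trivial_reduced_lp_cohomology[OF assms(6,1) z] by blast
qed

end
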